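(* Let $U\subset\mathbb{R}^2$ be open and let $f,g$ be positive locally Lipschitz functions on $U$. Let $v>0$ and let $E$ be a minimiser of $I(v):=\inf\{P_g(F): F \text{ of finite perimeter in } U,\ V_f(F)=v\}$. Then the boundary of $E$ is almost minimal in $U$: for every relatively compact open set $V\subset U$ there exist $T\in(0,\operatorname{dist}(V,\partial U))$ and $K>0$ such that for every $x\in V$ and $r\in(0,T)$, $$P(E,B(x,r))-\inf\{P(F,B(x,r)): F \text{ of finite perimeter in } U,\ F\Delta E\subset\subset B(x,r)\}\le K r^2.$$
   Context: $V_f(F)=\int_F f\,dx$, $P_g(F)=\int_U g\,d|D\chi_F|$, and $P(F,W)=|D\chi_F|(W)$ is the (unweighted) perimeter of $F$ relative to an open set $W$. *)

theory Defs
  imports "HOL-Analysis.Analysis"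
begin

type_synonym R2 = "real^2"

definition divergence :: "(R2 \<Rightarrow> R2) \<Rightarrow> R2 \<Rightarrow> real" where
  "divergence \<phi> x = (\<Sum>i\<in>UNIV. frechet_derivative \<phi> (at x) (axis i 1) $ i)"

definition test_fields :: "R2 set \<Rightarrow> (R2 \<Rightarrow> R2) set" where
  "test_fields W = {\<phi>. (\<forall>x. \<phi> differentiable (at x))
      \<and> (\<forall>i. continuous_on UNIV (\<lambda>x. frechet_derivative \<phi> (at x) (axis i 1)))
      \<and> compact (closure {x. \<phi> x \<noteq> 0}) \<and> closure {x. \<phi> x \<noteq> 0} \<subseteq> W
      \<and> (\<forall>x. norm (\<phi> x) \<le> 1)}"

definition perimeter :: "R2 set \<Rightarrow> R2 set \<Rightarrow> ennreal" where
  "perimeter F W = (SUP \<phi>\<in>test_fields W.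
      ennreal (\<integral>x. indicator F x * divergence \<phi> x \<partial>lebesgue))"

definition finite_perimeter_in :: "R2 set \<Rightarrow> R2 set \<Rightarrow> bool" where
  "finite_perimeter_in U F \<longleftrightarrow> F \<in> sets lebesgue \<and> F \<subseteq> U \<and> perimeter F U < \<infinity>"

text \<open>The total variation measure |D chi_F| on (the Borel sets of) U,
  obtained from its values on open sets by outer regularity.\<close>
definition Dchi :: "R2 set \<Rightarrow> R2 set \<Rightarrow> R2 measure" where
  "Dchi U F = measure_of U (sets (restrict_space borel U))
      (\<lambda>A. INF W\<in>{W. open W \<and> A \<subseteq> W \<and> W \<subseteq> U}. perimeter F W)"

definition wperimeter :: "R2 set \<Rightarrow> (R2 \<Rightarrow> real) \<Rightarrow> R2 set \<Rightarrow> ennreal" where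
  "wperimeter U g F = (\<integral>\<^sup>+x. ennreal (g x) \<partial>Dchi U F)"

definition wvolume :: "(R2 \<Rightarrow> real) \<Rightarrow> R2 set \<Rightarrow> ennreal" where
  "wvolume f F = (\<integral>\<^sup>+x. indicator F x * ennreal (f x) \<partial>lebesgue)"

definition locally_lipschitz_on :: "R2 set \<Rightarrow> (R2 \<Rightarrow> real) \<Rightarrow> bool" where
  "locally_lipschitz_on U f \<longleftrightarrow>
     (\<forall>x\<in>U. \<exists>e>0. \<exists>L. L-lipschitz_on (cball x e \<inter> U) f)"

end

(* The boundary of E accumulates at some point y other than the given p. A mollification and density
   argument shows that near y the set E cannot have small gradients in every disc and direction, so the
   volume of E changes at a definite rate when E is pushed along a suitable bump vector field
   supported near y; by the Piola identity this costs weighted perimeter at most linearly in the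
   displacement. Hence any modification of E inside a disc of radius r about p can be completed to a
   competitor of the right volume with additional cost O(r^2). Deleting the disc shows that the
   perimeter of E there is O(r), and then the oscillation O(r) of the Lipschitz weight g also
   contributes only O(r^2). *)
theory Submission imports Defs begin

text \<open>Nothing is used about the fine structure of sets of finite perimeter: no reduced
  boundary, normal vector or Gauss-Green formula. A direction of volume change must come out of the
  definition of the perimeter alone, by contraposition: small gradients of the mollified indicator
  at all scales make a disc full or empty of \<open>E\<close> up to a null set. A nonzero gradient
  would not be enough. Since \<open>f\<close> is only Lipschitz, displacing \<open>E\<close> by t in
  a disc of radius \<epsilon> changes its volume by a term linear in t with an error of up to 7 pi L
  \<epsilon>^2 |t|, which is of the same order in t. The gradient has to exceed C \<epsilon>^2 for a
  prescribed C, and this dictates working near y at a radius of order 1/C. The point y can avoid p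
  because a point carries no perimeter; the correction and the modification then live in disjoint
  sets and do not interact. The weighted perimeter of \<open>E\<close> must be finite before common
  parts can be cancelled. As \<open>g\<close> may blow up at the boundary of U, this needs a
  separate competitor, a finite union of discs.\<close>

section \<open>Continuously differentiable maps of compact support\<close>

definition C1 :: "(R2 \<Rightarrow> 'b::real_normed_vector) \<Rightarrow> bool" where
  "C1 u \<longleftrightarrow> (\<forall>x. u differentiable (at x)) \<and>
     (\<forall>v. continuous_on UNIV (\<lambda>x. frechet_derivative u (at x) v))"

abbreviation fd :: "(R2 \<Rightarrow> 'b::real_normed_vector) \<Rightarrow> R2 \<Rightarrow> R2 \<Rightarrow> 'b" where
  "fd u x \<equiv> frechet_derivative u (at x)"

abbreviation supp :: "(R2 \<Rightarrow> 'b::real_normed_vector) \<Rightarrow> R2 set" where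
  "supp u \<equiv> closure {x. u x \<noteq> 0}"

lemma fd_eq: "(u has_derivative u') (at x) \<Longrightarrow> fd u x = u'"
  using frechet_derivative_at by metis

lemma C1I:
  assumes "\<And>x. (u has_derivative u' x) (at x)"
    and "\<And>v. continuous_on UNIV (\<lambda>x. u' x v)"
  shows "C1 u"
proof -
  have "fd u x = u' x" for x using fd_eq assms(1) by blast
  then show ?thesis unfolding C1_def using assms
    by (auto simp: differentiable_def)
qed

lemma C1_has_derivative: "C1 u \<Longrightarrow> (u has_derivative fd u x) (at x)"
  unfolding C1_def using frechet_derivative_works by blast

lemma C1_continuous: "C1 u \<Longrightarrow> continuous_on S u"
  by (rule continuous_at_imp_continuous_on) (auto intro: has_derivative_continuous C1_has_derivative)

lemma C1_fd_continuous: "C1 u \<Longrightarrow> continuous_on S (\<lambda>x. fd u x v)"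
  by (rule continuous_on_subset[of UNIV]) (simp_all add: C1_def)

lemma linear_axis_expansion:
  fixes L :: "R2 \<Rightarrow> 'b::real_vector"
  assumes "linear L"
  shows "L v = (\<Sum>i\<in>UNIV. v $ i *\<^sub>R L (axis i 1))"
proof -
  have "v = (\<Sum>i\<in>UNIV. v $ i *\<^sub>R axis i 1)"
    by (simp add: basis_expansion scalar_mult_eq_scaleR[symmetric])
  then have "L v = L (\<Sum>i\<in>UNIV. v $ i *\<^sub>R axis i 1)" by simp
  then show ?thesis using assms by (simp add: linear_sum linear_cmul)
qed

lemma C1_linear: "C1 u \<Longrightarrow> linear (fd u x)"
  using C1_has_derivative has_derivative_linear by blast

text \<open>The definition asks for continuity of the derivative only along the coordinate axes; by
  linearity of the derivative this gives every direction.\<close>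

lemma test_fields_eq:
  "test_fields W = {\<phi>. C1 \<phi> \<and> compact (supp \<phi>) \<and> supp \<phi> \<subseteq> W \<and> (\<forall>x. norm (\<phi> x) \<le> 1)}"
proof -
  have "C1 \<phi> \<longleftrightarrow> (\<forall>x. \<phi> differentiable (at x))
      \<and> (\<forall>i. continuous_on UNIV (\<lambda>x. fd \<phi> x (axis i 1)))" for \<phi> :: "R2 \<Rightarrow> R2"
  proof
    assume R: "(\<forall>x. \<phi> differentiable (at x))
      \<and> (\<forall>i. continuous_on UNIV (\<lambda>x. fd \<phi> x (axis i 1)))"
    have "linear (fd \<phi> x)" for x
      using R frechet_derivative_works has_derivative_linear by blast
    then have "(\<lambda>x. fd \<phi> x v) = (\<lambda>x. \<Sum>i\<in>UNIV. v $ i *\<^sub>R fd \<phi> x (axis i 1))" for v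
      using linear_axis_expansion by blast
    moreover have "continuous_on UNIV (\<lambda>x. \<Sum>i\<in>UNIV. v $ i *\<^sub>R fd \<phi> x (axis i 1))" for v
      using R by (intro continuous_intros) auto
    ultimately show "C1 \<phi>" unfolding C1_def using R by metis
  qed (auto simp: C1_def)
  then show ?thesis unfolding test_fields_def by auto
qed

lemma supp_zero: "x \<notin> supp u \<Longrightarrow> u x = 0"
  using closure_subset[of "{x. u x \<noteq> 0}"] by blast

lemma fd_zero_outside:
  assumes "x \<notin> supp u"
  shows "(u has_derivative (\<lambda>v. 0)) (at x)" "fd u x = (\<lambda>v. 0)"
proof -
  show *: "(u has_derivative (\<lambda>v. 0)) (at x)"
  proof (rule has_derivative_transform_within_open[where f="\<lambda>x. 0" and s="- supp u"])
    show "0 = u y" if "y \<in> - supp u" for y using that supp_zero[of y u] by simp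
  qed (use assms in \<open>auto simp: open_Compl\<close>)
  then show "fd u x = (\<lambda>v. 0)" by (rule fd_eq)
qed

lemma C1_fd_bound:
  fixes u :: "R2 \<Rightarrow> 'b::real_normed_vector"
  assumes "C1 u" "compact (supp u)"
  obtains M where "M > 0" "\<And>x v. norm (fd u x v) \<le> M * norm v"
proof -
  have "\<exists>B. \<forall>x\<in>supp u. norm (fd u x (axis i 1)) \<le> B" for i
  proof -
    have "bounded ((\<lambda>x. fd u x (axis i 1)) ` supp u)"
      using assms C1_fd_continuous compact_continuous_image compact_imp_bounded by blast
    then show ?thesis unfolding bounded_iff by blast
  qed
  then have "\<forall>i. \<exists>B. \<forall>x\<in>supp u. norm (fd u x (axis i 1)) \<le> B" by blast
  then obtain B where B: "\<And>i x. x \<in> supp u \<Longrightarrow> norm (fd u x (axis i 1)) \<le> B i"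
    unfolding choice_iff by blast
  \<comment> \<open>The bounds of the two coordinate directions add up; the extra 1 makes
    \<open>M\<close> positive even if the derivative vanishes.\<close>
  define M where "M = (\<Sum>i\<in>UNIV. \<bar>B i\<bar>) + 1"
  have "norm (fd u x v) \<le> M * norm v" for x v
  proof (cases "x \<in> supp u")
    case True
    have "norm (fd u x v) = norm (\<Sum>i\<in>UNIV. v $ i *\<^sub>R fd u x (axis i 1))"
      using linear_axis_expansion[OF C1_linear[OF assms(1)]] by metis
    also have "\<dots> \<le> (\<Sum>i\<in>UNIV. norm v * \<bar>B i\<bar>)"
      by (rule order_trans[OF norm_sum sum_mono])
         (auto intro!: mult_mono component_le_norm_cart order_trans[OF B[OF True]])
    also have "\<dots> \<le> M * norm v"
      by (simp add: M_def sum_distrib_left[symmetric] algebra_simps)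
    finally show ?thesis .
  next
    case False
    have "M \<ge> 0" by (simp add: M_def sum_nonneg)
    with False show ?thesis by (simp add: fd_zero_outside(2))
  qed
  moreover have "M > 0" by (simp add: M_def add_nonneg_pos sum_nonneg)
  ultimately show ?thesis using that by blast
qed

lemma C1_lipschitz_bound:
  fixes u :: "R2 \<Rightarrow> 'b::real_normed_vector"
  assumes "C1 u" "\<And>x v. norm (fd u x v) \<le> M * norm v"
  shows "norm (u y - u x) \<le> M * norm (y - x)"
proof (rule differentiable_bound[OF convex_UNIV])
  show "(u has_derivative fd u x) (at x within UNIV)" for x
    using C1_has_derivative[OF assms(1)] by simp
  show "onorm (fd u x) \<le> M" for x
    using assms(2) onorm_le by blast
qed auto

lemma continuous_compact_support_bounded:
  fixes w :: "R2 \<Rightarrow> 'b::real_normed_vector"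
  assumes "continuous_on UNIV w" "compact K" "\<And>x. x \<notin> K \<Longrightarrow> w x = 0"
  obtains B where "B > 0" "\<And>x. norm (w x) \<le> B"
proof -
  have "bounded (w ` K)"
    by (rule compact_imp_bounded[OF compact_continuous_image])
       (use assms continuous_on_subset in blast)+
  then obtain B where "B > 0" "\<And>x. x \<in> K \<Longrightarrow> norm (w x) \<le> B"
    unfolding bounded_pos by blast
  then have "norm (w x) \<le> B" for x using assms(3) by (cases "x \<in> K") (auto simp: less_imp_le)
  then show ?thesis using that \<open>B > 0\<close> by blast
qed

lemma integrable_bounded_support:
  fixes w :: "R2 \<Rightarrow> real"
  assumes "w \<in> borel_measurable lebesgue" "bounded K" "\<And>x. x \<notin> K \<Longrightarrow> w x = 0"
    "\<And>x. \<bar>w x\<bar> \<le> B"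
  shows "integrable lebesgue w"
proof -
  obtain r where r: "K \<subseteq> ball 0 r" using assms(2) bounded_subset_ballD by blast
  have "emeasure lebesgue (ball (0::R2) r) < \<infinity>"
    using emeasure_bounded_finite[OF bounded_ball] by simp
  then show ?thesis
  proof (intro integrableI_bounded_set[where A="ball 0 r" and B=B] AE_I2)
    show "x \<notin> ball 0 r \<longrightarrow> w x = 0" for x using assms(3) r by blast
  qed (use assms in auto)
qed

lemma measurable_continuous_lebesgue:
  fixes w :: "R2 \<Rightarrow> 'b::real_normed_vector"
  shows "continuous_on UNIV w \<Longrightarrow> w \<in> borel_measurable lebesgue"
  by (simp add: measurable_completion borel_measurable_continuous_onI)

lemma integrable_indicator_continuous:
  fixes w :: "R2 \<Rightarrow> real"
  assumes "F \<in> sets lebesgue" "continuous_on UNIV w" "compact K" "\<And>x. x \<notin> K \<Longrightarrow> w x = 0"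
  shows "integrable lebesgue (\<lambda>x. indicator F x * w x)"
proof -
  obtain B where B: "B > 0" "\<And>x. norm (w x) \<le> B"
    using continuous_compact_support_bounded assms by metis
  have [measurable]: "w \<in> borel_measurable lebesgue"
    using assms measurable_continuous_lebesgue by blast
  note assms(1)[measurable]
  show ?thesis
  proof (rule integrable_bounded_support[where K=K and B=B])
    show "\<bar>indicator F x * w x\<bar> \<le> B" for x
      using B by (auto simp: indicator_def less_imp_le)
  qed (use assms compact_imp_bounded in auto)
qed

lemma continuous_divergence: "C1 \<phi> \<Longrightarrow> continuous_on S (divergence \<phi>)"
  unfolding divergence_def[abs_def]
  by (intro continuous_intros C1_fd_continuous)

lemma divergence_outside: "x \<notin> supp \<phi> \<Longrightarrow> divergence \<phi> x = 0"
  by (simp add: divergence_def fd_zero_outside(2))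

lemma integrable_divergence:
  "\<lbrakk>F \<in> sets lebesgue; C1 \<phi>; compact (supp \<phi>)\<rbrakk> \<Longrightarrow>
    integrable lebesgue (\<lambda>x. indicator F x * divergence \<phi> x)"
  by (rule integrable_indicator_continuous[OF _ continuous_divergence, where K="supp \<phi>"])
     (auto intro: divergence_outside)

lemma
  fixes \<eta> :: "R2 \<Rightarrow> real" and \<phi> :: "R2 \<Rightarrow> 'b::real_normed_vector"
  assumes "C1 \<eta>" "C1 \<phi>"
  shows C1_scaleR: "C1 (\<lambda>x. \<eta> x *\<^sub>R \<phi> x)"
    and fd_scaleR: "fd (\<lambda>x. \<eta> x *\<^sub>R \<phi> x) x = (\<lambda>v. \<eta> x *\<^sub>R fd \<phi> x v + fd \<eta> x v *\<^sub>R \<phi> x)"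
proof -
  have *: "((\<lambda>x. \<eta> x *\<^sub>R \<phi> x) has_derivative
      (\<lambda>v. \<eta> x *\<^sub>R fd \<phi> x v + fd \<eta> x v *\<^sub>R \<phi> x)) (at x)" for x
    using has_derivative_scaleR[OF C1_has_derivative[OF assms(1)] C1_has_derivative[OF assms(2)]] .
  show "C1 (\<lambda>x. \<eta> x *\<^sub>R \<phi> x)"
    by (rule C1I[OF *]) (intro continuous_intros C1_fd_continuous C1_continuous assms)
  show "fd (\<lambda>x. \<eta> x *\<^sub>R \<phi> x) x = (\<lambda>v. \<eta> x *\<^sub>R fd \<phi> x v + fd \<eta> x v *\<^sub>R \<phi> x)"
    using * fd_eq by blast
qed

lemma divergence_scaleR:
  assumes "C1 \<eta>" "C1 \<phi>"
  shows "divergence (\<lambda>x. \<eta> x *\<^sub>R \<phi> x) x = \<eta> x * divergence \<phi> x + fd \<eta> x (\<phi> x)"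
proof -
  have "fd \<eta> x (\<phi> x) = (\<Sum>i\<in>UNIV. fd \<eta> x (axis i 1) * \<phi> x $ i)"
    using linear_axis_expansion[OF C1_linear[OF assms(1)], of x "\<phi> x"] by (simp add: mult.commute)
  then show ?thesis
    by (simp add: divergence_def fd_scaleR[OF assms] sum.distrib sum_distrib_left)
qed

lemma
  assumes "C1 \<phi>" "C1 \<psi>"
  shows C1_add: "C1 (\<lambda>x. \<phi> x + \<psi> x)"
    and fd_add: "fd (\<lambda>x. \<phi> x + \<psi> x) x = (\<lambda>v. fd \<phi> x v + fd \<psi> x v)"
proof -
  have *: "((\<lambda>x. \<phi> x + \<psi> x) has_derivative (\<lambda>v. fd \<phi> x v + fd \<psi> x v)) (at x)" for x
    by (intro has_derivative_add C1_has_derivative assms)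
  show "C1 (\<lambda>x. \<phi> x + \<psi> x)"
    by (rule C1I[OF *]) (intro continuous_intros C1_fd_continuous assms)
  show "fd (\<lambda>x. \<phi> x + \<psi> x) x = (\<lambda>v. fd \<phi> x v + fd \<psi> x v)"
    using * fd_eq by blast
qed

lemma C1_const: "C1 (\<lambda>x. c)"
  by (rule C1I[of _ "\<lambda>_ _. 0"]) auto

lemma fd_const: "fd (\<lambda>x. c) x = (\<lambda>v. 0)"
  by (rule fd_eq) auto

lemma divergence_add:
  "C1 \<phi> \<Longrightarrow> C1 \<psi> \<Longrightarrow> divergence (\<lambda>x. \<phi> x + \<psi> x) x = divergence \<phi> x + divergence \<psi> x"
  by (simp add: divergence_def fd_add sum.distrib)

lemma divergence_cmul:
  assumes "C1 \<phi>"
  shows "C1 (\<lambda>x. c *\<^sub>R \<phi> x)" "divergence (\<lambda>x. c *\<^sub>R \<phi> x) x = c * divergence \<phi> x"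
  using C1_scaleR[OF C1_const assms] divergence_scaleR[OF C1_const assms] by (simp_all add: fd_const)

lemma supp_subset_scaleR:
  fixes \<eta> :: "R2 \<Rightarrow> real" and \<phi> :: "R2 \<Rightarrow> 'b::real_normed_vector"
  shows "supp (\<lambda>x. \<eta> x *\<^sub>R \<phi> x) \<subseteq> supp \<eta>" "supp (\<lambda>x. \<eta> x *\<^sub>R \<phi> x) \<subseteq> supp \<phi>"
  by (auto intro!: closure_mono)

lemma compact_supp_subset: "compact K \<Longrightarrow> supp u \<subseteq> K \<Longrightarrow> compact (supp u)"
  by (metis closed_closure compact_Int_closed inf.absorb_iff2)

lemma supp_subset_closed: "closed K \<Longrightarrow> (\<And>x. x \<notin> K \<Longrightarrow> u x = 0) \<Longrightarrow> supp u \<subseteq> K"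
  by (rule closure_minimal) auto

section \<open>Divergences of compactly supported fields integrate to zero\<close>

lemma lebesgue_integral_translate:
  fixes u :: "R2 \<Rightarrow> real"
  assumes "continuous_on UNIV u"
  shows "(\<integral>x. u (x + a) \<partial>lebesgue) = (\<integral>x. u x \<partial>lebesgue)"
proof -
  have m: "u \<in> borel_measurable lborel"
    using assms by (simp add: borel_measurable_continuous_onI)
  have m2: "(\<lambda>x. u (x + a)) \<in> borel_measurable lborel"
    using m by measurable
  have "(\<integral>x. u x \<partial>lborel) = (\<integral>x. u x \<partial>distr lborel borel ((+) a))"
    by (simp add: lborel_distr_plus)
  also have "\<dots> = (\<integral>x. u (a + x) \<partial>lborel)"
    using m by (intro integral_distr) auto
  finally show ?thesis using m m2 by (simp add: integral_completion add.commute)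
qed

text \<open>Difference quotients integrate to zero by translation invariance, and they converge to
  the derivative under the dominating function given by the Lipschitz bound on a fixed disc.\<close>

lemma integral_fd_zero:
  fixes u :: "R2 \<Rightarrow> real"
  assumes "C1 u" "compact (supp u)"
  shows "(\<integral>x. fd u x v \<partial>lebesgue) = 0"
proof -
  obtain M where M: "M > 0" "\<And>x v. norm (fd u x v) \<le> M * norm v"
    using C1_fd_bound assms by metis
  obtain r where r: "supp u \<subseteq> ball 0 r"
    using assms(2) compact_imp_bounded bounded_subset_ballD by blast
  \<comment> \<open>Increments of at most 1 keep all translated supports inside the disc of radius
    \<open>r + norm v\<close>, which makes one dominating function serve for all
    \<open>n\<close>.\<close>
  define s where "s n = 1 / (real n + 1)" for n :: nat
  have s: "s n > 0" "s n \<le> 1" for n by (auto simp: s_def)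
  define q where "q n x = (u (x + s n *\<^sub>R v) - u x) / s n" for n x
  have cu: "continuous_on UNIV u" using C1_continuous assms(1) by blast
  have cq: "continuous_on UNIV (\<lambda>x. u (x + s n *\<^sub>R v))" for n
    by (intro continuous_on_compose2[OF cu] continuous_intros) auto
  have bq: "\<bar>q n x\<bar> \<le> indicator (ball 0 (r + norm v)) x * (M * norm v)" for n x
  proof (cases "x \<in> ball 0 (r + norm v)")
    case True
    have "\<bar>u (x + s n *\<^sub>R v) - u x\<bar> \<le> M * norm (s n *\<^sub>R v)"
      using C1_lipschitz_bound[OF assms(1) M(2), of "x + s n *\<^sub>R v" x] by simp
    then show ?thesis using True s[of n] by (simp add: q_def abs_divide divide_simps mult_ac)
  next
    case False
    have "norm x \<ge> r + norm v" using False by simp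
    moreover have "norm (x + s n *\<^sub>R v) \<ge> norm x - norm v"
      using s[of n] norm_triangle_ineq4[of "x + s n *\<^sub>R v" "s n *\<^sub>R v"]
      by (simp add: mult_left_le_one_le[of "norm v" "s n"])
         (smt (verit) mult_left_le_one_le norm_ge_zero)
    ultimately have "norm x \<ge> r" "norm (x + s n *\<^sub>R v) \<ge> r"
      using norm_ge_zero[of v] by linarith+
    then have "x \<notin> ball 0 r" "x + s n *\<^sub>R v \<notin> ball 0 r" by simp_all
    then have "u x = 0" "u (x + s n *\<^sub>R v) = 0"
      using r supp_zero[of x u] supp_zero[of "x + s n *\<^sub>R v" u] by blast+
    then show ?thesis using M(1) by (simp add: q_def)
  qed
  have int0: "integrable lebesgue (\<lambda>x. indicator (ball (0::R2) (r + norm v)) x * (M * norm v))"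
  proof -
    have "emeasure lebesgue (ball (0::R2) (r + norm v)) < \<infinity>"
      using emeasure_bounded_finite[OF bounded_ball] by simp
    then show ?thesis by simp
  qed
  have "(\<lambda>n. \<integral>x. q n x \<partial>lebesgue) \<longlonglongrightarrow> (\<integral>x. fd u x v \<partial>lebesgue)"
  proof (rule integral_dominated_convergence[OF _ _ int0])
    show "(\<lambda>x. fd u x v) \<in> borel_measurable lebesgue"
      using C1_fd_continuous assms measurable_continuous_lebesgue by blast
    show "q n \<in> borel_measurable lebesgue" for n
      unfolding q_def[abs_def]
      by (intro measurable_continuous_lebesgue continuous_intros cq cu) (use s[of n] in auto)
    show "AE x in lebesgue. (\<lambda>n. q n x) \<longlonglongrightarrow> fd u x v"
    proof (intro AE_I2)
      fix x
      have "((\<lambda>t. u (x + t *\<^sub>R v)) has_vector_derivative fd u x v) (at 0)"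
      proof -
        have "(u has_derivative fd u x) (at (x + 0 *\<^sub>R v))"
          using C1_has_derivative assms(1) by simp
        moreover have "((\<lambda>t. x + t *\<^sub>R v) has_derivative (\<lambda>t. t *\<^sub>R v)) (at 0)"
          by (auto intro!: derivative_eq_intros)
        ultimately have "((\<lambda>t. u (x + t *\<^sub>R v)) has_derivative (\<lambda>t. fd u x (t *\<^sub>R v))) (at 0)"
          using has_derivative_compose[of "\<lambda>t. x + t *\<^sub>R v" "\<lambda>t. t *\<^sub>R v" 0 UNIV u] by auto
        then show ?thesis
          unfolding has_vector_derivative_def
          using linear_cmul[OF C1_linear[OF assms(1)]] by (simp add: fun_eq_iff)
      qed
      then have "((\<lambda>t. u (x + t *\<^sub>R v)) has_real_derivative fd u x v) (at 0)"
        by (simp add: has_real_derivative_iff_has_vector_derivative)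
      then have lim: "((\<lambda>h. (u (x + h *\<^sub>R v) - u x) / h) \<longlongrightarrow> fd u x v) (at 0)"
        by (simp add: DERIV_def)
      moreover have "filterlim s (at 0) sequentially"
      proof -
        have "s \<longlonglongrightarrow> 0" unfolding s_def
          using LIMSEQ_inverse_real_of_nat by (simp add: inverse_eq_divide add.commute)
        then show ?thesis using s by (auto simp: filterlim_at less_imp_neq[symmetric] eventually_sequentially)
      qed
      ultimately show "(\<lambda>n. q n x) \<longlonglongrightarrow> fd u x v"
        unfolding q_def using filterlim_compose by blast
    qed
    show "AE x in lebesgue. norm (q n x) \<le> indicator (ball 0 (r + norm v)) x * (M * norm v)" for n
      using bq by simp
  qed
  moreover have "(\<integral>x. q n x \<partial>lebesgue) = 0" for n
  proof -
    have i1: "integrable lebesgue u"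
      using integrable_indicator_continuous[OF _ cu assms(2) supp_zero[of _ u], of UNIV] by simp
    have i2: "integrable lebesgue (\<lambda>x. u (x + s n *\<^sub>R v))"
    proof -
      have K: "compact ((\<lambda>x. x - s n *\<^sub>R v) ` supp u)"
        by (intro compact_continuous_image continuous_intros assms)
      have "u (x + s n *\<^sub>R v) = 0" if "x \<notin> (\<lambda>x. x - s n *\<^sub>R v) ` supp u" for x
        using that supp_zero[of "x + s n *\<^sub>R v" u]
        by (metis add_diff_cancel image_eqI)
      from integrable_indicator_continuous[OF _ cq K this, of UNIV] show ?thesis by simp
    qed
    show ?thesis unfolding q_def
      using i1 i2 lebesgue_integral_translate[OF cu] by simp
  qed
  ultimately have "(\<lambda>n::nat. 0::real) \<longlonglongrightarrow> (\<integral>x. fd u x v \<partial>lebesgue)" by simp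
  then show ?thesis using LIMSEQ_unique[OF tendsto_const] by metis
qed

lemma integral_divergence_zero:
  assumes "C1 \<phi>" "compact (supp \<phi>)"
  shows "(\<integral>x. divergence \<phi> x \<partial>lebesgue) = 0"
proof -
  have c: "C1 (\<lambda>x. \<phi> x $ i)" "fd (\<lambda>x. \<phi> x $ i) x = (\<lambda>v. fd \<phi> x v $ i)" for i x
  proof -
    have *: "((\<lambda>x. \<phi> x $ i) has_derivative (\<lambda>v. fd \<phi> x v $ i)) (at x)" for x
      by (rule has_derivative_compose[OF C1_has_derivative[OF assms(1)]])
         (simp add: bounded_linear.has_derivative[OF bounded_linear_vec_nth])
    show "C1 (\<lambda>x. \<phi> x $ i)"
      by (rule C1I[OF *]) (intro continuous_intros C1_fd_continuous assms)
    show "fd (\<lambda>x. \<phi> x $ i) x = (\<lambda>v. fd \<phi> x v $ i)" using * fd_eq by blast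
  qed
  have K: "compact (supp (\<lambda>x. \<phi> x $ i))" for i
    by (rule compact_supp_subset[OF assms(2)]) (auto intro!: closure_mono)
  have i: "integrable lebesgue (\<lambda>x. fd (\<lambda>x. \<phi> x $ i) x v)" for i v
    using integrable_indicator_continuous[of UNIV "\<lambda>x. fd (\<lambda>x. \<phi> x $ i) x v" "supp (\<lambda>x. \<phi> x $ i)"]
      K C1_fd_continuous[OF c(1)] fd_zero_outside(2)[of _ "\<lambda>x. \<phi> x $ i"] by auto
  have "divergence \<phi> x = (\<Sum>i\<in>UNIV. fd (\<lambda>x. \<phi> x $ i) x (axis i 1))" for x
    by (simp add: divergence_def c(2))
  then show ?thesis
    using i integral_fd_zero[OF c(1) K] by simp
qed

section \<open>Elementary properties of the perimeter\<close>

abbreviation divint :: "R2 set \<Rightarrow> (R2 \<Rightarrow> R2) \<Rightarrow> real" where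
  "divint F \<phi> \<equiv> \<integral>x. indicator F x * divergence \<phi> x \<partial>lebesgue"

lemma test_fieldsD:
  assumes "\<phi> \<in> test_fields W"
  shows "C1 \<phi>" "compact (supp \<phi>)" "supp \<phi> \<subseteq> W" "\<And>x. norm (\<phi> x) \<le> 1"
  using assms by (auto simp: test_fields_eq)

lemma test_fieldsI:
  "C1 \<phi> \<Longrightarrow> compact (supp \<phi>) \<Longrightarrow> supp \<phi> \<subseteq> W \<Longrightarrow> (\<And>x. norm (\<phi> x) \<le> 1) \<Longrightarrow> \<phi> \<in> test_fields W"
  by (auto simp: test_fields_eq)

lemma zero_test_field: "(\<lambda>x. 0) \<in> test_fields W"
  by (rule test_fieldsI) (auto simp: C1_const)

lemma perimeter_upper: "\<phi> \<in> test_fields W \<Longrightarrow> ennreal (divint F \<phi>) \<le> perimeter F W"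
  unfolding perimeter_def by (rule SUP_upper)

lemma perimeter_least:
  "(\<And>\<phi>. \<phi> \<in> test_fields W \<Longrightarrow> ennreal (divint F \<phi>) \<le> c) \<Longrightarrow> perimeter F W \<le> c"
  unfolding perimeter_def by (rule SUP_least)

lemma test_fields_mono: "W \<subseteq> W' \<Longrightarrow> test_fields W \<subseteq> test_fields W'"
  by (auto simp: test_fields_eq)

lemma perimeter_mono: "W \<subseteq> W' \<Longrightarrow> perimeter F W \<le> perimeter F W'"
  unfolding perimeter_def by (intro SUP_subset_mono test_fields_mono) auto

lemma perimeter_empty: "perimeter F {} = 0"
proof -
  have "ennreal (divint F \<phi>) \<le> 0" if "\<phi> \<in> test_fields {}" for \<phi>
  proof -
    have "x \<notin> supp \<phi>" for x using test_fieldsD(3)[OF that, THEN subsetD, of x] by (metis empty_iff)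
    then have "divergence \<phi> x = 0" for x by (rule divergence_outside)
    then show ?thesis by simp
  qed
  then show ?thesis using perimeter_least[of "{}" F 0] by simp
qed

lemma divint_cong:
  assumes "F \<in> sets lebesgue" "G \<in> sets lebesgue" "\<phi> \<in> test_fields W"
    "AE x in lebesgue. x \<in> W \<longrightarrow> (x \<in> F \<longleftrightarrow> x \<in> G)"
  shows "divint F \<phi> = divint G \<phi>"
proof (rule integral_cong_AE)
  note f = integrable_divergence[OF _ test_fieldsD(1,2)[OF assms(3)]]
  show "(\<lambda>x. indicator F x * divergence \<phi> x) \<in> borel_measurable lebesgue"
    "(\<lambda>x. indicator G x * divergence \<phi> x) \<in> borel_measurable lebesgue"
    using f[OF assms(1)] f[OF assms(2)] by blast+
  show "AE x in lebesgue. indicator F x * divergence \<phi> x = indicator G x * divergence \<phi> x"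
    using assms(4)
  proof eventually_elim
    case (elim x)
    then show ?case
    proof (cases "x \<in> W")
      case True
      with elim show ?thesis by (simp add: indicator_def)
    next
      case False
      then have "x \<notin> supp \<phi>" using test_fieldsD(3)[OF assms(3)] by blast
      then show ?thesis by (simp add: divergence_outside)
    qed
  qed
qed

lemma perimeter_cong:
  assumes "F \<in> sets lebesgue" "G \<in> sets lebesgue"
    "AE x in lebesgue. x \<in> W \<longrightarrow> (x \<in> F \<longleftrightarrow> x \<in> G)"
  shows "perimeter F W = perimeter G W"
  unfolding perimeter_def using divint_cong[OF assms(1,2) _ assms(3)] by simp

lemma perimeter_cong_on:
  assumes "F \<in> sets lebesgue" "G \<in> sets lebesgue" "F \<inter> W = G \<inter> W"
  shows "perimeter F W = perimeter G W"
  by (rule perimeter_cong[OF assms(1,2)]) (use assms(3) in auto)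

lemma test_fields_scaleR:
  assumes "C1 \<phi>" "compact (supp \<phi>)" "supp \<phi> \<subseteq> W" "\<And>x. norm (c *\<^sub>R \<phi> x) \<le> 1"
  shows "(\<lambda>x. c *\<^sub>R \<phi> x) \<in> test_fields W"
proof (rule test_fieldsI)
  have s: "supp (\<lambda>x. c *\<^sub>R \<phi> x) \<subseteq> supp \<phi>" by (auto intro!: closure_mono)
  show "compact (supp (\<lambda>x. c *\<^sub>R \<phi> x))" by (rule compact_supp_subset[OF assms(2) s])
  show "supp (\<lambda>x. c *\<^sub>R \<phi> x) \<subseteq> W" by (rule subset_trans[OF s assms(3)])
qed (use assms(4) divergence_cmul(1)[OF assms(1)] in simp_all)

lemma divint_cmul:
  assumes "C1 \<phi>"
  shows "divint F (\<lambda>x. c *\<^sub>R \<phi> x) = c * divint F \<phi>"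
proof -
  have "indicator F x * divergence (\<lambda>x. c *\<^sub>R \<phi> x) x = c * (indicator F x * divergence \<phi> x)" for x
    using divergence_cmul(2)[OF assms, of c x] by simp
  then have "divint F (\<lambda>x. c *\<^sub>R \<phi> x) = (\<integral>x. c * (indicator F x * divergence \<phi> x) \<partial>lebesgue)"
    by presburger
  then show ?thesis by simp
qed

text \<open>Since a divergence integrates to zero, passing to the complement only changes the sign
  of \<open>divint\<close>, and test fields are closed under sign change. Statements about full sets
  and added discs thereby reduce to null sets and deleted discs.\<close>

lemma perimeter_Compl:
  assumes F: "F \<in> sets lebesgue"
  shows "perimeter (- F) W = perimeter F W"
proof -
  have *: "perimeter (- F) W \<le> perimeter F W" if F: "F \<in> sets lebesgue" for F
  proof (rule perimeter_least)
    fix \<phi> assume \<phi>: "\<phi> \<in> test_fields W"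
    note D = test_fieldsD[OF \<phi>]
    have m: "(\<lambda>x. (-1) *\<^sub>R \<phi> x) \<in> test_fields W"
      by (rule test_fields_scaleR) (use D in auto)
    have "indicator (- F) x * divergence \<phi> x = divergence \<phi> x - indicator F x * divergence \<phi> x" for x
      by (simp add: indicator_def)
    then have "divint (- F) \<phi> = (\<integral>x. divergence \<phi> x - indicator F x * divergence \<phi> x \<partial>lebesgue)"
      by simp
    also have "\<dots> = - divint F \<phi>"
      using integrable_divergence[OF F D(1,2)] integrable_divergence[OF _ D(1,2), of UNIV]
        integral_divergence_zero[OF D(1,2)] by simp
    also have "\<dots> = divint F (\<lambda>x. (-1) *\<^sub>R \<phi> x)"
      using divint_cmul[OF D(1), of F "-1"] by simp
    finally show "ennreal (divint (- F) \<phi>) \<le> perimeter F W"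
      using perimeter_upper[OF m] by simp
  qed
  have "- F \<in> sets lebesgue" using F by (simp add: Compl_in_sets_lebesgue)
  from *[OF F] *[OF this] show ?thesis by simp
qed

lemma perimeter_null:
  assumes "F \<in> sets lebesgue" "AE x in lebesgue. x \<in> W \<longrightarrow> x \<notin> F"
  shows "perimeter F W = 0"
proof -
  have "perimeter F W = perimeter {} W"
    by (rule perimeter_cong) (use assms in auto)
  then show ?thesis using perimeter_least[of W "{}" 0] by simp
qed

lemma perimeter_conull:
  assumes "F \<in> sets lebesgue" "AE x in lebesgue. x \<in> W \<longrightarrow> x \<in> F"
  shows "perimeter F W = 0"
proof -
  have "perimeter (- F) W = 0"
    by (rule perimeter_null) (use assms in \<open>auto simp: Compl_in_sets_lebesgue\<close>)
  then show ?thesis using perimeter_Compl assms by simp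
qed

lemma divint_add:
  assumes "F \<in> sets lebesgue" "C1 \<phi>" "compact (supp \<phi>)" "C1 \<psi>" "compact (supp \<psi>)"
  shows "divint F (\<lambda>x. \<phi> x + \<psi> x) = divint F \<phi> + divint F \<psi>"
proof -
  have "divint F (\<lambda>x. \<phi> x + \<psi> x) =
    (\<integral>x. indicator F x * divergence \<phi> x + indicator F x * divergence \<psi> x \<partial>lebesgue)"
    using divergence_add[OF assms(2,4)] by (simp add: distrib_left)
  also have "\<dots> = divint F \<phi> + divint F \<psi>"
    using assms integrable_divergence by (intro Bochner_Integration.integral_add) auto
  finally show ?thesis .
qed

lemma test_fields_add_disjoint:
  assumes "\<phi> \<in> test_fields W" "\<psi> \<in> test_fields W" "supp \<phi> \<inter> supp \<psi> = {}"
  shows "(\<lambda>x. \<phi> x + \<psi> x) \<in> test_fields W"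
proof (rule test_fieldsI)
  have s: "supp (\<lambda>x. \<phi> x + \<psi> x) \<subseteq> supp \<phi> \<union> supp \<psi>"
  proof (rule supp_subset_closed)
    show "\<phi> x + \<psi> x = 0" if "x \<notin> supp \<phi> \<union> supp \<psi>" for x
      using that supp_zero[of x \<phi>] supp_zero[of x \<psi>] by simp
  qed (rule closed_Un[OF closed_closure closed_closure])
  show "supp (\<lambda>x. \<phi> x + \<psi> x) \<subseteq> W"
    using s test_fieldsD(3)[OF assms(1)] test_fieldsD(3)[OF assms(2)] by blast
  show "compact (supp (\<lambda>x. \<phi> x + \<psi> x))"
    by (rule compact_supp_subset[OF compact_Un s]) (use assms test_fieldsD in auto)
  show "norm (\<phi> x + \<psi> x) \<le> 1" for x
  proof (cases "x \<in> supp \<phi>")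
    case True
    then have "x \<notin> supp \<psi>" using assms(3) by blast
    then have "\<psi> x = 0" by (rule supp_zero)
    then show ?thesis using test_fieldsD(4)[OF assms(1)] by simp
  next
    case False
    then have "\<phi> x = 0" by (rule supp_zero)
    then show ?thesis using test_fieldsD(4)[OF assms(2)] by simp
  qed
  show "C1 (\<lambda>x. \<phi> x + \<psi> x)" using assms C1_add test_fieldsD(1) by blast
qed

text \<open>Fields with disjoint supports can be added without exceeding norm 1. Fixing one field
  and removing its support leaves room for all fields of \<open>W'\<close>; this is the source of
  the additivity of the variation measure.\<close>

lemma perimeter_split_field:
  assumes F: "F \<in> sets lebesgue" and \<phi>: "\<phi> \<in> test_fields W" and W': "W' \<subseteq> W - supp \<phi>"
  shows "ennreal (divint F \<phi>) + perimeter F W' \<le> perimeter F W"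
proof -
  have "ennreal (divint F \<phi>) + ennreal (divint F \<psi>) \<le> perimeter F W"
    if \<psi>: "\<psi> \<in> test_fields W'" for \<psi>
  proof -
    have \<psi>W: "\<psi> \<in> test_fields W" using \<psi> W' test_fields_mono[of W' W] by blast
    have "(\<lambda>x. \<phi> x + \<psi> x) \<in> test_fields W"
      by (rule test_fields_add_disjoint[OF \<phi> \<psi>W]) (use W' test_fieldsD(3)[OF \<psi>] in blast)
    from perimeter_upper[OF this, of F]
    have le: "ennreal (divint F \<phi> + divint F \<psi>) \<le> perimeter F W"
      using divint_add[OF F] test_fieldsD(1,2)[OF \<phi>] test_fieldsD(1,2)[OF \<psi>] by simp
    \<comment> \<open>\<open>ennreal\<close> truncates negative numbers to 0, so the two values add
      up only if both are nonnegative; otherwise one summand disappears.\<close>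
    consider "divint F \<phi> < 0" | "divint F \<psi> < 0" | "divint F \<phi> \<ge> 0" "divint F \<psi> \<ge> 0"
      by linarith
    then show ?thesis
    proof cases
      case 1
      then show ?thesis using perimeter_upper[OF \<psi>W, of F] by (simp add: ennreal_neg)
    next
      case 2
      then show ?thesis using perimeter_upper[OF \<phi>, of F] by (simp add: ennreal_neg)
    next
      case 3
      then show ?thesis using le by (simp add: ennreal_plus)
    qed
  qed
  moreover have "test_fields W' \<noteq> {}" using zero_test_field by blast
  ultimately show ?thesis unfolding perimeter_def[of F W']
    by (subst ennreal_SUP_add_right) (auto intro!: SUP_least)
qed

subsection \<open>Bumps and cutoff functions\<close>

text \<open>At the kink the difference quotient is at most the \<open>n\<close>-th power of the
  increment in absolute value, so \<open>n \<ge> 1\<close> makes it tend to 0. All bumps and cutoffs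
  below are built from these truncated powers, whose derivatives are explicit.\<close>

lemma has_real_derivative_pos_part_power:
  fixes s :: real
  assumes "n \<ge> 1"
  shows "((\<lambda>s. (max 0 s) ^ Suc n) has_real_derivative (real (Suc n) * (max 0 s) ^ n)) (at s)"
proof -
  consider "s > 0" | "s < 0" | "s = 0" by linarith
  then show ?thesis
  proof cases
    case 1
    have "((\<lambda>s::real. s ^ Suc n) has_real_derivative (real (Suc n) * s ^ n)) (at s)"
      by (rule DERIV_cong[OF DERIV_pow]) simp
    then have "((\<lambda>s::real. (max 0 s) ^ Suc n) has_real_derivative (real (Suc n) * s ^ n)) (at s)"
      by (rule has_field_derivative_transform_within_open[where S="{0<..}"]) (use 1 in auto)
    then show ?thesis using 1 by simp
  next
    case 2
    have "((\<lambda>s::real. (max 0 s) ^ Suc n) has_real_derivative 0) (at s)"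
      by (rule has_field_derivative_transform_within_open[OF DERIV_const, where S="{..<0}"])
         (use 2 in auto)
    then show ?thesis using 2 assms by (simp add: power_0_left)
  next
    case 3
    have "((\<lambda>h. ((max 0 (0 + h)) ^ Suc n - (max 0 (0::real)) ^ Suc n) / h) \<longlongrightarrow> 0) (at 0)"
    proof (rule Lim_null_comparison[where g="\<lambda>h. \<bar>h\<bar> ^ n"])
      have "norm (((max 0 (0 + h)) ^ Suc n - (max 0 (0::real)) ^ Suc n) / h) \<le> \<bar>h\<bar> ^ n" for h :: real
        by (cases "h > 0") (auto simp: max_def)
      then show "\<forall>\<^sub>F h in at 0. norm (((max 0 (0 + h)) ^ Suc n - (max 0 (0::real)) ^ Suc n) / h) \<le> \<bar>h\<bar> ^ n"
        by simp
      have "((\<lambda>h::real. \<bar>h\<bar> ^ n) \<longlongrightarrow> \<bar>0\<bar> ^ n) (at 0)"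
        by (intro tendsto_intros)
      moreover have "\<bar>0::real\<bar> ^ n = 0" using assms by (simp add: power_0_left)
      ultimately show "((\<lambda>h::real. \<bar>h\<bar> ^ n) \<longlongrightarrow> 0) (at 0)" by metis
    qed
    then show ?thesis using 3 assms by (simp add: DERIV_def power_0_left)
  qed
qed

text \<open>The third power makes the function twice continuously differentiable. Two derivatives
  are required because the Piola transform contains the gradient and must itself be a test field up
  to scaling.\<close>

definition bump :: "R2 \<Rightarrow> real \<Rightarrow> R2 \<Rightarrow> real" where
  "bump z \<epsilon> x = (max 0 (1 - (norm (x - z))\<^sup>2 / \<epsilon>\<^sup>2)) ^ 3"

definition bump_grad :: "R2 \<Rightarrow> real \<Rightarrow> R2 \<Rightarrow> R2" where
  "bump_grad z \<epsilon> x = (- (6 / \<epsilon>\<^sup>2) * (max 0 (1 - (norm (x - z))\<^sup>2 / \<epsilon>\<^sup>2))\<^sup>2) *\<^sub>R (x - z)"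

definition bump_hess :: "R2 \<Rightarrow> real \<Rightarrow> R2 \<Rightarrow> R2 \<Rightarrow> R2" where
  "bump_hess z \<epsilon> x v =
     (24 / \<epsilon>^4 * max 0 (1 - (norm (x - z))\<^sup>2 / \<epsilon>\<^sup>2) * ((x - z) \<bullet> v)) *\<^sub>R (x - z)
     - (6 / \<epsilon>\<^sup>2 * (max 0 (1 - (norm (x - z))\<^sup>2 / \<epsilon>\<^sup>2))\<^sup>2) *\<^sub>R v"

lemma bump_inner_derivative:
  fixes z :: R2
  shows "((\<lambda>x. 1 - (norm (x - z))\<^sup>2 / \<epsilon>\<^sup>2) has_derivative (\<lambda>v. - (2 / \<epsilon>\<^sup>2) * ((x - z) \<bullet> v))) (at x)"
proof -
  have "((\<lambda>x. 1 - k * (norm (x - z))\<^sup>2) has_derivative (\<lambda>v. - (2 * k) * ((x - z) \<bullet> v))) (at x)" for k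
    unfolding power2_norm_eq_inner
    by (auto intro!: derivative_eq_intros simp: inner_commute algebra_simps)
  from this[of "1 / \<epsilon>\<^sup>2"] show ?thesis by simp
qed

lemma bump_derivative: "(bump z \<epsilon> has_derivative (\<lambda>v. bump_grad z \<epsilon> x \<bullet> v)) (at x)"
proof -
  let ?s = "\<lambda>x. 1 - (norm (x - z))\<^sup>2 / \<epsilon>\<^sup>2"
  have "((\<lambda>s::real. (max 0 s) ^ 3) has_real_derivative (3 * (max 0 (?s x)) ^ 2)) (at (?s x))"
    using has_real_derivative_pos_part_power[of 2 "?s x"] by (simp add: eval_nat_numeral)
  from has_derivative_compose[OF bump_inner_derivative this[unfolded has_field_derivative_def]]
  show ?thesis
    unfolding bump_def[abs_def] bump_grad_def
    by (rule has_derivative_eq_rhs) (simp add: fun_eq_iff)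
qed

lemma bump_grad_derivative: "(bump_grad z \<epsilon> has_derivative bump_hess z \<epsilon> x) (at x)"
proof -
  let ?s = "\<lambda>x. 1 - (norm (x - z))\<^sup>2 / \<epsilon>\<^sup>2"
  have "((\<lambda>s::real. (max 0 s)\<^sup>2) has_real_derivative (2 * max 0 (?s x))) (at (?s x))"
    using has_real_derivative_pos_part_power[of 1 "?s x"] by (simp add: eval_nat_numeral)
  from has_derivative_compose[OF bump_inner_derivative this[unfolded has_field_derivative_def]]
  have 1: "((\<lambda>x. (max 0 (?s x))\<^sup>2) has_derivative
      (\<lambda>v. 2 * max 0 (?s x) * (- (2 / \<epsilon>\<^sup>2) * ((x - z) \<bullet> v)))) (at x)" .
  have "((\<lambda>x. (- (6 / \<epsilon>\<^sup>2) * (max 0 (?s x))\<^sup>2) *\<^sub>R (x - z)) has_derivative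
      (\<lambda>v. (- (6 / \<epsilon>\<^sup>2) * (max 0 (?s x))\<^sup>2) *\<^sub>R v
        + (- (6 / \<epsilon>\<^sup>2) * (2 * max 0 (?s x) * (- (2 / \<epsilon>\<^sup>2) * ((x - z) \<bullet> v)))) *\<^sub>R (x - z))) (at x)"
    by (intro has_derivative_scaleR has_derivative_mult_right 1)
       (auto intro!: derivative_eq_intros)
  moreover have "(\<lambda>v. (- (6 / \<epsilon>\<^sup>2) * (max 0 (?s x))\<^sup>2) *\<^sub>R v
        + (- (6 / \<epsilon>\<^sup>2) * (2 * max 0 (?s x) * (- (2 / \<epsilon>\<^sup>2) * ((x - z) \<bullet> v)))) *\<^sub>R (x - z)) = bump_hess z \<epsilon> x"
  proof -
    have "- (6 / \<epsilon>\<^sup>2) * (2 * m * (- (2 / \<epsilon>\<^sup>2) * p)) = 24 / \<epsilon>^4 * m * p" for m p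
      by (simp add: power2_eq_square power4_eq_xxxx)
    then show ?thesis unfolding bump_hess_def by (simp add: fun_eq_iff)
  qed
  ultimately show ?thesis unfolding bump_grad_def[abs_def] by simp
qed

lemma bump_hess_symmetric: "bump_hess z \<epsilon> x v \<bullet> w = bump_hess z \<epsilon> x w \<bullet> v"
  by (simp add: bump_hess_def inner_diff_left inner_diff_right inner_commute mult_ac)

lemma continuous_bump_hess: "continuous_on S (\<lambda>x. bump_hess z \<epsilon> x v)"
proof -
  have "continuous_on S (\<lambda>x. (a * max 0 (1 - (norm (x - z))\<^sup>2 * k) * ((x - z) \<bullet> v)) *\<^sub>R (x - z)
     - (b * (max 0 (1 - (norm (x - z))\<^sup>2 * k))\<^sup>2) *\<^sub>R v)" for a b k
    by (intro continuous_intros)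
  from this[of "24 / \<epsilon>^4" "1 / \<epsilon>\<^sup>2" "6 / \<epsilon>\<^sup>2"] show ?thesis
    by (simp add: bump_hess_def)
qed

lemma continuous_bump_grad: "continuous_on S (bump_grad z \<epsilon>)"
  by (rule continuous_at_imp_continuous_on)
     (auto intro: has_derivative_continuous bump_grad_derivative)

lemma C1_bump: "C1 (bump z \<epsilon>)"
  by (rule C1I[OF bump_derivative]) (intro continuous_intros continuous_bump_grad)

lemma fd_bump: "fd (bump z \<epsilon>) x v = bump_grad z \<epsilon> x \<bullet> v"
  using fd_eq[OF bump_derivative] by metis

lemma bump_nonneg: "0 \<le> bump z \<epsilon> x"
  by (simp add: bump_def)

lemma bump_le_1: "bump z \<epsilon> x \<le> 1"
  unfolding bump_def by (rule power_le_one) auto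

lemma bump_outside:
  assumes "\<epsilon> > 0" "x \<notin> ball z \<epsilon>"
  shows "bump z \<epsilon> x = 0" "bump_grad z \<epsilon> x = 0"
proof -
  have "norm (x - z) \<ge> \<epsilon>" using assms(2) by (simp add: dist_norm norm_minus_commute)
  then have "1 - (norm (x - z))\<^sup>2 / \<epsilon>\<^sup>2 \<le> 0"
    using assms(1) by (simp add: divide_simps power_mono)
  then show "bump z \<epsilon> x = 0" "bump_grad z \<epsilon> x = 0" by (simp_all add: bump_def bump_grad_def)
qed

text \<open>Within half the radius the base of the cube is at least 1 - 1/4, and (3/4)^3 =
  27/64.\<close>

lemma bump_inside:
  assumes "\<epsilon> > 0" "x \<in> cball z (\<epsilon> / 2)"
  shows "bump z \<epsilon> x \<ge> 27 / 64"
proof -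
  have "norm (x - z) \<le> \<epsilon> / 2" using assms(2) by (simp add: dist_norm norm_minus_commute)
  then have "(norm (x - z))\<^sup>2 \<le> (\<epsilon> / 2)\<^sup>2" by (intro power_mono) auto
  then have "(norm (x - z))\<^sup>2 / \<epsilon>\<^sup>2 \<le> (\<epsilon> / 2)\<^sup>2 / \<epsilon>\<^sup>2" by (rule divide_right_mono) simp
  moreover have "(\<epsilon> / 2)\<^sup>2 / \<epsilon>\<^sup>2 = 1 / 4" using assms(1) by (simp add: power_divide)
  ultimately have "3 / 4 \<le> 1 - (norm (x - z))\<^sup>2 / \<epsilon>\<^sup>2" by linarith
  then have "3 / 4 \<le> max 0 (1 - (norm (x - z))\<^sup>2 / \<epsilon>\<^sup>2)"
    by (rule order_trans[OF _ max.cobounded2])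
  then have "(3 / 4) ^ 3 \<le> (max 0 (1 - (norm (x - z))\<^sup>2 / \<epsilon>\<^sup>2)) ^ 3"
    by (rule power_mono) simp
  then show ?thesis by (simp add: bump_def power3_eq_cube)
qed

lemma norm_bump_grad:
  assumes "\<epsilon> > 0"
  shows "norm (bump_grad z \<epsilon> x) \<le> 6 / \<epsilon>"
proof (cases "x \<in> ball z \<epsilon>")
  case True
  let ?m = "max 0 (1 - (norm (x - z))\<^sup>2 / \<epsilon>\<^sup>2)"
  have n: "norm (x - z) \<le> \<epsilon>" using True by (simp add: dist_norm norm_minus_commute)
  have "0 \<le> ?m" "?m \<le> 1" by auto
  then have "?m\<^sup>2 \<le> 1" by (simp add: power_le_one)
  then have "?m\<^sup>2 * norm (x - z) \<le> 1 * \<epsilon>" using n by (intro mult_mono) auto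
  then have "6 / \<epsilon>\<^sup>2 * (?m\<^sup>2 * norm (x - z)) \<le> 6 / \<epsilon>\<^sup>2 * \<epsilon>"
    by (intro mult_left_mono) auto
  also have "\<dots> = 6 / \<epsilon>" using assms by (simp add: power2_eq_square)
  finally show ?thesis by (simp add: bump_grad_def abs_mult)
next
  case False
  then show ?thesis using bump_outside[OF assms] assms by simp
qed

lemma
  fixes \<sigma> :: "R2 \<Rightarrow> real"
  assumes "C1 \<sigma>" "\<And>s. (\<theta> has_real_derivative \<theta>' s) (at s)" "continuous_on UNIV \<theta>'"
  shows C1_compose: "C1 (\<lambda>x. \<theta> (\<sigma> x))"
    and fd_compose: "fd (\<lambda>x. \<theta> (\<sigma> x)) x = (\<lambda>v. \<theta>' (\<sigma> x) * fd \<sigma> x v)"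
proof -
  have *: "((\<lambda>x. \<theta> (\<sigma> x)) has_derivative (\<lambda>v. \<theta>' (\<sigma> x) * fd \<sigma> x v)) (at x)" for x
    using has_derivative_compose[OF C1_has_derivative[OF assms(1)]
        assms(2)[unfolded has_field_derivative_def]] .
  show "C1 (\<lambda>x. \<theta> (\<sigma> x))"
  proof (rule C1I[OF *])
    show "continuous_on UNIV (\<lambda>x. \<theta>' (\<sigma> x) * fd \<sigma> x v)" for v
      by (intro continuous_intros continuous_on_compose2[OF assms(3)] C1_continuous
          C1_fd_continuous assms(1)) auto
  qed
  show "fd (\<lambda>x. \<theta> (\<sigma> x)) x = (\<lambda>v. \<theta>' (\<sigma> x) * fd \<sigma> x v)"
    using * fd_eq by blast
qed

lemma C1_sum:
  fixes \<sigma> :: "'i \<Rightarrow> R2 \<Rightarrow> 'b::real_normed_vector"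
  shows "finite I \<Longrightarrow> (\<And>i. i \<in> I \<Longrightarrow> C1 (\<sigma> i)) \<Longrightarrow> C1 (\<lambda>x. \<Sum>i\<in>I. \<sigma> i x)"
  by (induction I rule: finite_induct) (auto intro: C1_const C1_add)

text \<open>A finite sum of bumps is at least 27/64 near \<open>K\<close>; composing it with a
  profile that equals 1 from 27/64 on flattens it. The open set \<open>N\<close> is part of the
  conclusion so that multiplication by \<open>1 - \<eta>\<close> removes a whole neighbourhood of
  \<open>K\<close> from a support.\<close>

lemma C1_cutoff:
  fixes K O' :: "R2 set"
  assumes "compact K" "open O'" "K \<subseteq> O'"
  obtains \<eta> :: "R2 \<Rightarrow> real" and N where "C1 \<eta>" "\<And>x. 0 \<le> \<eta> x" "\<And>x. \<eta> x \<le> 1"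
    "compact (supp \<eta>)" "supp \<eta> \<subseteq> O'" "open N" "K \<subseteq> N" "\<And>x. x \<in> N \<Longrightarrow> \<eta> x = 1"
proof -
  have "\<exists>e>0. cball x e \<subseteq> O'" if "x \<in> K" for x
    using assms that open_contains_cball by blast
  then obtain e where e: "\<And>x. x \<in> K \<Longrightarrow> e x > 0" "\<And>x. x \<in> K \<Longrightarrow> cball x (e x) \<subseteq> O'"
    by metis
  have "K \<subseteq> (\<Union>x\<in>K. ball x (e x / 2))" using e(1) by fastforce
  then obtain I where I: "I \<subseteq> K" "finite I" "K \<subseteq> (\<Union>x\<in>I. ball x (e x / 2))"
    using compactE_image[OF assms(1), of K "\<lambda>x. ball x (e x / 2)"] by auto
  define N where "N = (\<Union>x\<in>I. ball x (e x / 2))"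
  define \<sigma> where "\<sigma> x = (\<Sum>z\<in>I. bump z (e z) x)" for x
  \<comment> \<open>It satisfies \<open>\<theta> 0 = 0\<close>, is constantly 1 for arguments of at
    least 27/64, and the square makes the junction continuously differentiable.\<close>
  define \<theta> :: "real \<Rightarrow> real" where "\<theta> s = 1 - (max 0 (1 - 64 / 27 * s)) ^ Suc 1" for s
  have C\<sigma>: "C1 \<sigma>" unfolding \<sigma>_def[abs_def] by (intro C1_sum I C1_bump)
  have \<sigma>0: "\<sigma> x \<ge> 0" for x unfolding \<sigma>_def by (intro sum_nonneg bump_nonneg)
  have \<sigma>N: "\<sigma> x \<ge> 27 / 64" if "x \<in> N" for x
  proof -
    obtain z where z: "z \<in> I" "x \<in> ball z (e z / 2)" using \<open>x \<in> N\<close> unfolding N_def by blast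
    have "27 / 64 \<le> bump z (e z) x"
      using bump_inside[of "e z" x z] z e(1) I(1) by fastforce
    also have "\<dots> \<le> \<sigma> x" unfolding \<sigma>_def
      by (rule member_le_sum) (use z I bump_nonneg in auto)
    finally show ?thesis .
  qed
  have d: "(\<theta> has_real_derivative (- (real (Suc 1) * (max 0 (1 - 64 / 27 * s)) ^ 1 * (- (64 / 27))))) (at s)" for s
  proof -
    have "((\<lambda>s. 1 - 64 / 27 * s) has_real_derivative (- (64 / 27))) (at s)"
      by (auto intro!: derivative_eq_intros)
    from DERIV_chain2[OF has_real_derivative_pos_part_power this, of 1]
    have "((\<lambda>s. (max 0 (1 - 64 / 27 * s)) ^ Suc 1) has_real_derivative
       (real (Suc 1) * (max 0 (1 - 64 / 27 * s)) ^ 1 * (- (64 / 27)))) (at s)" by simp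
    from DERIV_diff[OF DERIV_const this, of 1] show ?thesis unfolding \<theta>_def[abs_def] by simp
  qed
  define \<eta> where "\<eta> x = \<theta> (\<sigma> x)" for x
  have \<theta>01: "0 \<le> \<theta> s" "\<theta> s \<le> 1" if "s \<ge> 0" for s
  proof -
    have "(max 0 (1 - 64 / 27 * s)) ^ Suc 1 \<le> 1" using that by (intro power_le_one) auto
    then show "0 \<le> \<theta> s" by (simp add: \<theta>_def)
    show "\<theta> s \<le> 1" by (simp add: \<theta>_def)
  qed
  have sub: "supp \<eta> \<subseteq> (\<Union>z\<in>I. cball z (e z))"
  proof (rule supp_subset_closed)
    show "closed (\<Union>z\<in>I. cball z (e z))" using I(2) by auto
    fix x assume x: "x \<notin> (\<Union>z\<in>I. cball z (e z))"
    have "bump z (e z) x = 0" if "z \<in> I" for z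
      by (rule bump_outside) (use e(1) I(1) that x in auto)
    then show "\<eta> x = 0" by (simp add: \<eta>_def \<sigma>_def \<theta>_def)
  qed
  have cK: "compact (\<Union>z\<in>I. cball z (e z))" using I(2) by auto
  show ?thesis
  proof
    show "C1 \<eta>" unfolding \<eta>_def[abs_def]
      by (rule C1_compose[OF C\<sigma> d]) (intro continuous_intros)
    show "0 \<le> \<eta> x" "\<eta> x \<le> 1" for x using \<theta>01 \<sigma>0 by (auto simp: \<eta>_def)
    show "compact (supp \<eta>)" using compact_supp_subset[OF cK sub] .
    show "supp \<eta> \<subseteq> O'" using sub e(2) I(1) by blast
    show "open N" by (auto simp: N_def)
    show "K \<subseteq> N" using I(3) by (simp add: N_def)
    show "\<eta> x = 1" if "x \<in> N" for x
      using \<sigma>N[OF that] by (simp add: \<eta>_def \<theta>_def)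
  qed
qed

section \<open>Subadditivity of the perimeter on open sets\<close>

lemma test_fields_cutoff:
  assumes "\<phi> \<in> test_fields W'" "C1 \<eta>" "\<And>x. \<bar>\<eta> x\<bar> \<le> 1" "supp (\<lambda>x. \<eta> x *\<^sub>R \<phi> x) \<subseteq> W"
  shows "(\<lambda>x. \<eta> x *\<^sub>R \<phi> x) \<in> test_fields W"
proof (rule test_fieldsI[OF C1_scaleR _ assms(4)])
  show "compact (supp (\<lambda>x. \<eta> x *\<^sub>R \<phi> x))"
    using compact_supp_subset[OF test_fieldsD(2)[OF assms(1)] supp_subset_scaleR(2)] .
  show "norm (\<eta> x *\<^sub>R \<phi> x) \<le> 1" for x
    using mult_mono[OF assms(3)[of x] test_fieldsD(4)[OF assms(1), of x]] by simp
qed (use assms test_fieldsD in auto)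

text \<open>A partition of unity with two members splits a test field. The cutoff equals 1 near the
  part of the support that \<open>W2\<close> misses, so the complementary piece is supported in
  \<open>W2\<close>; factors between 0 and 1 preserve the norm bound.\<close>

lemma perimeter_subadd:
  assumes F: "F \<in> sets lebesgue" and "open W1" "open W2"
  shows "perimeter F (W1 \<union> W2) \<le> perimeter F W1 + perimeter F W2"
proof (rule perimeter_least)
  fix \<phi> assume \<phi>: "\<phi> \<in> test_fields (W1 \<union> W2)"
  note D = test_fieldsD[OF \<phi>]
  have "compact (supp \<phi> - W2)" using D(2) \<open>open W2\<close> by (simp add: compact_diff)
  moreover have "supp \<phi> - W2 \<subseteq> W1" using D(3) by blast
  ultimately obtain \<eta> :: "R2 \<Rightarrow> real" and N where \<eta>: "C1 \<eta>" "\<And>x. 0 \<le> \<eta> x" "\<And>x. \<eta> x \<le> 1"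
    "supp \<eta> \<subseteq> W1" "open N" "supp \<phi> - W2 \<subseteq> N" "\<And>x. x \<in> N \<Longrightarrow> \<eta> x = 1"
    using C1_cutoff[OF _ \<open>open W1\<close>] by metis
  have C': "C1 (\<lambda>x. 1 + (-1) *\<^sub>R \<eta> x)" using C1_add[OF C1_const divergence_cmul(1)] \<eta>(1)
    by (intro C1_add C1_const C1_scaleR \<eta>(1))
  have 1: "(\<lambda>x. \<eta> x *\<^sub>R \<phi> x) \<in> test_fields W1"
    by (rule test_fields_cutoff[OF \<phi> \<eta>(1)])
       (use \<eta>(2,3,4) supp_subset_scaleR(1)[of \<eta> \<phi>] in auto)
  have 2: "(\<lambda>x. (1 + (-1) *\<^sub>R \<eta> x) *\<^sub>R \<phi> x) \<in> test_fields W2"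
  proof (rule test_fields_cutoff[OF \<phi> C'])
    show "\<bar>1 + (-1) *\<^sub>R \<eta> x\<bar> \<le> 1" for x using \<eta>(2,3)[of x] by simp
    have "supp (\<lambda>x. (1 + (-1) *\<^sub>R \<eta> x) *\<^sub>R \<phi> x) \<subseteq> supp \<phi> - N"
    proof (rule supp_subset_closed)
      show "closed (supp \<phi> - N)" using \<eta>(5) by (simp add: closed_Diff)
      show "(1 + (-1) *\<^sub>R \<eta> x) *\<^sub>R \<phi> x = 0" if "x \<notin> supp \<phi> - N" for x
        using that \<eta>(7)[of x] supp_zero[of x \<phi>] by auto
    qed
    then show "supp (\<lambda>x. (1 + (-1) *\<^sub>R \<eta> x) *\<^sub>R \<phi> x) \<subseteq> W2" using \<eta>(6) by blast
  qed
  have "\<phi> = (\<lambda>x. \<eta> x *\<^sub>R \<phi> x + (1 + (-1) *\<^sub>R \<eta> x) *\<^sub>R \<phi> x)"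
    by (simp add: fun_eq_iff algebra_simps)
  then have "divint F \<phi> = divint F (\<lambda>x. \<eta> x *\<^sub>R \<phi> x + (1 + (-1) *\<^sub>R \<eta> x) *\<^sub>R \<phi> x)" by simp
  also have "\<dots> = divint F (\<lambda>x. \<eta> x *\<^sub>R \<phi> x) + divint F (\<lambda>x. (1 + (-1) *\<^sub>R \<eta> x) *\<^sub>R \<phi> x)"
    by (intro divint_add F test_fieldsD(1,2)[OF 1] test_fieldsD(1,2)[OF 2])
  finally have "ennreal (divint F \<phi>) \<le>
      ennreal (divint F (\<lambda>x. \<eta> x *\<^sub>R \<phi> x)) + ennreal (divint F (\<lambda>x. (1 + (-1) *\<^sub>R \<eta> x) *\<^sub>R \<phi> x))"
    by (simp add: ennreal_plus_if ennreal_leI)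
  also have "\<dots> \<le> perimeter F W1 + perimeter F W2"
    by (intro add_mono perimeter_upper 1 2)
  finally show "ennreal (divint F \<phi>) \<le> perimeter F W1 + perimeter F W2" .
qed

lemma perimeter_finite_subadd:
  assumes F: "F \<in> sets lebesgue" and "finite I" "\<And>i. i \<in> I \<Longrightarrow> open (W i)"
  shows "perimeter F (\<Union>i\<in>I. W i) \<le> (\<Sum>i\<in>I. perimeter F (W i))"
  using assms(2,3)
proof (induction I rule: finite_induct)
  case empty
  then show ?case by (simp add: perimeter_empty)
next
  case (insert i I)
  have "perimeter F (\<Union>i\<in>insert i I. W i) \<le> perimeter F (W i) + perimeter F (\<Union>i\<in>I. W i)"
    using perimeter_subadd[OF F, of "W i" "\<Union>i\<in>I. W i"] insert.prems by auto
  also have "\<dots> \<le> perimeter F (W i) + (\<Sum>i\<in>I. perimeter F (W i))"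
    using insert by (intro add_left_mono) auto
  finally show ?case using insert.hyps by simp
qed

text \<open>Test fields have compact support, so each of them sees only finitely many members of an
  open cover of any cardinality. Both countable subadditivity and the localisation of zero perimeter
  follow.\<close>

lemma perimeter_compact_cover:
  assumes F: "F \<in> sets lebesgue" and "\<And>i. i \<in> I \<Longrightarrow> open (W i)" "W' \<subseteq> (\<Union>i\<in>I. W i)"
    "\<And>J. J \<subseteq> I \<Longrightarrow> finite J \<Longrightarrow> (\<Sum>i\<in>J. perimeter F (W i)) \<le> c"
  shows "perimeter F W' \<le> c"
proof (rule perimeter_least)
  fix \<phi> assume \<phi>: "\<phi> \<in> test_fields W'"
  have "supp \<phi> \<subseteq> (\<Union>i\<in>I. W i)" using test_fieldsD(3)[OF \<phi>] assms(3) by blast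
  then obtain J where J: "J \<subseteq> I" "finite J" "supp \<phi> \<subseteq> (\<Union>i\<in>J. W i)"
    using compactE_image[OF test_fieldsD(2)[OF \<phi>], of I W] assms(2) by auto
  have "\<phi> \<in> test_fields (\<Union>i\<in>J. W i)"
    using test_fieldsD[OF \<phi>] J(3) by (intro test_fieldsI) auto
  then have "ennreal (divint F \<phi>) \<le> perimeter F (\<Union>i\<in>J. W i)" by (rule perimeter_upper)
  also have "\<dots> \<le> (\<Sum>i\<in>J. perimeter F (W i))"
    using J assms(2) by (intro perimeter_finite_subadd F) auto
  also have "\<dots> \<le> c" using assms(4) J by blast
  finally show "ennreal (divint F \<phi>) \<le> c" .
qed

text \<open>Used in contrapositive form: positive perimeter in \<open>W\<close> yields a point of
  \<open>W\<close> all of whose discs have positive perimeter.\<close>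

lemma perimeter_zero_local:
  assumes F: "F \<in> sets lebesgue" and "\<And>y. y \<in> W \<Longrightarrow> \<exists>\<rho>>0. perimeter F (ball y \<rho>) = 0"
  shows "perimeter F W = 0"
proof -
  obtain \<rho> where \<rho>: "\<And>y. y \<in> W \<Longrightarrow> \<rho> y > 0" "\<And>y. y \<in> W \<Longrightarrow> perimeter F (ball y (\<rho> y)) = 0"
    using assms(2) by metis
  have "perimeter F W \<le> 0"
  proof (rule perimeter_compact_cover[OF F, where I=W and W="\<lambda>y. ball y (\<rho> y)"])
    show "W \<subseteq> (\<Union>y\<in>W. ball y (\<rho> y))" using \<rho>(1) by force
    show "(\<Sum>i\<in>J. perimeter F (ball i (\<rho> i))) \<le> 0" if "J \<subseteq> W" for J
      using that \<rho>(2) by (simp add: subset_iff)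
  qed auto
  then show ?thesis by simp
qed

lemma perimeter_countable_subadd:
  assumes F: "F \<in> sets lebesgue" and "\<And>i::nat. open (W i)"
  shows "perimeter F (\<Union>i. W i) \<le> (\<Sum>i. perimeter F (W i))"
proof (rule perimeter_compact_cover[OF F, where I=UNIV and W=W])
  show "(\<Sum>i\<in>J. perimeter F (W i)) \<le> (\<Sum>i. perimeter F (W i))" if "finite J" for J
    using that by (intro sum_le_suminf) auto
qed (use assms(2) in auto)

subsection \<open>The variation measure\<close>

text \<open>This is the set function inside \<open>Dchi\<close>, named so that it can be treated as
  an outer measure on all subsets of \<open>U\<close>.\<close>

definition outer_perimeter :: "R2 set \<Rightarrow> R2 set \<Rightarrow> R2 set \<Rightarrow> ennreal" where
  "outer_perimeter U F A = (INF W\<in>{W. open W \<and> A \<subseteq> W \<and> W \<subseteq> U}. perimeter F W)"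

lemma outer_perimeter_le: "open W \<Longrightarrow> A \<subseteq> W \<Longrightarrow> W \<subseteq> U \<Longrightarrow> outer_perimeter U F A \<le> perimeter F W"
  unfolding outer_perimeter_def by (rule INF_lower) auto

lemma outer_perimeter_greatest:
  "(\<And>W. open W \<Longrightarrow> A \<subseteq> W \<Longrightarrow> W \<subseteq> U \<Longrightarrow> c \<le> perimeter F W) \<Longrightarrow> c \<le> outer_perimeter U F A"
  unfolding outer_perimeter_def by (rule INF_greatest) auto

lemma outer_perimeter_open: "open W \<Longrightarrow> W \<subseteq> U \<Longrightarrow> outer_perimeter U F W = perimeter F W"
  by (intro antisym outer_perimeter_le outer_perimeter_greatest perimeter_mono) auto

lemma outer_perimeter_mono: "A \<subseteq> B \<Longrightarrow> outer_perimeter U F A \<le> outer_perimeter U F B"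
  by (rule outer_perimeter_greatest, rule outer_perimeter_le) auto

text \<open>Each \<open>A i\<close> is covered by an open set with excess e / 2^(i+1). Such a set
  exists only where the outer value is finite, hence the separate case of an infinite sum.\<close>

lemma outer_perimeter_countable_subadd:
  assumes F: "F \<in> sets lebesgue"
  shows "outer_perimeter U F (\<Union>i::nat. A i) \<le> (\<Sum>i. outer_perimeter U F (A i))"
proof (cases "(\<Sum>i. outer_perimeter U F (A i)) = \<infinity>")
  case True
  then show ?thesis by simp
next
  case False
  have fin: "outer_perimeter U F (A i) < \<infinity>" for i
    using ennreal_suminf_lessD[of "\<lambda>i. outer_perimeter U F (A i)" \<infinity> i] False
    by (simp add: less_top)
  show ?thesis
  proof (rule ennreal_le_epsilon)
    fix e :: real assume e: "0 < e"
    have "\<exists>W. open W \<and> A i \<subseteq> W \<and> W \<subseteq> U \<and>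
        perimeter F W < outer_perimeter U F (A i) + ennreal (e * (1 / 2) ^ Suc i)" for i
    proof -
      have "outer_perimeter U F (A i) < outer_perimeter U F (A i) + ennreal (e * (1 / 2) ^ Suc i)"
        using ennreal_add_left_cancel_less[of "outer_perimeter U F (A i)" 0 "ennreal (e * (1 / 2) ^ Suc i)"]
          fin[of i] e by (simp add: less_top)
      then show ?thesis
        unfolding outer_perimeter_def[of U F "A i"] INF_less_iff by blast
    qed
    then obtain W where W: "\<And>i. open (W i)" "\<And>i. A i \<subseteq> W i" "\<And>i. W i \<subseteq> U"
      "\<And>i. perimeter F (W i) < outer_perimeter U F (A i) + ennreal (e * (1 / 2) ^ Suc i)"
      by metis
    have "outer_perimeter U F (\<Union>i. A i) \<le> perimeter F (\<Union>i. W i)"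
      by (intro outer_perimeter_le open_UN ballI W(1) UN_mono W(2) UN_least W(3) subset_refl)
    also have "\<dots> \<le> (\<Sum>i. perimeter F (W i))"
      by (rule perimeter_countable_subadd[OF F W(1)])
    also have "\<dots> \<le> (\<Sum>i. outer_perimeter U F (A i) + ennreal (e * (1 / 2) ^ Suc i))"
      using W(4) by (intro suminf_le) (auto intro: less_imp_le)
    also have "\<dots> = (\<Sum>i. outer_perimeter U F (A i)) + (\<Sum>i. ennreal (e * (1 / 2) ^ Suc i))"
      by (simp add: suminf_add)
    also have "(\<Sum>i. ennreal (e * (1 / 2) ^ Suc i)) = ennreal e"
    proof (rule suminf_ennreal_eq)
      show "(\<lambda>i. e * (1 / 2) ^ Suc i) sums e"
        using sums_mult[OF power_half_series, of e] by simp
    qed (use e in simp)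
    finally show "outer_perimeter U F (\<Union>i. A i) \<le> (\<Sum>i. outer_perimeter U F (A i)) + ennreal e" .
  qed
qed

lemma outer_perimeter_outer_measure:
  assumes "F \<in> sets lebesgue"
  shows "outer_measure_space (Pow U) (outer_perimeter U F)"
  unfolding outer_measure_space_def positive_def increasing_def countably_subadditive_def
  using outer_perimeter_open[of "{}" U F] outer_perimeter_countable_subadd[OF assms]
  by (auto simp: perimeter_empty intro: outer_perimeter_mono)

text \<open>Given an open \<open>W\<close> around \<open>x\<close>, a field supported in
  \<open>W \<inter> O'\<close> has compact support, and \<open>W\<close> without that support is an
  open set around \<open>x - O'\<close>. Taking the supremum over such fields gives the Caratheodory
  inequality.\<close>

lemma open_in_lambda_system:
  assumes F: "F \<in> sets lebesgue" and O': "open O'" "O' \<subseteq> U"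
  shows "O' \<in> lambda_system U (Pow U) (outer_perimeter U F)"
proof -
  interpret Pow: algebra U "Pow U" by (rule algebra_Pow)
  have ge: "outer_perimeter U F (x \<inter> O') + outer_perimeter U F (x - O') \<le> outer_perimeter U F x" for x
  proof (rule outer_perimeter_greatest)
    fix W assume W: "open W" "x \<subseteq> W" "W \<subseteq> U"
    have "ennreal (divint F \<phi>) + outer_perimeter U F (x - O') \<le> perimeter F W"
      if \<phi>: "\<phi> \<in> test_fields (W \<inter> O')" for \<phi>
    proof -
      have "outer_perimeter U F (x - O') \<le> perimeter F (W - supp \<phi>)"
        using W test_fieldsD(3)[OF \<phi>] by (intro outer_perimeter_le open_Diff closed_closure) auto
      then have "ennreal (divint F \<phi>) + outer_perimeter U F (x - O')
          \<le> ennreal (divint F \<phi>) + perimeter F (W - supp \<phi>)" by (rule add_left_mono)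
      also have "\<dots> \<le> perimeter F W"
        using test_fields_mono[of "W \<inter> O'" W] \<phi> by (intro perimeter_split_field F) auto
      finally show ?thesis .
    qed
    moreover have "test_fields (W \<inter> O') \<noteq> {}" using zero_test_field by blast
    ultimately have "perimeter F (W \<inter> O') + outer_perimeter U F (x - O') \<le> perimeter F W"
      unfolding perimeter_def[of F "W \<inter> O'"]
      by (subst ennreal_SUP_add_left[symmetric]) (auto intro!: SUP_least)
    moreover have "outer_perimeter U F (x \<inter> O') \<le> perimeter F (W \<inter> O')"
      using W O' by (intro outer_perimeter_le) auto
    ultimately show "outer_perimeter U F (x \<inter> O') + outer_perimeter U F (x - O') \<le> perimeter F W"
      by (meson add_right_mono order_trans)
  qed
  have le: "outer_perimeter U F x \<le> outer_perimeter U F (x \<inter> O') + outer_perimeter U F (x - O')" for x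
  proof -
    \<comment> \<open>The decomposition into two pieces is padded with empty sets, which have value
      0, to apply countable subadditivity.\<close>
    define B where "B i = (if i = 0 then x \<inter> O' else if i = 1 then x - O' else {})" for i :: nat
    have "outer_perimeter U F x \<le> outer_perimeter U F (\<Union>i. B i)"
    proof (rule outer_perimeter_mono)
      have "x = B 0 \<union> B 1" by (auto simp: B_def)
      then show "x \<subseteq> (\<Union>i. B i)" by blast
    qed
    also have "\<dots> \<le> (\<Sum>i. outer_perimeter U F (B i))"
      by (rule outer_perimeter_countable_subadd[OF F])
    also have "\<dots> = (\<Sum>i\<in>{0,1}. outer_perimeter U F (B i))"
      by (rule suminf_finite) (auto simp: outer_perimeter_open perimeter_empty B_def)
    finally show ?thesis by (simp add: B_def)
  qed
  show ?thesis unfolding Pow.lambda_system_eq using O'(2) ge le by (auto intro: antisym)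
qed

text \<open>\<open>measure_of\<close> falls back to the zero measure when its set function is not a
  measure, so this is what makes \<open>Dchi\<close> meaningful.\<close>

lemma measure_space_outer_perimeter:
  assumes F: "F \<in> sets lebesgue" and U: "open U"
  shows "measure_space U (sets (restrict_space borel U)) (outer_perimeter U F)"
proof -
  interpret sigma_algebra U "Pow U" by (rule sigma_algebra_Pow)
  let ?L = "lambda_system U (Pow U) (outer_perimeter U F)"
  have ms: "measure_space U ?L (outer_perimeter U F)"
    by (rule caratheodory_lemma[OF outer_perimeter_outer_measure[OF F]])
  then interpret L: sigma_algebra U ?L by (simp add: measure_space_def)
  \<comment> \<open>The induction runs over traces on \<open>U\<close>, because the measurable sets
    of the Caratheodory construction have \<open>U\<close>, not the plane, as their space.\<close>
  have L: "U \<inter> A \<in> ?L" if "A \<in> sets borel" for A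
    using that unfolding borel_def sets_measure_of[OF Pow_UNIV[THEN equalityD2, THEN subset_trans[OF subset_UNIV]]]
  proof (induction rule: sigma_sets.induct)
    case (Basic a)
    then show ?case using U by (intro open_in_lambda_system F) auto
  next
    case Empty
    then show ?case by simp
  next
    case (Compl a)
    have "U \<inter> (UNIV - a) = U - (U \<inter> a)" by blast
    then show ?case using L.compl_sets[OF Compl.IH] by simp
  next
    case (Union a)
    have "U \<inter> (\<Union>i. a i) = (\<Union>i. U \<inter> a i)" by blast
    then show ?case using L.countable_UN[of "\<lambda>i. U \<inter> a i" UNIV] Union.IH by auto
  qed
  have sub: "sets (restrict_space borel U) \<subseteq> ?L"
    using L by (auto simp: sets_restrict_space)
  have sa: "sigma_algebra U (sets (restrict_space borel U))"
    using sets.sigma_algebra_axioms[of "restrict_space borel U"] by (simp add: space_restrict_space)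
  show ?thesis
    unfolding measure_space_def
  proof (intro conjI)
    show "positive (sets (restrict_space borel U)) (outer_perimeter U F)"
      using ms by (auto simp: measure_space_def positive_def)
    have ca: "countably_additive ?L (outer_perimeter U F)" using ms by (simp add: measure_space_def)
    show "countably_additive (sets (restrict_space borel U)) (outer_perimeter U F)"
      unfolding countably_additive_def
    proof (intro allI impI)
      fix A :: "nat \<Rightarrow> R2 set"
      assume A: "range A \<subseteq> sets (restrict_space borel U)" "disjoint_family A"
        "(\<Union>i. A i) \<in> sets (restrict_space borel U)"
      show "(\<Sum>i. outer_perimeter U F (A i)) = outer_perimeter U F (\<Union>i. A i)"
        using ca[unfolded countably_additive_def, rule_format, of A] A sub by blast
    qed
  qed (rule sa)
qed

lemma space_Dchi: "space (Dchi U F) = U"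
  unfolding Dchi_def by (simp add: space_measure_of_conv)

lemma sets_Dchi: "sets (Dchi U F) = sets (restrict_space borel U)"
  unfolding Dchi_def
  using sets.sigma_sets_eq[of "restrict_space borel U"] sets.space_closed[of "restrict_space borel U"]
  by (simp add: sets_measure_of_conv space_restrict_space)

lemma in_sets_Dchi: "open U \<Longrightarrow> A \<in> sets (Dchi U F) \<longleftrightarrow> A \<in> sets borel \<and> A \<subseteq> U"
  by (auto simp: sets_Dchi sets_restrict_space_iff)

lemma emeasure_Dchi:
  assumes "F \<in> sets lebesgue" "open U" "A \<in> sets borel" "A \<subseteq> U"
  shows "emeasure (Dchi U F) A = outer_perimeter U F A"
proof -
  have "emeasure (measure_of U (sets (restrict_space borel U)) (outer_perimeter U F)) A = outer_perimeter U F A"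
    by (rule emeasure_measure_of_sigma)
       (use measure_space_outer_perimeter[OF assms(1,2)] assms in
         \<open>auto simp: measure_space_def sets_restrict_space_iff\<close>)
  then show ?thesis unfolding Dchi_def outer_perimeter_def[abs_def] .
qed

lemma emeasure_Dchi_open:
  "\<lbrakk>F \<in> sets lebesgue; open U; open W; W \<subseteq> U\<rbrakk> \<Longrightarrow> emeasure (Dchi U F) W = perimeter F W"
  by (simp add: emeasure_Dchi outer_perimeter_open)

text \<open>Open sets around \<open>A\<close> may be intersected with \<open>W\<close> before they
  are compared. \<open>W\<close> may leave \<open>U\<close>; in the applications it is the
  complement of a closed set outside which two sets agree.\<close>

lemma emeasure_Dchi_local:
  assumes F: "F \<in> sets lebesgue" "G \<in> sets lebesgue" and U: "open U" and W: "open W"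
    and eq: "F \<inter> W = G \<inter> W" and A: "A \<in> sets borel" "A \<subseteq> W" "A \<subseteq> U"
  shows "emeasure (Dchi U F) A = emeasure (Dchi U G) A"
proof -
  have le: "outer_perimeter U F A \<le> outer_perimeter U G A"
    if "F \<in> sets lebesgue" "G \<in> sets lebesgue" "F \<inter> W = G \<inter> W" for F G
  proof (rule outer_perimeter_greatest)
    fix W' assume W': "open W'" "A \<subseteq> W'" "W' \<subseteq> U"
    have "outer_perimeter U F A \<le> perimeter F (W' \<inter> W)"
      using W W' A by (intro outer_perimeter_le) auto
    also have "\<dots> = perimeter G (W' \<inter> W)"
      by (rule perimeter_cong_on) (use that in blast)+
    also have "\<dots> \<le> perimeter G W'" by (rule perimeter_mono) auto
    finally show "outer_perimeter U F A \<le> perimeter G W'" .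
  qed
  show ?thesis
    using emeasure_Dchi[OF F(1) U A(1,3)] emeasure_Dchi[OF F(2) U A(1,3)] le[OF F eq]
      le[OF F(2,1) eq[symmetric]] by simp
qed

text \<open>The two measures restricted to \<open>A\<close> are equal as measures, so the integrals
  agree for an arbitrary \<open>h\<close>, measurable or not.\<close>

lemma nn_integral_Dchi_local:
  assumes F: "F \<in> sets lebesgue" "G \<in> sets lebesgue" and U: "open U" and W: "open W"
    and eq: "F \<inter> W = G \<inter> W" and A: "A \<in> sets borel" "A \<subseteq> W" "A \<subseteq> U"
  shows "(\<integral>\<^sup>+x\<in>A. h x \<partial>Dchi U F) = (\<integral>\<^sup>+x\<in>A. h x \<partial>Dchi U G)"
proof -
  have AS: "A \<in> sets (Dchi U H)" for H using A U in_sets_Dchi by blast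
  have r: "restrict_space (Dchi U F) A = restrict_space (Dchi U G) A"
  proof (rule measure_eqI)
    show "sets (restrict_space (Dchi U F) A) = sets (restrict_space (Dchi U G) A)"
      by (simp add: sets_restrict_space sets_Dchi)
    fix B assume "B \<in> sets (restrict_space (Dchi U F) A)"
    then have B: "B \<subseteq> A" "B \<in> sets (Dchi U F)"
      using AS[of F] by (auto simp: sets_restrict_space_iff space_Dchi Int_absorb2 A)
    then have "B \<in> sets borel" "B \<subseteq> U" using in_sets_Dchi U by blast+
    then have "emeasure (Dchi U F) B = emeasure (Dchi U G) B"
      using B A by (intro emeasure_Dchi_local[OF F U W eq]) auto
    then show "emeasure (restrict_space (Dchi U F) A) B = emeasure (restrict_space (Dchi U G) A) B"
      using B AS A by (simp add: emeasure_restrict_space space_Dchi Int_absorb2)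
  qed
  have "(\<integral>\<^sup>+x\<in>A. h x \<partial>Dchi U H) = (\<integral>\<^sup>+x. h x \<partial>restrict_space (Dchi U H) A)" for H
    using AS[of H] A by (intro nn_integral_restrict_space[symmetric]) (simp add: space_Dchi Int_absorb2)
  then show ?thesis using r by simp
qed

subsection \<open>Removing a disc\<close>

text \<open>A continuously differentiable transition from 0 to 1 on the unit interval: each of the
  two nested squares smooths one of the corners.\<close>

definition ramp :: "real \<Rightarrow> real" where
  "ramp u = 1 - (max 0 (1 - (max 0 u)\<^sup>2))\<^sup>2"

lemma ramp_derivative:
  "(ramp has_real_derivative (4 * max 0 (1 - (max 0 u)\<^sup>2) * max 0 u)) (at u)"
proof -
  have sq: "((\<lambda>s::real. (max 0 s)\<^sup>2) has_real_derivative (2 * max 0 s)) (at s)" for s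
    using has_real_derivative_pos_part_power[of 1 s] by (simp add: eval_nat_numeral)
  have "((\<lambda>u. 1 - (max 0 u)\<^sup>2) has_real_derivative (- (2 * max 0 u))) (at u)"
    using DERIV_diff[OF DERIV_const sq, of 1 u] by simp
  from DERIV_chain2[OF sq this]
  have "((\<lambda>u. (max 0 (1 - (max 0 u)\<^sup>2))\<^sup>2) has_real_derivative
     (2 * max 0 (1 - (max 0 u)\<^sup>2) * - (2 * max 0 u))) (at u)" .
  from DERIV_diff[OF DERIV_const this, of 1] show ?thesis
    unfolding ramp_def[abs_def] by (rule DERIV_cong) simp
qed

lemma ramp_simps:
  "0 \<le> ramp u" "ramp u \<le> 1" "u \<le> 0 \<Longrightarrow> ramp u = 0" "u \<ge> 1 \<Longrightarrow> ramp u = 1"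
proof -
  have "(max 0 (1 - (max 0 u)\<^sup>2))\<^sup>2 \<le> 1" by (rule power_le_one) auto
  then show "0 \<le> ramp u" by (simp add: ramp_def)
  show "ramp u \<le> 1" by (simp add: ramp_def)
  show "u \<le> 0 \<Longrightarrow> ramp u = 0" by (simp add: ramp_def)
  show "ramp u = 1" if "u \<ge> 1"
  proof -
    have "1 \<le> (max 0 u)\<^sup>2" using that by (simp add: one_le_power)
    then show ?thesis by (simp add: ramp_def)
  qed
qed

lemma ramp_deriv_bound:
  fixes u :: real
  shows
  "\<bar>4 * max 0 (1 - (max 0 u)\<^sup>2) * max 0 u\<bar> \<le> 4"
  "u \<le> 0 \<or> u \<ge> 1 \<Longrightarrow> 4 * max 0 (1 - (max 0 u)\<^sup>2) * max 0 u = 0"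
proof -
  have 0: "4 * max 0 (1 - (max 0 u)\<^sup>2) * max 0 u = 0" if "u \<le> 0 \<or> u \<ge> 1"
  proof (cases "u \<le> 0")
    case False
    then have "1 \<le> max 0 u" using that by auto
    then have "1 \<le> (max 0 u)\<^sup>2" using power_mono[of 1 "max 0 u" 2] by simp
    then show ?thesis by simp
  qed simp
  then show "u \<le> 0 \<or> u \<ge> 1 \<Longrightarrow> 4 * max 0 (1 - (max 0 u)\<^sup>2) * max 0 u = 0" .
  show "\<bar>4 * max 0 (1 - (max 0 u)\<^sup>2) * max 0 u\<bar> \<le> 4"
  proof (cases "u \<le> 0 \<or> u \<ge> 1")
    case False
    have "max 0 (1 - (max 0 u)\<^sup>2) * max 0 u \<le> 1 * 1"
      using False by (intro mult_mono) auto
    then show ?thesis by (simp add: abs_mult)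
  next
    case True
    then show ?thesis unfolding 0[OF True] by simp
  qed
qed

text \<open>With k = \<open>Suc n\<close>, the transition takes place where the squared distance
  lies between s^2 + 1/k and s^2 + 2/k. Squared distances make this annulus have area exactly pi/k,
  and the offset by 1 makes the function vanish in a neighbourhood of the closed disc.\<close>

definition radial_cutoff :: "R2 \<Rightarrow> real \<Rightarrow> nat \<Rightarrow> R2 \<Rightarrow> real" where
  "radial_cutoff c s n x = ramp (real (Suc n) * ((norm (x - c))\<^sup>2 - s\<^sup>2) - 1)"

lemma
  fixes c :: R2
  shows C1_radial_cutoff: "C1 (radial_cutoff c s n)"
    and fd_radial_cutoff: "\<bar>fd (radial_cutoff c s n) x v\<bar> \<le>
      indicator (cball c (sqrt (s\<^sup>2 + 2 / real (Suc n))) - cball c (sqrt (s\<^sup>2 + 1 / real (Suc n)))) x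
        * (8 * real (Suc n) * sqrt (s\<^sup>2 + 2 / real (Suc n)) * norm v)"
proof -
  let ?k = "real (Suc n)"
  let ?u = "\<lambda>x. ?k * ((norm (x - c))\<^sup>2 - s\<^sup>2) - 1"
  have d: "(?u has_derivative (\<lambda>v. 2 * ?k * ((x - c) \<bullet> v))) (at x)" for x
    unfolding power2_norm_eq_inner
    by (auto intro!: derivative_eq_intros simp: inner_commute algebra_simps)
  have C: "C1 ?u" by (rule C1I[OF d]) (intro continuous_intros)
  have cont: "continuous_on UNIV (\<lambda>u::real. 4 * max 0 (1 - (max 0 u)\<^sup>2) * max 0 u)"
    by (intro continuous_intros)
  show "C1 (radial_cutoff c s n)"
    unfolding radial_cutoff_def[abs_def]
    by (rule C1_compose[OF C ramp_derivative cont])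
  have fd: "fd (radial_cutoff c s n) x v = 4 * max 0 (1 - (max 0 (?u x))\<^sup>2) * max 0 (?u x) * (2 * ?k * ((x - c) \<bullet> v))"
    unfolding radial_cutoff_def[abs_def]
    using fd_compose[OF C ramp_derivative cont, of x] fd_eq[OF d, of x] by simp
  show "\<bar>fd (radial_cutoff c s n) x v\<bar> \<le>
      indicator (cball c (sqrt (s\<^sup>2 + 2 / ?k)) - cball c (sqrt (s\<^sup>2 + 1 / ?k))) x
        * (8 * ?k * sqrt (s\<^sup>2 + 2 / ?k) * norm v)"
  proof (cases "?u x \<le> 0 \<or> ?u x \<ge> 1")
    case True
    have "fd (radial_cutoff c s n) x v = 0" unfolding fd ramp_deriv_bound(2)[OF True] by simp
    then show ?thesis by simp
  next
    case False
    have "(norm (x - c))\<^sup>2 > s\<^sup>2 + 1 / ?k" "(norm (x - c))\<^sup>2 \<le> s\<^sup>2 + 2 / ?k"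
      using False by (simp_all add: field_simps)
    then have n: "norm (x - c) > sqrt (s\<^sup>2 + 1 / ?k)" "norm (x - c) \<le> sqrt (s\<^sup>2 + 2 / ?k)"
      using real_less_rsqrt real_le_rsqrt by (auto intro: real_less_lsqrt)
    then have x: "x \<in> cball c (sqrt (s\<^sup>2 + 2 / ?k)) - cball c (sqrt (s\<^sup>2 + 1 / ?k))"
      by (simp add: dist_norm norm_minus_commute)
    have "\<bar>fd (radial_cutoff c s n) x v\<bar> = \<bar>4 * max 0 (1 - (max 0 (?u x))\<^sup>2) * max 0 (?u x)\<bar> * (2 * ?k * \<bar>(x - c) \<bullet> v\<bar>)"
      unfolding fd abs_mult by simp
    also have "\<dots> \<le> 4 * (2 * ?k * (sqrt (s\<^sup>2 + 2 / ?k) * norm v))"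
    proof (intro mult_mono ramp_deriv_bound(1))
      show "\<bar>(x - c) \<bullet> v\<bar> \<le> sqrt (s\<^sup>2 + 2 / ?k) * norm v"
        using Cauchy_Schwarz_ineq2[of "x - c" v] n(2) mult_right_mono[of "norm (x - c)" _ "norm v"]
        by (smt (verit) norm_ge_zero)
    qed auto
    also have "\<dots> = 8 * ?k * sqrt (s\<^sup>2 + 2 / ?k) * norm v" by (simp only: mult_ac)
    finally show ?thesis unfolding indicator_simps(1)[OF x] by (simp only: mult_1)
  qed
qed

lemma measure_annulus:
  fixes c :: R2
  assumes "0 \<le> a" "a \<le> b"
  shows "measure lebesgue (cball c (sqrt b) - cball c (sqrt a)) = pi * (b - a)"
    "cball c (sqrt b) - cball c (sqrt a) \<in> lmeasurable"
proof -
  have m: "measure lebesgue (cball c (sqrt r)) = pi * r" if "r \<ge> 0" for r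
    using content_cball[of "sqrt r" c] that by (simp add: unit_ball_vol_2)
  have sub: "cball c (sqrt a) \<subseteq> cball c (sqrt b)" using assms by (intro subset_cball) simp
  show "measure lebesgue (cball c (sqrt b) - cball c (sqrt a)) = pi * (b - a)"
    using measurable_measure_Diff[of "cball c (sqrt b)" lebesgue "cball c (sqrt a)"] sub m assms
    by (simp add: algebra_simps)
  show "cball c (sqrt b) - cball c (sqrt a) \<in> lmeasurable"
    by (intro fmeasurable_Diff) auto
qed

lemma radial_cutoff_limit: "(\<lambda>n. radial_cutoff c s n x) \<longlonglongrightarrow> indicator (- cball c \<bar>s\<bar>) x"
proof (cases "x \<in> cball c \<bar>s\<bar>")
  case True
  then have "norm (x - c) \<le> \<bar>s\<bar>" by (simp add: dist_norm norm_minus_commute)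
  then have "(norm (x - c))\<^sup>2 \<le> s\<^sup>2" by (simp add: abs_le_square_iff[symmetric])
  then have "real (Suc n) * ((norm (x - c))\<^sup>2 - s\<^sup>2) \<le> 0" for n
    by (intro mult_nonneg_nonpos) auto
  then have "real (Suc n) * ((norm (x - c))\<^sup>2 - s\<^sup>2) - 1 \<le> 0" for n
    by (smt (verit))
  then have "radial_cutoff c s n x = 0" for n
    unfolding radial_cutoff_def by (rule ramp_simps(3))
  then show ?thesis using True by simp
next
  case False
  then have "\<bar>s\<bar> < \<bar>norm (x - c)\<bar>" by (simp add: dist_norm norm_minus_commute)
  then have pos: "(norm (x - c))\<^sup>2 - s\<^sup>2 > 0"
    using power_strict_mono[of "\<bar>s\<bar>" "norm (x - c)" 2] by simp
  obtain N :: nat where N: "2 / ((norm (x - c))\<^sup>2 - s\<^sup>2) < real N" using reals_Archimedean2 by blast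
  have "radial_cutoff c s n x = 1" if "n \<ge> N" for n
  proof -
    have "2 / ((norm (x - c))\<^sup>2 - s\<^sup>2) \<le> real (Suc n)" using N that by linarith
    then have "2 \<le> real (Suc n) * ((norm (x - c))\<^sup>2 - s\<^sup>2)" using pos by (simp add: divide_simps)
    then show ?thesis unfolding radial_cutoff_def by (intro ramp_simps(4)) simp
  qed
  then have "(\<lambda>n. radial_cutoff c s n x) \<longlonglongrightarrow> 1"
    by (intro tendsto_eventually) (auto simp: eventually_sequentially)
  then show ?thesis using False by simp
qed

text \<open>The truncation of \<^term>\<open>F\<close> costs at most the mass of the gradient of radial cutoffs, which
  stays of the order of the length of the circle.\<close>

lemma perimeter_diff_cball:
  fixes c :: R2
  assumes F: "F \<in> sets lebesgue" and s: "0 \<le> s"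
  shows "perimeter (F - cball c s) W \<le> perimeter F (W - cball c s) + ennreal (8 * pi * s)"
proof (rule perimeter_least)
  fix \<phi> assume \<phi>: "\<phi> \<in> test_fields W"
  note D = test_fieldsD[OF \<phi>]
  let ?\<eta> = "radial_cutoff c s"
  define r where "r n = sqrt (s\<^sup>2 + 2 / real (Suc n))" for n
  have md: "divergence \<phi> \<in> borel_measurable lebesgue"
    by (intro measurable_continuous_lebesgue continuous_divergence D)
  have m\<eta>: "?\<eta> n \<in> borel_measurable lebesgue" for n
    by (intro measurable_continuous_lebesgue C1_continuous C1_radial_cutoff)
  have bound: "(\<integral>x. indicator F x * (?\<eta> n x * divergence \<phi> x) \<partial>lebesgue) \<le>
      divint F (\<lambda>x. ?\<eta> n x *\<^sub>R \<phi> x) + 8 * pi * r n" for n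
  proof -
    let ?A = "cball c (sqrt (s\<^sup>2 + 2 / real (Suc n))) - cball c (sqrt (s\<^sup>2 + 1 / real (Suc n)))"
    let ?B = "8 * real (Suc n) * r n"
    note A = measure_annulus[of "s\<^sup>2 + 1 / real (Suc n)" "s\<^sup>2 + 2 / real (Suc n)" c]
    have e: "divergence (\<lambda>x. ?\<eta> n x *\<^sub>R \<phi> x) x = ?\<eta> n x * divergence \<phi> x + fd (?\<eta> n) x (\<phi> x)" for x
      by (rule divergence_scaleR[OF C1_radial_cutoff D(1)])
    have i1: "integrable lebesgue (\<lambda>x. indicator F x * divergence (\<lambda>x. ?\<eta> n x *\<^sub>R \<phi> x) x)"
      by (intro integrable_divergence F C1_scaleR C1_radial_cutoff D
          compact_supp_subset[OF D(2) supp_subset_scaleR(2)])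
    have i2: "integrable lebesgue (\<lambda>x. indicator ?A x * ?B)"
      using A(2) by (intro integrable_mult_left) (auto simp: fmeasurable_def divide_simps)
    have pt: "indicator F x * (?\<eta> n x * divergence \<phi> x) \<le>
       indicator F x * divergence (\<lambda>x. ?\<eta> n x *\<^sub>R \<phi> x) x + indicator ?A x * ?B" for x
    proof -
      have "\<bar>fd (?\<eta> n) x (\<phi> x)\<bar> \<le> indicator ?A x * (?B * norm (\<phi> x))"
        using fd_radial_cutoff[of c s n x "\<phi> x"] unfolding r_def .
      also have "\<dots> \<le> indicator ?A x * (?B * 1)"
        by (intro mult_left_mono D(4)) (auto simp: r_def)
      finally have "\<bar>fd (?\<eta> n) x (\<phi> x)\<bar> \<le> indicator ?A x * ?B" by simp
      then show ?thesis unfolding e by (auto simp: indicator_def split: if_splits)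
    qed
    have "(\<integral>x. indicator F x * (?\<eta> n x * divergence \<phi> x) \<partial>lebesgue) \<le>
      (\<integral>x. indicator F x * divergence (\<lambda>x. ?\<eta> n x *\<^sub>R \<phi> x) x + indicator ?A x * ?B \<partial>lebesgue)"
    proof (rule integral_mono[OF _ _ pt])
      have "integrable lebesgue (\<lambda>x. indicator F x * (\<lambda>x. ?\<eta> n x * divergence \<phi> x) x)"
        by (rule integrable_indicator_continuous[OF F continuous_on_mult[OF
              C1_continuous[OF C1_radial_cutoff] continuous_divergence[OF D(1)]] D(2)])
           (simp add: divergence_outside)
      then show "integrable lebesgue (\<lambda>x. indicator F x * (?\<eta> n x * divergence \<phi> x))" by simp
    qed (intro Bochner_Integration.integrable_add i1 i2)
    also have "\<dots> = divint F (\<lambda>x. ?\<eta> n x *\<^sub>R \<phi> x) + measure lebesgue ?A * ?B"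
      using Bochner_Integration.integral_add[OF i1 i2] A(2) by (simp add: fmeasurable_def divide_simps)
    \<comment> \<open>The gradient bound 8 k r and the area pi/k balance: k cancels, and in the
      limit 8 pi s remains.\<close>
    also have "measure lebesgue ?A * ?B = 8 * pi * r n"
    proof -
      have "measure lebesgue ?A = pi * (1 / real (Suc n))"
        using A(1) by (simp add: divide_simps algebra_simps)
      moreover have "pi * (1 / k) * (8 * k * t) = 8 * pi * t" if "k > 0" for k t :: real
        using that by simp
      ultimately show ?thesis by (simp only: of_nat_0_less_iff zero_less_Suc)
    qed
    finally show ?thesis .
  qed
  have tf: "(\<lambda>x. ?\<eta> n x *\<^sub>R \<phi> x) \<in> test_fields (W - cball c s)" for n
  proof (rule test_fields_cutoff[OF \<phi> C1_radial_cutoff])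
    show "\<bar>?\<eta> n x\<bar> \<le> 1" for x using ramp_simps(1,2) by (simp add: radial_cutoff_def)
    \<comment> \<open>The cutoff vanishes on a disc of radius strictly larger than \<open>s\<close>,
      so the support keeps away from the closed disc itself.\<close>
    have "supp (\<lambda>x. ?\<eta> n x *\<^sub>R \<phi> x) \<subseteq> supp \<phi> - ball c (sqrt (s\<^sup>2 + 1 / real (Suc n)))"
    proof (rule supp_subset_closed)
      show "closed (supp \<phi> - ball c (sqrt (s\<^sup>2 + 1 / real (Suc n))))" by (intro closed_Diff) auto
      fix x assume x: "x \<notin> supp \<phi> - ball c (sqrt (s\<^sup>2 + 1 / real (Suc n)))"
      show "?\<eta> n x *\<^sub>R \<phi> x = 0"
      proof (cases "x \<in> supp \<phi>")
        case True
        then have "norm (x - c) < sqrt (s\<^sup>2 + 1 / real (Suc n))"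
          using x by (simp add: dist_norm norm_minus_commute)
        then have "(norm (x - c))\<^sup>2 < (sqrt (s\<^sup>2 + 1 / real (Suc n)))\<^sup>2"
          by (intro power_strict_mono) auto
        then have "(norm (x - c))\<^sup>2 < s\<^sup>2 + 1 / real (Suc n)" by simp
        then have "real (Suc n) * ((norm (x - c))\<^sup>2 - s\<^sup>2) - 1 \<le> 0" by (simp add: field_simps)
        then show ?thesis using ramp_simps(3) by (simp add: radial_cutoff_def)
      qed (simp add: supp_zero[of x \<phi>])
    qed
    also have "\<dots> \<subseteq> W - cball c s"
    proof -
      have "s < sqrt (s\<^sup>2 + 1 / real (Suc n))" by (rule real_less_rsqrt) simp
      then show ?thesis using D(3) by (auto simp: subset_iff)
    qed
    finally show "supp (\<lambda>x. ?\<eta> n x *\<^sub>R \<phi> x) \<subseteq> W - cball c s" .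
  qed
  have lim1: "(\<lambda>n. \<integral>x. indicator F x * (?\<eta> n x * divergence \<phi> x) \<partial>lebesgue) \<longlonglongrightarrow> divint (F - cball c s) \<phi>"
  proof (rule integral_dominated_convergence[where w="\<lambda>x. \<bar>divergence \<phi> x\<bar>"])
    show "integrable lebesgue (\<lambda>x. \<bar>divergence \<phi> x\<bar>)"
      using integrable_divergence[OF _ D(1,2), of UNIV] by (intro integrable_abs) simp
    show "AE x in lebesgue. (\<lambda>n. indicator F x * (?\<eta> n x * divergence \<phi> x))
        \<longlonglongrightarrow> indicator (F - cball c s) x * divergence \<phi> x"
    proof (rule AE_I2)
      fix x
      have "(\<lambda>n. indicator F x * (?\<eta> n x * divergence \<phi> x))
        \<longlonglongrightarrow> indicator F x * (indicator (- cball c \<bar>s\<bar>) x * divergence \<phi> x)"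
        by (intro tendsto_intros radial_cutoff_limit)
      moreover have "indicator F x * (indicator (- cball c \<bar>s\<bar>) x * divergence \<phi> x)
          = indicator (F - cball c s) x * divergence \<phi> x"
        using s by (simp add: indicator_def)
      ultimately show "(\<lambda>n. indicator F x * (?\<eta> n x * divergence \<phi> x))
        \<longlonglongrightarrow> indicator (F - cball c s) x * divergence \<phi> x" by simp
    qed
    show "AE x in lebesgue. norm (indicator F x * (?\<eta> n x * divergence \<phi> x)) \<le> \<bar>divergence \<phi> x\<bar>" for n
    proof (rule AE_I2)
      fix x
      have "\<bar>?\<eta> n x\<bar> \<le> 1" using ramp_simps(1,2) by (simp add: radial_cutoff_def)
      then have "\<bar>?\<eta> n x\<bar> * \<bar>divergence \<phi> x\<bar> \<le> 1 * \<bar>divergence \<phi> x\<bar>" by (rule mult_right_mono) simp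
      then show "norm (indicator F x * (?\<eta> n x * divergence \<phi> x)) \<le> \<bar>divergence \<phi> x\<bar>"
        by (simp add: indicator_def abs_mult)
    qed
    have "F - cball c s \<in> sets lebesgue" using F by (intro sets.Diff) simp_all
    then show "(\<lambda>x. indicator (F - cball c s) x * divergence \<phi> x) \<in> borel_measurable lebesgue"
      using integrable_divergence[OF _ D(1,2)] by blast
    show "(\<lambda>x. indicator F x * (?\<eta> n x * divergence \<phi> x)) \<in> borel_measurable lebesgue" for n
      by (intro borel_measurable_times m\<eta> md borel_measurable_indicator F)
  qed
  have "(\<lambda>n. 2 / real (Suc n)) \<longlonglongrightarrow> 0"
    using tendsto_mult_right[OF LIMSEQ_inverse_real_of_nat, of 2] by (simp add: inverse_eq_divide)
  then have "r \<longlonglongrightarrow> sqrt (s\<^sup>2 + 0)" unfolding r_def by (intro tendsto_intros)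
  then have "r \<longlonglongrightarrow> s" using s by simp
  then have "(\<lambda>n. 8 * pi * r n) \<longlonglongrightarrow> 8 * pi * s" by (intro tendsto_intros)
  then have lim2: "(\<lambda>n. perimeter F (W - cball c s) + ennreal (8 * pi * r n)) \<longlonglongrightarrow> perimeter F (W - cball c s) + ennreal (8 * pi * s)"
    by (intro tendsto_add tendsto_ennrealI tendsto_const)
  show "ennreal (divint (F - cball c s) \<phi>) \<le> perimeter F (W - cball c s) + ennreal (8 * pi * s)"
  proof (rule LIMSEQ_le[OF tendsto_ennrealI[OF lim1] lim2], intro exI allI impI)
    fix n
    have "ennreal (\<integral>x. indicator F x * (?\<eta> n x * divergence \<phi> x) \<partial>lebesgue)
      \<le> ennreal (divint F (\<lambda>x. ?\<eta> n x *\<^sub>R \<phi> x) + 8 * pi * r n)"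
      by (rule ennreal_leI[OF bound])
    also have "\<dots> \<le> ennreal (divint F (\<lambda>x. ?\<eta> n x *\<^sub>R \<phi> x)) + ennreal (8 * pi * r n)"
      by (simp add: ennreal_plus_if ennreal_leI r_def)
    also have "\<dots> \<le> perimeter F (W - cball c s) + ennreal (8 * pi * r n)"
      by (intro add_right_mono perimeter_upper tf)
    finally show "ennreal (\<integral>x. indicator F x * (?\<eta> n x * divergence \<phi> x) \<partial>lebesgue)
      \<le> perimeter F (W - cball c s) + ennreal (8 * pi * r n)" .
  qed
qed

text \<open>Deleting a disc of radius 1/(n+1) costs at most 8 pi/(n+1) and changes the tested
  integrals by an amount tending to 0. This is what supplies a boundary point different from a given
  one.\<close>

lemma perimeter_delete_point:
  assumes F: "F \<in> sets lebesgue"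
  shows "perimeter F (W - {p}) = perimeter F W"
proof (rule antisym[OF perimeter_mono perimeter_least])
  fix \<phi> assume \<phi>: "\<phi> \<in> test_fields W"
  note D = test_fieldsD[OF \<phi>]
  define s where "s n = inverse (real (Suc n))" for n
  have s0: "s \<longlonglongrightarrow> 0" unfolding s_def by (rule LIMSEQ_inverse_real_of_nat)

  have lim1: "(\<lambda>n. divint (F - cball p (s n)) \<phi>) \<longlonglongrightarrow> divint F \<phi>"
  proof (rule integral_dominated_convergence[where w="\<lambda>x. \<bar>divergence \<phi> x\<bar>"])
    show "integrable lebesgue (\<lambda>x. \<bar>divergence \<phi> x\<bar>)"
      using integrable_divergence[OF _ D(1,2), of UNIV] by (intro integrable_abs) simp
    have "AE x in lebesgue. x \<noteq> p"
      by (rule AE_I'[of "{p}"]) auto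
    then show "AE x in lebesgue. (\<lambda>n. indicator (F - cball p (s n)) x * divergence \<phi> x)
        \<longlonglongrightarrow> indicator F x * divergence \<phi> x"
    proof eventually_elim
      case (elim x)
      then have "\<forall>\<^sub>F n in sequentially. s n < dist p x"
        using s0 by (intro order_tendstoD(2)) auto
      then have "\<forall>\<^sub>F n in sequentially. indicator (F - cball p (s n)) x * divergence \<phi> x = indicator F x * divergence \<phi> x"
        by eventually_elim (auto simp: indicator_def)
      then show ?case by (rule tendsto_eventually)
    qed
    have "F - cball p (s n) \<in> sets lebesgue" for n using F by (intro sets.Diff) simp_all
    then show "(\<lambda>x. indicator (F - cball p (s n)) x * divergence \<phi> x) \<in> borel_measurable lebesgue" for n
      using integrable_divergence[OF _ D(1,2)] by blast
    show "(\<lambda>x. indicator F x * divergence \<phi> x) \<in> borel_measurable lebesgue"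
      using integrable_divergence[OF F D(1,2)] by blast
  qed (auto simp: indicator_def)
  have lim2: "(\<lambda>n. perimeter F (W - {p}) + ennreal (8 * pi * s n)) \<longlonglongrightarrow> perimeter F (W - {p}) + ennreal (8 * pi * 0)"
    by (intro tendsto_add tendsto_ennrealI tendsto_const tendsto_mult s0)
  have "ennreal (divint F \<phi>) \<le> perimeter F (W - {p}) + ennreal (8 * pi * 0)"
  proof (rule LIMSEQ_le[OF tendsto_ennrealI[OF lim1] lim2], intro exI allI impI)
    fix n
    have "ennreal (divint (F - cball p (s n)) \<phi>) \<le> perimeter (F - cball p (s n)) W"
      by (rule perimeter_upper[OF \<phi>])
    also have "\<dots> \<le> perimeter F (W - cball p (s n)) + ennreal (8 * pi * s n)"
      by (rule perimeter_diff_cball[OF F]) (simp add: s_def)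
    also have "\<dots> \<le> perimeter F (W - {p}) + ennreal (8 * pi * s n)"
      by (intro add_right_mono perimeter_mono) (auto simp: s_def)
    finally show "ennreal (divint (F - cball p (s n)) \<phi>) \<le> perimeter F (W - {p}) + ennreal (8 * pi * s n)" .
  qed
  then show "ennreal (divint F \<phi>) \<le> perimeter F (W - {p})" by simp
qed auto

text \<open>In slightly larger open discs the deletion estimate leaves the variation of
  \<open>F\<close> in a thin annulus. These annuli decrease to the empty set, so their finite
  measure tends to 0 and only the contribution of the circle survives.\<close>

lemma emeasure_Dchi_diff_cball:
  assumes F: "F \<in> sets lebesgue" and U: "open U" and fin: "perimeter F U < \<infinity>"
    and s: "0 \<le> s" and sub: "cball c s \<subseteq> U"
  shows "emeasure (Dchi U (F - cball c s)) (cball c s) \<le> ennreal (8 * pi * s)"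
proof -
  have G: "F - cball c s \<in> sets lebesgue" using F by (intro sets.Diff) simp_all
  obtain \<delta> where \<delta>: "\<delta> > 0" "ball c (s + \<delta>) \<subseteq> U"
  proof -
    have "\<exists>\<delta>>0. \<forall>x\<in>cball c s. \<forall>y. dist x y < \<delta> \<longrightarrow> y \<in> U"
      using compact_subset_open_imp_ball_epsilon_subset[OF compact_cball U sub]
      by (metis (no_types, lifting) UN_subset_iff mem_ball subset_iff)
    then obtain \<delta> where \<delta>: "\<delta> > 0" "\<And>x y. x \<in> cball c s \<Longrightarrow> dist x y < \<delta> \<Longrightarrow> y \<in> U" by blast
    have "ball c (s + \<delta>) \<subseteq> U"
    proof
      fix y assume y: "y \<in> ball c (s + \<delta>)"
      show "y \<in> U"
      proof (cases "dist c y \<le> s")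
        case True
        then show ?thesis using sub by auto
      next
        case False
        \<comment> \<open>The radial projection of \<open>y\<close> onto the circle; its distance
          from \<open>y\<close> is \<open>dist c y - s\<close>, hence less than \<delta>.\<close>
        define x where "x = c + (s / dist c y) *\<^sub>R (y - c)"
        have dpos: "dist c y > 0" using False s by linarith
        have "norm (x - c) = s" using dpos s by (simp add: x_def dist_norm norm_minus_commute)
        moreover have "dist x y = dist c y - s"
        proof -
          have "y - x = (1 - s / dist c y) *\<^sub>R (y - c)" by (simp add: x_def algebra_simps)
          then have "norm (y - x) = \<bar>1 - s / dist c y\<bar> * dist c y"
            by (simp add: dist_norm norm_minus_commute)
          also have "\<dots> = (1 - s / dist c y) * dist c y" using False dpos by (simp add: divide_simps)
          also have "\<dots> = dist c y - s" using dpos by (simp add: field_simps)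
          finally show ?thesis by (simp add: dist_norm norm_minus_commute)
        qed
        ultimately show ?thesis using \<delta>(2)[of x y] y by (simp add: dist_norm norm_minus_commute)
      qed
    qed
    then show ?thesis using \<delta>(1) that by blast
  qed
  define A where "A n = ball c (s + \<delta> / real (Suc n)) - cball c s" for n
  have sub': "ball c (s + \<delta> / real (Suc n)) \<subseteq> U" for n
  proof (rule subset_trans[OF subset_ball \<delta>(2)])
    have "\<delta> / real (Suc n) \<le> \<delta> / 1" using \<delta>(1) by (intro divide_left_mono) auto
    then show "s + \<delta> / real (Suc n) \<le> s + \<delta>" by simp
  qed
  have AU: "open (A n)" "A n \<subseteq> U" for n using sub'[of n] unfolding A_def by auto
  have "(\<lambda>n. emeasure (Dchi U F) (A n)) \<longlonglongrightarrow> emeasure (Dchi U F) (\<Inter>n. A n)"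
  proof (rule Lim_emeasure_decseq)
    show "range A \<subseteq> sets (Dchi U F)" using AU in_sets_Dchi[OF U] by auto
    show "decseq A"
    proof (rule decseq_SucI)
      fix n
      have "\<delta> / real (Suc (Suc n)) \<le> \<delta> / real (Suc n)" using \<delta>(1) by (intro divide_left_mono) auto
      then show "A (Suc n) \<le> A n" unfolding A_def by (intro Diff_mono subset_ball) auto
    qed
    show "emeasure (Dchi U F) (A n) \<noteq> \<infinity>" for n
      using emeasure_Dchi_open[OF F U AU] perimeter_mono[OF AU(2), of F n] fin by auto
  qed
  moreover have "(\<Inter>n. A n) = {}"
  proof -
    have "x \<notin> (\<Inter>n. A n)" for x
    proof
      assume "x \<in> (\<Inter>n. A n)"
      then have x: "dist c x > s" "\<And>n. dist c x < s + \<delta> / real (Suc n)" by (auto simp: A_def)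
      obtain n where "inverse (real (Suc n)) < (dist c x - s) / \<delta>"
        using reals_Archimedean[of "(dist c x - s) / \<delta>"] x(1) \<delta>(1) by auto
      then have "\<delta> / real (Suc n) < dist c x - s" using \<delta>(1) by (simp add: field_simps)
      then show False using x(2)[of n] by linarith
    qed
    then show ?thesis by blast
  qed
  ultimately have lim: "(\<lambda>n. emeasure (Dchi U F) (A n) + ennreal (8 * pi * s)) \<longlonglongrightarrow> 0 + ennreal (8 * pi * s)"
    by (intro tendsto_add tendsto_const) simp
  have "emeasure (Dchi U (F - cball c s)) (cball c s) \<le> emeasure (Dchi U F) (A n) + ennreal (8 * pi * s)" for n
  proof -
    have "emeasure (Dchi U (F - cball c s)) (cball c s) \<le> emeasure (Dchi U (F - cball c s)) (ball c (s + \<delta> / real (Suc n)))"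
      using \<delta>(1) sub' in_sets_Dchi[OF U] by (intro emeasure_mono) (auto simp: cball_subset_ball_iff)
    also have "\<dots> = perimeter (F - cball c s) (ball c (s + \<delta> / real (Suc n)))"
      by (rule emeasure_Dchi_open[OF G U _ sub']) auto
    also have "\<dots> \<le> perimeter F (A n) + ennreal (8 * pi * s)"
      unfolding A_def by (rule perimeter_diff_cball[OF F s])
    finally show ?thesis using emeasure_Dchi_open[OF F U AU] by simp
  qed
  then show ?thesis using LIMSEQ_le_const[OF lim] by auto
qed

section \<open>Weighted volume, weighted perimeter and a competitor of finite energy\<close>

lemma locally_lipschitz_on_continuous:
  assumes "locally_lipschitz_on U f"
  shows "continuous_on U f"
  unfolding continuous_on_eq_continuous_within
proof
  fix x assume x: "x \<in> U"
  then obtain e L where e: "e > 0" and L: "L-lipschitz_on (cball x e \<inter> U) f"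
    using assms unfolding locally_lipschitz_on_def by blast
  have "continuous (at x within (cball x e \<inter> U)) f"
    using lipschitz_on_continuous_on[OF L] x e by (auto simp: continuous_on_eq_continuous_within)
  moreover have "at x within (cball x e \<inter> U) = at x within U"
    by (rule at_within_nhd[of x "ball x e"]) (use e in auto)
  ultimately show "continuous (at x within U) f" by simp
qed

text \<open>The weighted volume as a measure on all Lebesgue sets. The indicator removes the values
  of \<open>f\<close> outside \<open>U\<close>, about which nothing is assumed.\<close>

definition fvol :: "R2 set \<Rightarrow> (R2 \<Rightarrow> real) \<Rightarrow> R2 measure" where
  "fvol U f = density lebesgue (\<lambda>x. indicator U x * ennreal (f x))"

lemma measurable_fvol_density:
  assumes "open U" "continuous_on U f"
  shows "(\<lambda>x. indicator U x * ennreal (f x)) \<in> borel_measurable lebesgue"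
proof -
  have "(\<lambda>x. indicator U x *\<^sub>R f x) \<in> borel_measurable borel"
    using assms by (intro borel_measurable_continuous_on_indicator) auto
  then have "(\<lambda>x. indicator U x *\<^sub>R f x) \<in> borel_measurable lebesgue"
    by (simp add: measurable_completion)
  then have "(\<lambda>x. ennreal (indicator U x *\<^sub>R f x)) \<in> borel_measurable lebesgue"
    by measurable
  moreover have "ennreal (indicator U x *\<^sub>R f x) = indicator U x * ennreal (f x)" for x
    by (simp add: indicator_def)
  ultimately show ?thesis by simp
qed

lemma sets_fvol: "sets (fvol U f) = sets lebesgue"
  by (simp add: fvol_def)

lemma emeasure_fvol:
  assumes "open U" "continuous_on U f" "A \<in> sets lebesgue"
  shows "emeasure (fvol U f) A = (\<integral>\<^sup>+x. indicator U x * ennreal (f x) * indicator A x \<partial>lebesgue)"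
  unfolding fvol_def by (rule emeasure_density[OF measurable_fvol_density[OF assms(1,2)] assms(3)])

lemma wvolume_eq_fvol:
  assumes "open U" "continuous_on U f" "A \<in> sets lebesgue" "A \<subseteq> U"
  shows "wvolume f A = emeasure (fvol U f) A"
  unfolding emeasure_fvol[OF assms(1-3)] wvolume_def
  by (rule nn_integral_cong) (use assms(4) in \<open>auto simp: indicator_def\<close>)

lemma emeasure_fvol_le:
  assumes "open U" "continuous_on U f" "A \<in> sets lebesgue" "\<And>x. x \<in> A \<inter> U \<Longrightarrow> f x \<le> M"
  shows "emeasure (fvol U f) A \<le> ennreal M * emeasure lebesgue A"
proof -
  have "emeasure (fvol U f) A \<le> (\<integral>\<^sup>+x. ennreal M * indicator A x \<partial>lebesgue)"
    unfolding emeasure_fvol[OF assms(1-3)]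
    by (rule nn_integral_mono) (use assms(4) in \<open>auto simp: indicator_def intro: ennreal_leI\<close>)
  also have "\<dots> = ennreal M * emeasure lebesgue A"
    by (rule nn_integral_cmult_indicator[OF assms(3)])
  finally show ?thesis .
qed

text \<open>Adding a disc is deleting it from the complement, which has the same perimeter.\<close>

lemma perimeter_Un_cball:
  fixes c :: R2
  assumes F: "F \<in> sets lebesgue" and s: "0 \<le> s"
  shows "perimeter (F \<union> cball c s) W \<le> perimeter F W + ennreal (8 * pi * s)"
proof -
  have m: "- F \<in> sets lebesgue" "F \<union> cball c s \<in> sets lebesgue"
    using F by (auto simp: Compl_in_sets_lebesgue intro!: sets.Un)
  have "- (F \<union> cball c s) = - F - cball c s" by blast
  then have "perimeter (F \<union> cball c s) W = perimeter (- F - cball c s) W"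
    using perimeter_Compl[OF m(2), of W] by simp
  also have "\<dots> \<le> perimeter (- F) (W - cball c s) + ennreal (8 * pi * s)"
    by (rule perimeter_diff_cball[OF m(1) s])
  also have "\<dots> \<le> perimeter (- F) W + ennreal (8 * pi * s)"
    by (intro add_right_mono perimeter_mono) auto
  finally show ?thesis using perimeter_Compl[OF F] by simp
qed

lemma perimeter_Union_cball_finite:
  fixes c :: "nat \<Rightarrow> R2"
  assumes "\<And>i. 0 \<le> r i"
  shows "perimeter (\<Union>i<n. cball (c i) (r i)) W < \<infinity>"
proof (induction n)
  case 0
  then show ?case using perimeter_null[of "{}" W] by simp
next
  case (Suc n)
  have "(\<Union>i<n. cball (c i) (r i)) \<in> sets lebesgue" by (intro sets.finite_UN) auto
  from perimeter_Un_cball[OF this assms, of "c n" n W] Suc show ?case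
    by (simp add: lessThan_Suc Un_commute) (meson ennreal_add_less_top ennreal_less_top le_less_trans)
qed

lemma measurable_Dchi:
  assumes "continuous_on U g"
  shows "(\<lambda>x. ennreal (g x)) \<in> borel_measurable (Dchi U F)"
proof -
  have "g \<in> borel_measurable (restrict_space borel U)"
    using assms by (rule borel_measurable_continuous_on_restrict)
  then have "g \<in> borel_measurable (Dchi U F)"
    using measurable_cong_sets[OF sets_Dchi refl] by blast
  then show ?thesis by measurable
qed

lemma set_nn_integral_Dchi_le:
  assumes "A \<in> sets (Dchi U F)" "\<And>x. x \<in> A \<Longrightarrow> g x \<le> M"
  shows "(\<integral>\<^sup>+x\<in>A. ennreal (g x) \<partial>Dchi U F) \<le> ennreal M * emeasure (Dchi U F) A"
proof -
  have "(\<integral>\<^sup>+x\<in>A. ennreal (g x) \<partial>Dchi U F) \<le> (\<integral>\<^sup>+x. ennreal M * indicator A x \<partial>Dchi U F)"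
    by (rule nn_integral_mono) (use assms(2) in \<open>auto simp: indicator_def intro: ennreal_leI\<close>)
  also have "\<dots> = ennreal M * emeasure (Dchi U F) A"
    by (rule nn_integral_cmult_indicator[OF assms(1)])
  finally show ?thesis .
qed

lemma wperimeter_split:
  assumes "open U" "continuous_on U g" "A \<in> sets borel" "A \<subseteq> U"
  shows "wperimeter U g F = (\<integral>\<^sup>+x\<in>A. ennreal (g x) \<partial>Dchi U F) + (\<integral>\<^sup>+x\<in>U - A. ennreal (g x) \<partial>Dchi U F)"
proof -
  have AS: "A \<in> sets (Dchi U F)" "U - A \<in> sets (Dchi U F)"
    using assms in_sets_Dchi by auto
  have "wperimeter U g F = (\<integral>\<^sup>+x. ennreal (g x) * indicator A x + ennreal (g x) * indicator (U - A) x \<partial>Dchi U F)"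
    unfolding wperimeter_def by (rule nn_integral_cong) (auto simp: space_Dchi indicator_def)
  also have "\<dots> = (\<integral>\<^sup>+x\<in>A. ennreal (g x) \<partial>Dchi U F) + (\<integral>\<^sup>+x\<in>U - A. ennreal (g x) \<partial>Dchi U F)"
    by (intro nn_integral_add borel_measurable_times_ennreal measurable_Dchi[OF assms(2)]
        borel_measurable_indicator AS)
  finally show ?thesis .
qed

text \<open>\<open>g\<close> may be unbounded near the boundary of \<open>U\<close>, but the
  variation measure of a compact set is carried by that set, where \<open>g\<close> is
  bounded.\<close>

lemma wperimeter_compact_finite:
  assumes U: "open U" and g: "continuous_on U g" and K: "compact F" "F \<subseteq> U"
    and fin: "perimeter F U < \<infinity>"
  shows "wperimeter U g F < \<infinity>"
proof -
  have "bounded (g ` F)"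
    using K g by (meson compact_continuous_image compact_imp_bounded continuous_on_subset)
  then obtain M where M: "\<And>x. x \<in> F \<Longrightarrow> g x \<le> M"
    unfolding bounded_iff by (metis image_eqI real_norm_def abs_le_D1)
  have FL: "F \<in> sets lebesgue" "F \<in> sets borel" using K(1) borel_compact[of F] by auto
  have o: "open (U - F)" using U K(1) by (simp add: compact_imp_closed open_Diff)
  have in1: "F \<in> sets (Dchi U F)" "U - F \<in> sets (Dchi U F)" using in_sets_Dchi[OF U] FL o K by auto
  have "emeasure (Dchi U F) (U - F) = perimeter F (U - F)"
    by (rule emeasure_Dchi_open[OF FL(1) U o]) auto
  also have "\<dots> = 0" by (rule perimeter_null[OF FL(1)]) auto
  finally have 0: "emeasure (Dchi U F) (U - F) = 0" .
  have "U - F \<in> null_sets (Dchi U F)" using 0 in1 by auto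
  then have "(\<integral>\<^sup>+x\<in>U - F. ennreal (g x) \<partial>Dchi U F) = 0"
    by (rule nn_integral_null_set)
  then have "wperimeter U g F = (\<integral>\<^sup>+x\<in>F. ennreal (g x) \<partial>Dchi U F)"
    using wperimeter_split[OF U g FL(2) K(2), of F] by simp
  also have "\<dots> \<le> ennreal M * emeasure (Dchi U F) F"
    by (rule set_nn_integral_Dchi_le[OF in1(1) M])
  also have "\<dots> \<le> ennreal M * emeasure (Dchi U F) U"
    using in_sets_Dchi[OF U, of U F] U by (intro mult_left_mono emeasure_mono K) auto
  also have "emeasure (Dchi U F) U = perimeter F U"
    by (rule emeasure_Dchi_open[OF FL(1) U U]) auto
  also have "ennreal M * perimeter F U < \<infinity>"
    using fin by (simp add: ennreal_mult_less_top)
  finally show ?thesis .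
qed

text \<open>Finitely many discs inside \<open>U\<close> already hold more than volume
  \<open>v\<close>. Shrinking them all about their centres by a common factor changes the volume
  continuously down to 0, so the value \<open>v\<close> is attained by a compact set of finite
  perimeter.\<close>

lemma finite_wperimeter_competitor:
  assumes U: "open U" and f: "continuous_on U f" and g: "continuous_on U g"
    and v: "0 \<le> v" "ennreal v < emeasure (fvol U f) U"
  obtains F where "finite_perimeter_in U F" "wvolume f F = ennreal v" "wperimeter U g F < \<infinity>"
proof -
  let ?\<nu> = "fvol U f"
  let ?B = "{ball x r |x r. r > 0 \<and> cball x r \<subseteq> U}"
  obtain \<F> where \<F>: "\<F> \<subseteq> ?B" "countable \<F>" "\<Union>\<F> = \<Union>?B"
  proof -
    have "\<And>S. S \<in> ?B \<Longrightarrow> open S" by auto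
    from Lindelof[OF this] show ?thesis using that by blast
  qed
  have UB: "\<Union>?B = U"
  proof
    show "\<Union>?B \<subseteq> U" using ball_subset_cball by blast
    show "U \<subseteq> \<Union>?B"
    proof
      fix x assume "x \<in> U"
      then obtain e where "e > 0" "cball x e \<subseteq> U" using U open_contains_cball by blast
      then show "x \<in> \<Union>?B" by (intro UnionI[of "ball x e"]) auto
    qed
  qed
  have "U \<noteq> {}" using v(2) by auto
  then have ne: "\<F> \<noteq> {}" using \<F>(3) UB by auto
  define b where "b = from_nat_into \<F>"
  have rb: "range b = \<F>" unfolding b_def by (rule range_from_nat_into[OF ne \<F>(2)])
  have "\<exists>x r. r > 0 \<and> cball x r \<subseteq> U \<and> b i = ball x r" for i
  proof -
    have "b i \<in> ?B" by (rule subsetD[OF \<F>(1)]) (simp only: rb[symmetric] rangeI)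
    then obtain x r where "b i = ball x r" "r > 0" "cball x r \<subseteq> U" by (elim CollectE exE conjE) simp
    then show ?thesis by (intro exI[of _ x] exI[of _ r]) simp
  qed
  then obtain c r where cr: "\<And>i. r i > 0" "\<And>i. cball (c i) (r i) \<subseteq> U" "\<And>i. b i = ball (c i) (r i)"
    by metis
  define Q where "Q n s = (\<Union>i<n. cball (c i) (s * r i))" for n :: nat and s :: real
  have Qc: "compact (Q n s)" for n s unfolding Q_def by (intro compact_UN) auto
  have QL: "Q n s \<in> sets lebesgue" for n s using Qc by (simp add: borel_compact)
  have Qmono: "Q n s \<subseteq> Q n s'" if "s \<le> s'" for n s s'
    unfolding Q_def using that cr(1) by (intro UN_mono subset_cball mult_right_mono) (auto intro: less_imp_le)
  have Q1: "Q n 1 \<subseteq> U" for n unfolding Q_def using cr(2) by auto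
  have "(\<Union>n. Q n 1) = U"
  proof
    show "(\<Union>n. Q n 1) \<subseteq> U" using Q1 by blast
    show "U \<subseteq> (\<Union>n. Q n 1)"
    proof
      fix x assume "x \<in> U"
      then have "x \<in> \<Union>(range b)" using \<F>(3) UB rb by simp
      then obtain i where "x \<in> b i" by blast
      then have "x \<in> Q (Suc i) 1" using cr(3)[of i] by (auto simp: Q_def intro!: bexI[of _ i])
      then show "x \<in> (\<Union>n. Q n 1)" by blast
    qed
  qed
  moreover have "(SUP n. emeasure ?\<nu> (Q n 1)) = emeasure ?\<nu> (\<Union>n. Q n 1)"
    by (rule SUP_emeasure_incseq) (use QL in \<open>auto simp: sets_fvol incseq_def Q_def intro: less_le_trans intro!: bexI\<close>)
  ultimately obtain n where n: "ennreal v < emeasure ?\<nu> (Q n 1)"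
    using v(2) less_SUP_iff[of "ennreal v"] by metis
  have "bounded (f ` Q n 1)"
    using Qc f Q1 by (meson compact_continuous_image compact_imp_bounded continuous_on_subset)
  then obtain M where M: "M > 0" "\<And>x. x \<in> Q n 1 \<Longrightarrow> f x \<le> M"
    unfolding bounded_pos by (metis image_eqI real_norm_def abs_le_D1)
  have fin: "emeasure ?\<nu> (Q n s) < \<infinity>" if "s \<le> 1" for s
  proof -
    have "emeasure ?\<nu> (Q n s) \<le> ennreal M * emeasure lebesgue (Q n s)"
      by (rule emeasure_fvol_le[OF U f QL]) (use M Qmono[OF that] in auto)
    also have "\<dots> < \<infinity>"
      using fmeasurableD2[OF lmeasurable_compact[OF Qc]] by (simp add: ennreal_mult_less_top less_top)
    finally show ?thesis .
  qed
  \<comment> \<open>\<open>M\<close> times the rate at which the discs gain area: pi r^2 (s'^2 -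
    s^2) is at most 2 pi r^2 (s' - s), because s' + s does not exceed 2.\<close>
  define B where "B = M * (\<Sum>i<n. 2 * pi * (r i)\<^sup>2)"
  define m where "m s = measure ?\<nu> (Q n s)" for s
  have m_eq: "emeasure ?\<nu> (Q n s) = ennreal (m s)" if "s \<le> 1" for s
    using fin[OF that] unfolding m_def by (intro emeasure_eq_ennreal_measure) (auto simp: less_top)
  have step: "m s' \<le> m s + B * (s' - s)" if s: "0 \<le> s" "s \<le> s'" "s' \<le> 1" for s s'
  proof -
    have ann: "measure lebesgue (cball (c i) (s' * r i) - cball (c i) (s * r i)) \<le> 2 * pi * (r i)\<^sup>2 * (s' - s)"
      "cball (c i) (s' * r i) - cball (c i) (s * r i) \<in> lmeasurable" for i
    proof -
      note a = measure_annulus[of "(s * r i)\<^sup>2" "(s' * r i)\<^sup>2" "c i"]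
      have le: "(s * r i)\<^sup>2 \<le> (s' * r i)\<^sup>2" using s cr(1)[of i] by (intro power_mono mult_right_mono) auto
      have sq: "sqrt ((s * r i)\<^sup>2) = s * r i" "sqrt ((s' * r i)\<^sup>2) = s' * r i"
        using s cr(1)[of i] by (auto simp: less_imp_le)
      have "measure lebesgue (cball (c i) (s' * r i) - cball (c i) (s * r i)) = pi * (s'\<^sup>2 - s\<^sup>2) * (r i)\<^sup>2"
        using a(1)[OF _ le] unfolding sq by (simp add: power_mult_distrib algebra_simps)
      also have "s'\<^sup>2 - s\<^sup>2 = (s' + s) * (s' - s)" by (simp add: power2_eq_square algebra_simps)
      also have "pi * ((s' + s) * (s' - s)) * (r i)\<^sup>2 \<le> pi * (2 * (s' - s)) * (r i)\<^sup>2"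
        using s by (intro mult_left_mono mult_right_mono) auto
      finally show "measure lebesgue (cball (c i) (s' * r i) - cball (c i) (s * r i)) \<le> 2 * pi * (r i)\<^sup>2 * (s' - s)"
        by (simp add: algebra_simps)
      show "cball (c i) (s' * r i) - cball (c i) (s * r i) \<in> lmeasurable"
        using a(2)[OF _ le] unfolding sq by simp
    qed
    let ?D = "\<Union>i<n. cball (c i) (s' * r i) - cball (c i) (s * r i)"
    have sub: "Q n s' \<subseteq> Q n s \<union> ?D" unfolding Q_def by blast
    have DL: "?D \<in> lmeasurable" using ann(2) by (intro fmeasurable.finite_UN) auto
    have DL': "?D \<in> sets lebesgue" using DL by (simp add: fmeasurableD)
    have Dsub: "?D \<subseteq> Q n 1" using Qmono[OF s(3)] unfolding Q_def by blast
    have "measure lebesgue ?D \<le> (\<Sum>i<n. measure lebesgue (cball (c i) (s' * r i) - cball (c i) (s * r i)))"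
      using ann(2) by (intro measure_UNION_le) (auto simp: fmeasurableD)
    also have "\<dots> \<le> (\<Sum>i<n. 2 * pi * (r i)\<^sup>2 * (s' - s))" by (intro sum_mono ann(1))
    also have "\<dots> = (\<Sum>i<n. 2 * pi * (r i)\<^sup>2) * (s' - s)" by (simp add: sum_distrib_right)
    finally have mD: "M * measure lebesgue ?D \<le> B * (s' - s)"
      unfolding B_def using M(1) by (simp add: mult.assoc)
    have "ennreal (m s') = emeasure ?\<nu> (Q n s')" using m_eq s by simp
    also have "\<dots> \<le> emeasure ?\<nu> (Q n s \<union> ?D)"
      using sub QL DL' by (intro emeasure_mono) (auto simp: sets_fvol)
    also have "\<dots> \<le> emeasure ?\<nu> (Q n s) + emeasure ?\<nu> ?D"
      using QL DL' by (intro emeasure_subadditive) (auto simp: sets_fvol)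
    also have "emeasure ?\<nu> ?D \<le> ennreal M * emeasure lebesgue ?D"
      by (rule emeasure_fvol_le[OF U f DL']) (use M(2) Dsub in blast)
    also have "\<dots> = ennreal (M * measure lebesgue ?D)"
      using DL M(1) by (simp add: emeasure_eq_measure2 ennreal_mult)
    also have "\<dots> \<le> ennreal (B * (s' - s))" by (rule ennreal_leI[OF mD])
    also have "emeasure ?\<nu> (Q n s) = ennreal (m s)" using m_eq s by simp
    also have "ennreal (m s) + ennreal (B * (s' - s)) = ennreal (m s + B * (s' - s))"
    proof (rule ennreal_plus[symmetric])
      show "0 \<le> m s" by (simp add: m_def)
      show "0 \<le> B * (s' - s)" using s M(1) by (auto simp: B_def intro!: mult_nonneg_nonneg sum_nonneg)
    qed
    finally have "ennreal (m s') \<le> ennreal (m s + B * (s' - s))" by (simp add: add_mono)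
    moreover have "0 \<le> m s + B * (s' - s)"
      using s M(1) by (auto simp: B_def m_def intro!: add_nonneg_nonneg mult_nonneg_nonneg sum_nonneg)
    ultimately show ?thesis by (simp add: ennreal_le_iff)
  qed
  have mmono: "m s \<le> m s'" if "s \<le> s'" "s' \<le> 1" for s s'
    unfolding m_def measure_def using Qmono[OF that(1), of n] QL fin[OF that(2)]
    by (intro enn2real_mono emeasure_mono) (auto simp: sets_fvol)
  have Bnn: "0 \<le> B" using M(1) by (auto simp: B_def intro!: mult_nonneg_nonneg sum_nonneg)
  have "B-lipschitz_on {0..1} m"
  proof (rule lipschitz_onI[OF _ Bnn])
    fix s s' assume "s \<in> {0..1::real}" "s' \<in> {0..1::real}"
    then show "dist (m s) (m s') \<le> B * dist s s'"
      using step[of s s'] step[of s' s] mmono[of s s'] mmono[of s' s]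
      by (cases "s \<le> s'") (auto simp: dist_real_def abs_if)
  qed
  then have cont: "continuous_on {0..1} m" by (rule lipschitz_on_continuous_on)
  \<comment> \<open>At factor 0 only the finitely many centres are left.\<close>
  have "Q n 0 \<in> null_sets lebesgue"
  proof -
    have "Q n 0 = c ` {..<n}" by (auto simp: Q_def)
    then show ?thesis by (simp add: finite_imp_null_set_lborel null_sets_completionI)
  qed
  then have "emeasure ?\<nu> (Q n 0) \<le> ennreal M * 0"
    using emeasure_fvol_le[OF U f QL, of n 0 M] M(2) Qmono[of 0 1 n] by (auto simp: subset_iff null_setsD1)
  then have "m 0 = 0" by (simp add: m_def measure_def)
  moreover have "v \<le> m 1" using n m_eq[of 1] v(1) by (simp add: ennreal_less_iff)
  ultimately obtain s where s: "0 \<le> s" "s \<le> 1" "m s = v"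
    using IVT'[of m 0 v 1] cont v(1) by auto
  show ?thesis
  proof
    have p: "perimeter (Q n s) W < \<infinity>" for W
      unfolding Q_def using s(1) cr(1) by (intro perimeter_Union_cball_finite) (simp add: less_imp_le)
    have sub: "Q n s \<subseteq> U" using Qmono[OF s(2)] Q1 by blast
    show "finite_perimeter_in U (Q n s)" unfolding finite_perimeter_in_def using QL sub p by blast
    show "wvolume f (Q n s) = ennreal v"
      using wvolume_eq_fvol[OF U f QL sub] m_eq[OF s(2)] s(3) by simp
    show "wperimeter U g (Q n s) < \<infinity>" by (rule wperimeter_compact_finite[OF U g Qc sub p])
  qed
qed

subsection \<open>Mollified indicators\<close>

definition bump_mass :: "real \<Rightarrow> real" where
  "bump_mass \<epsilon> = (\<integral>x. bump 0 \<epsilon> x \<partial>lebesgue)"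

lemma bump_translate: "bump z \<epsilon> x = bump 0 \<epsilon> (x - z)" "bump_grad z \<epsilon> x = bump_grad 0 \<epsilon> (x - z)"
  by (simp_all add: bump_def bump_grad_def)

lemma bump_commute: "bump z \<epsilon> x = bump x \<epsilon> z"
  by (simp add: bump_def norm_minus_commute)

lemma integrable_bump:
  assumes "F \<in> sets lebesgue" "\<epsilon> > 0"
  shows "integrable lebesgue (\<lambda>x. indicator F x * bump z \<epsilon> x)"
    "integrable lebesgue (\<lambda>x. indicator F x * (bump_grad z \<epsilon> x \<bullet> v))"
proof -
  show "integrable lebesgue (\<lambda>x. indicator F x * bump z \<epsilon> x)"
    by (rule integrable_indicator_continuous[OF assms(1) C1_continuous[OF C1_bump] compact_cball[of z \<epsilon>]])
       (use assms(2) in \<open>auto intro!: bump_outside\<close>)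
  have c: "continuous_on UNIV (\<lambda>x. bump_grad z \<epsilon> x \<bullet> v)"
    by (intro continuous_intros continuous_bump_grad)
  have "bump_grad z \<epsilon> x \<bullet> v = 0" if "x \<notin> cball z \<epsilon>" for x
    using bump_outside(2)[OF assms(2), of x z] that by auto
  from integrable_indicator_continuous[OF assms(1) c compact_cball this]
  show "integrable lebesgue (\<lambda>x. indicator F x * (bump_grad z \<epsilon> x \<bullet> v))" .
qed

lemma integral_bump: "(\<integral>x. bump z \<epsilon> x \<partial>lebesgue) = bump_mass \<epsilon>"
proof -
  have "(\<integral>x. bump 0 \<epsilon> (x + (- z)) \<partial>lebesgue) = bump_mass \<epsilon>"
    unfolding bump_mass_def by (rule lebesgue_integral_translate[OF C1_continuous[OF C1_bump]])
  moreover have "bump 0 \<epsilon> (x + (- z)) = bump z \<epsilon> x" for x by (simp add: bump_def)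
  ultimately show ?thesis by simp
qed

lemma nn_integral_bump:
  assumes "\<epsilon> > 0"
  shows "(\<integral>\<^sup>+x. ennreal (bump z \<epsilon> x) \<partial>lborel) = ennreal (bump_mass \<epsilon>)"
proof -
  have i: "integrable lebesgue (bump z \<epsilon>)" using integrable_bump(1)[of UNIV] assms by simp
  have "(\<integral>\<^sup>+x. ennreal (bump z \<epsilon> x) \<partial>lborel) = (\<integral>\<^sup>+x. ennreal (bump z \<epsilon> x) \<partial>lebesgue)"
    by (rule nn_integral_completion[symmetric])
  also have "\<dots> = ennreal (\<integral>x. bump z \<epsilon> x \<partial>lebesgue)"
    by (rule nn_integral_eq_integral[OF i]) (simp add: bump_nonneg)
  finally show ?thesis by (simp add: integral_bump)
qed

text \<open>The bump is at least 27/64 on the disc of half the radius, whose area exceeds 3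
  \<epsilon>^2 / 4; the product exceeds 81/256 \<epsilon>^2.\<close>

lemma bump_mass_ge:
  assumes "\<epsilon> > 0"
  shows "\<epsilon>\<^sup>2 / 4 \<le> bump_mass \<epsilon>"
proof -
  have m: "measure lebesgue (cball (0::R2) (\<epsilon> / 2)) = pi * (\<epsilon> / 2)\<^sup>2"
    using content_cball[of "\<epsilon> / 2" "0::R2"] assms by (simp add: unit_ball_vol_2)
  have "\<epsilon>\<^sup>2 / 4 \<le> 27 / 64 * (pi * (\<epsilon> / 2)\<^sup>2)"
  proof -
    have "\<epsilon>\<^sup>2 * 3 \<le> \<epsilon>\<^sup>2 * pi" using pi_gt3 by (intro mult_left_mono) auto
    moreover have "27 / 64 * (pi * (\<epsilon> / 2)\<^sup>2) = 27 / 256 * (\<epsilon>\<^sup>2 * pi)"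
      by (simp add: power2_eq_square)
    ultimately show ?thesis using zero_le_power2[of \<epsilon>] by linarith
  qed
  also have "\<dots> = (\<integral>x. 27 / 64 * indicator (cball (0::R2) (\<epsilon> / 2)) x \<partial>lebesgue)"
    using m by simp
  also have "\<dots> \<le> (\<integral>x. bump 0 \<epsilon> x \<partial>lebesgue)"
  proof (rule integral_mono)
    have "integrable lebesgue (indicator (cball (0::R2) (\<epsilon> / 2)) :: R2 \<Rightarrow> real)"
      using fmeasurableD2[OF lmeasurable_cball[of "0::R2" "\<epsilon> / 2"]] by (simp add: less_top)
    then show "integrable lebesgue (\<lambda>x. 27 / 64 * indicator (cball (0::R2) (\<epsilon> / 2)) x :: real)" by simp
    show "integrable lebesgue (bump 0 \<epsilon>)" using integrable_bump(1)[of UNIV] assms by simp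
    show "27 / 64 * indicator (cball 0 (\<epsilon> / 2)) x \<le> bump 0 \<epsilon> x" for x
      using bump_inside[OF assms, of x 0] bump_nonneg[of 0 \<epsilon> x] by (auto simp: indicator_def)
  qed
  finally show ?thesis by (simp add: bump_mass_def)
qed

text \<open>Here the centre moves, so the linear term carries the opposite sign of the gradient in
  \<open>x\<close>. The remainder is uniform in \<open>z\<close> and \<open>x\<close> because the
  gradient is globally Lipschitz.\<close>

lemma bump_taylor:
  assumes "\<epsilon> > 0"
  obtains M where "M > 0"
    "\<And>z v x. \<bar>bump (z + v) \<epsilon> x - bump z \<epsilon> x + bump_grad z \<epsilon> x \<bullet> v\<bar> \<le> M * (norm v)\<^sup>2"
proof -
  have C: "C1 (bump_grad 0 \<epsilon>)" by (rule C1I[OF bump_grad_derivative continuous_bump_hess])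
  have "supp (bump_grad 0 \<epsilon>) \<subseteq> cball 0 \<epsilon>"
    by (rule supp_subset_closed) (use bump_outside(2)[OF assms, of _ 0] in \<open>auto simp: not_le\<close>)
  then have "compact (supp (bump_grad 0 \<epsilon>))" by (rule compact_supp_subset[OF compact_cball])
  then obtain M where M: "M > 0" "\<And>x v. norm (fd (bump_grad 0 \<epsilon>) x v) \<le> M * norm v"
    using C1_fd_bound[OF C] by metis
  have lip: "norm (bump_grad 0 \<epsilon> a - bump_grad 0 \<epsilon> b) \<le> M * norm (a - b)" for a b
    by (rule C1_lipschitz_bound[OF C M(2)])
  have "\<bar>bump (z + v) \<epsilon> x - bump z \<epsilon> x + bump_grad z \<epsilon> x \<bullet> v\<bar> \<le> M * (norm v)\<^sup>2" for z v x
  proof -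
    let ?f = "\<lambda>a. bump 0 \<epsilon> a - bump_grad 0 \<epsilon> (x - z) \<bullet> a"
    have "norm (?f (x - z - v) - ?f (x - z)) \<le> (M * norm v) * norm (x - z - v - (x - z))"
    proof (rule differentiable_bound[OF convex_cball[of "x - z" "norm v"]])
      fix a assume a: "a \<in> cball (x - z) (norm v)"
      show "(?f has_derivative (\<lambda>w. bump_grad 0 \<epsilon> a \<bullet> w - bump_grad 0 \<epsilon> (x - z) \<bullet> w)) (at a within cball (x - z) (norm v))"
        by (intro has_derivative_diff has_derivative_at_withinI[OF bump_derivative])
           (auto intro!: derivative_eq_intros)
      show "onorm (\<lambda>w. bump_grad 0 \<epsilon> a \<bullet> w - bump_grad 0 \<epsilon> (x - z) \<bullet> w) \<le> M * norm v"
      proof (rule onorm_le)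
        fix w
        have "norm (bump_grad 0 \<epsilon> a \<bullet> w - bump_grad 0 \<epsilon> (x - z) \<bullet> w) \<le>
          norm (bump_grad 0 \<epsilon> a - bump_grad 0 \<epsilon> (x - z)) * norm w"
          unfolding inner_diff_left[symmetric] real_norm_def by (rule Cauchy_Schwarz_ineq2)
        also have "\<dots> \<le> M * norm (a - (x - z)) * norm w" by (intro mult_right_mono lip) simp
        also have "\<dots> \<le> M * norm v * norm w"
          using a M(1) by (intro mult_right_mono mult_left_mono) (auto simp: dist_norm norm_minus_commute)
        finally show "norm (bump_grad 0 \<epsilon> a \<bullet> w - bump_grad 0 \<epsilon> (x - z) \<bullet> w) \<le> M * norm v * norm w" .
      qed
    qed (auto simp: dist_norm)
    moreover have "?f (x - z - v) - ?f (x - z) = bump (z + v) \<epsilon> x - bump z \<epsilon> x + bump_grad z \<epsilon> x \<bullet> v"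
      unfolding bump_translate[of z] bump_translate(1)[of "z + v"]
      by (simp add: inner_diff_right algebra_simps)
    ultimately show ?thesis by (simp add: power2_eq_square)
  qed
  then show ?thesis using M(1) that by blast
qed

text \<open>The uniform quadratic remainder can be integrated directly, as all bumps involved live
  in one disc. The mollified indicator is differentiable although \<open>E\<close> is only
  measurable.\<close>

lemma mollified_derivative:
  fixes E :: "R2 set"
  assumes E: "E \<in> sets lebesgue" and \<epsilon>: "\<epsilon> > 0"
  defines "w \<equiv> \<lambda>z. \<integral>x. indicator E x * bump z \<epsilon> x \<partial>lebesgue"
  shows "((\<lambda>s. w (z + s *\<^sub>R d)) has_real_derivative
    (- (\<integral>x. indicator E x * (bump_grad (z + s *\<^sub>R d) \<epsilon> x \<bullet> d) \<partial>lebesgue))) (at s)"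
proof -
  define p where "p = z + s *\<^sub>R d"
  define D where "D = - (\<integral>x. indicator E x * (bump_grad p \<epsilon> x \<bullet> d) \<partial>lebesgue)"
  obtain M where M: "M > 0" "\<And>z v x. \<bar>bump (z + v) \<epsilon> x - bump z \<epsilon> x + bump_grad z \<epsilon> x \<bullet> v\<bar> \<le> M * (norm v)\<^sup>2"
    using bump_taylor[OF \<epsilon>] by metis
  \<comment> \<open>Contains the supports of the bumps centred at \<open>p\<close> and at
    \<open>p + h *\<^sub>R d\<close> for all increments of absolute value at most 1.\<close>
  define K where "K = cball p (\<epsilon> + norm d)"
  define A where "A = M * (norm d)\<^sup>2 * measure lebesgue K"
  have q: "\<bar>w (p + h *\<^sub>R d) - w p - h * D\<bar> \<le> A * h\<^sup>2" if h: "\<bar>h\<bar> \<le> 1" for h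
  proof -
    let ?r = "\<lambda>x. bump (p + h *\<^sub>R d) \<epsilon> x - bump p \<epsilon> x + bump_grad p \<epsilon> x \<bullet> (h *\<^sub>R d)"
    note i = integrable_bump(1)[OF E \<epsilon>] integrable_bump(2)[OF E \<epsilon>]
    have "w (p + h *\<^sub>R d) - w p - h * D = w (p + h *\<^sub>R d) - w p + (\<integral>x. h * (indicator E x * (bump_grad p \<epsilon> x \<bullet> d)) \<partial>lebesgue)"
      by (simp add: D_def)
    also have "\<dots> = (\<integral>x. indicator E x * bump (p + h *\<^sub>R d) \<epsilon> x - indicator E x * bump p \<epsilon> x
        + h * (indicator E x * (bump_grad p \<epsilon> x \<bullet> d)) \<partial>lebesgue)"
      unfolding w_def using i by simp
    also have "\<dots> = (\<integral>x. indicator E x * ?r x \<partial>lebesgue)"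
      by (rule Bochner_Integration.integral_cong) (auto simp: algebra_simps)
    finally have eq: "w (p + h *\<^sub>R d) - w p - h * D = (\<integral>x. indicator E x * ?r x \<partial>lebesgue)" .
    have bd: "\<bar>indicator E x * ?r x\<bar> \<le> indicator K x * (M * (norm (h *\<^sub>R d))\<^sup>2)" for x
    proof (cases "x \<in> K")
      case True
      then show ?thesis using M(2)[of p "h *\<^sub>R d" x] M(1) by (auto simp: indicator_def)
    next
      case False
      have "norm (h *\<^sub>R d) \<le> norm d" using h by (simp add: mult_left_le_one_le)
      moreover have "dist p x > \<epsilon> + norm d" using False by (simp add: K_def)
      moreover have "dist p x \<le> norm (h *\<^sub>R d) + dist (p + h *\<^sub>R d) x"
        using dist_triangle[of p x "p + h *\<^sub>R d"] by (simp add: dist_norm)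
      ultimately have "\<epsilon> < dist (p + h *\<^sub>R d) x" "\<epsilon> < dist p x" using norm_ge_zero[of d] by linarith+
      then show ?thesis
        using bump_outside[OF \<epsilon>, of x p] bump_outside[OF \<epsilon>, of x "p + h *\<^sub>R d"] M(1) by simp
    qed
    have "\<bar>\<integral>x. indicator E x * ?r x \<partial>lebesgue\<bar> \<le> (\<integral>x. indicator K x * (M * (norm (h *\<^sub>R d))\<^sup>2) \<partial>lebesgue)"
    proof (rule integral_abs_bound_integral)
      have "integrable lebesgue (indicator K :: R2 \<Rightarrow> real)"
        using fmeasurableD2[OF lmeasurable_cball[of p "\<epsilon> + norm d"]] by (simp add: K_def less_top)
      then show "integrable lebesgue (\<lambda>x. indicator K x * (M * (norm (h *\<^sub>R d))\<^sup>2))" by simp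
      have "integrable lebesgue (\<lambda>x. indicator E x * bump (p + h *\<^sub>R d) \<epsilon> x - indicator E x * bump p \<epsilon> x
        + h * (indicator E x * (bump_grad p \<epsilon> x \<bullet> d)))" using i by simp
      moreover have "indicator E x * bump (p + h *\<^sub>R d) \<epsilon> x - indicator E x * bump p \<epsilon> x
        + h * (indicator E x * (bump_grad p \<epsilon> x \<bullet> d)) = indicator E x * ?r x" for x
        by (simp add: algebra_simps)
      ultimately show "integrable lebesgue (\<lambda>x. indicator E x * ?r x)" by simp
    qed (rule bd)
    also have "\<dots> = A * h\<^sup>2" by (simp add: A_def power_mult_distrib)
    finally show ?thesis unfolding eq .
  qed
  have "((\<lambda>h. (w (p + h *\<^sub>R d) - w p) / h - D) \<longlongrightarrow> 0) (at 0)"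
  proof (rule Lim_null_comparison[where g="\<lambda>h. A * \<bar>h\<bar>"])
    have "\<forall>\<^sub>F h in at 0. \<bar>h::real\<bar> \<le> 1 \<and> h \<noteq> 0"
      by (auto simp: eventually_at intro!: exI[of _ 1])
    then show "\<forall>\<^sub>F h in at 0. norm ((w (p + h *\<^sub>R d) - w p) / h - D) \<le> A * \<bar>h\<bar>"
    proof eventually_elim
      case (elim h)
      have "(w (p + h *\<^sub>R d) - w p) / h - D = (w (p + h *\<^sub>R d) - w p - h * D) / h"
        using elim by (simp add: field_simps)
      moreover have "\<bar>w (p + h *\<^sub>R d) - w p - h * D\<bar> / \<bar>h\<bar> \<le> A * h\<^sup>2 / \<bar>h\<bar>"
        using q elim by (intro divide_right_mono) auto
      moreover have "A * h\<^sup>2 / \<bar>h\<bar> = A * \<bar>h\<bar>"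
        using elim by (metis abs_eq_0 nonzero_mult_div_cancel_right power2_abs power2_eq_square times_divide_eq_right)
      ultimately show ?case by (simp add: abs_divide)
    qed
    have "((\<lambda>h::real. A * \<bar>h\<bar>) \<longlongrightarrow> A * \<bar>0\<bar>) (at 0)" by (intro tendsto_intros)
    then show "((\<lambda>h::real. A * \<bar>h\<bar>) \<longlongrightarrow> 0) (at 0)" by simp
  qed
  then have "((\<lambda>h. (w (p + h *\<^sub>R d) - w p) / h) \<longlongrightarrow> D) (at 0)" by (simp add: LIM_zero_iff)
  then show ?thesis by (simp add: DERIV_def D_def p_def algebra_simps)
qed

text \<open>Mean value theorem on the segment. The bound \<open>le\<close> is one-sided but holds
  for every unit vector, and the one opposite to the displacement is the one required.\<close>

lemma mollified_lipschitz:
  fixes E :: "R2 set"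
  assumes E: "E \<in> sets lebesgue" and \<epsilon>: "\<epsilon> > 0" and S: "convex S" "z \<in> S" "z' \<in> S"
    and le: "\<And>z e. z \<in> S \<Longrightarrow> norm e = 1 \<Longrightarrow> (\<integral>x. indicator E x * (bump_grad z \<epsilon> x \<bullet> e) \<partial>lebesgue) \<le> C"
  shows "(\<integral>x. indicator E x * bump z' \<epsilon> x \<partial>lebesgue) - (\<integral>x. indicator E x * bump z \<epsilon> x \<partial>lebesgue) \<le> C * dist z z'"
proof (cases "z = z'")
  case False
  define d where "d = z' - z"
  have d: "norm d > 0" using False by (simp add: d_def)
  let ?w = "\<lambda>z. \<integral>x. indicator E x * bump z \<epsilon> x \<partial>lebesgue"
  have "\<exists>s>0. s < 1 \<and> ?w (z + 1 *\<^sub>R d) - ?w (z + 0 *\<^sub>R d) =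
    (1 - 0) * - (\<integral>x. indicator E x * (bump_grad (z + s *\<^sub>R d) \<epsilon> x \<bullet> d) \<partial>lebesgue)"
    by (rule MVT2) (auto intro: mollified_derivative[OF E \<epsilon>])
  then obtain s where s: "0 < s" "s < 1"
    "?w z' - ?w z = - (\<integral>x. indicator E x * (bump_grad (z + s *\<^sub>R d) \<epsilon> x \<bullet> d) \<partial>lebesgue)"
    by (auto simp: d_def)
  define e where "e = (- 1 / norm d) *\<^sub>R d"
  have p: "z + s *\<^sub>R d \<in> S"
  proof -
    have "z + s *\<^sub>R d = (1 - s) *\<^sub>R z + s *\<^sub>R z'" by (simp add: d_def algebra_simps)
    then show ?thesis using convexD_alt[OF S, of s] s by simp
  qed
  have "norm e = 1" using d by (simp add: e_def)
  from le[OF p this] have "(\<integral>x. indicator E x * (bump_grad (z + s *\<^sub>R d) \<epsilon> x \<bullet> e) \<partial>lebesgue) \<le> C" .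
  then have "norm d * (\<integral>x. indicator E x * (bump_grad (z + s *\<^sub>R d) \<epsilon> x \<bullet> e) \<partial>lebesgue) \<le> norm d * C"
    using d by (intro mult_left_mono) auto
  moreover have "norm d * (\<integral>x. indicator E x * (bump_grad (z + s *\<^sub>R d) \<epsilon> x \<bullet> e) \<partial>lebesgue)
     = (\<integral>x. norm d * (indicator E x * (bump_grad (z + s *\<^sub>R d) \<epsilon> x \<bullet> e)) \<partial>lebesgue)" by simp
  moreover have "\<dots> = (\<integral>x. (- 1) * (indicator E x * (bump_grad (z + s *\<^sub>R d) \<epsilon> x \<bullet> d)) \<partial>lebesgue)"
    by (rule Bochner_Integration.integral_cong) (use d in \<open>auto simp: e_def\<close>)
  ultimately show ?thesis using s(3) by (simp add: d_def dist_norm norm_minus_commute mult.commute)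
qed simp

text \<open>A replacement for the density theorem. If \<open>B - E\<close> had positive measure, a
  compact \<open>K\<close> inside it with a tight open neighbourhood \<open>V\<close> would violate
  a mass balance: bumps centred in \<open>K\<close> meet \<open>E\<close> only in
  \<open>V - K\<close>, which is too small to supply the fraction \<open>c\<close> of their mass on
  average.\<close>

lemma null_set_mollified:
  fixes E B :: "R2 set"
  assumes E: "E \<in> sets lebesgue" and B: "B \<in> sets lebesgue" "bounded B" and c: "c > 0"
    and ge: "\<And>\<delta>. \<delta> > 0 \<Longrightarrow> \<exists>\<epsilon>>0. \<epsilon> < \<delta> \<and> (\<forall>z\<in>B. c * bump_mass \<epsilon> \<le> (\<integral>x. indicator E x * bump z \<epsilon> x \<partial>lebesgue))"
  shows "B - E \<in> null_sets lebesgue"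
proof (rule ccontr)
  assume nn: "B - E \<notin> null_sets lebesgue"
  have BE: "B - E \<in> lmeasurable"
    using B E by (intro bounded_set_imp_lmeasurable bounded_diff sets.Diff) auto
  have pos: "measure lebesgue (B - E) > 0"
    using nn BE by (metis completion.complete2 emeasure_eq_measure2 ennreal_0 fmeasurableD measure_nonneg null_setsI order_le_less)
  obtain K where K: "closed K" "K \<subseteq> B - E" "B - E - K \<in> lmeasurable"
    "emeasure lebesgue (B - E - K) < ennreal (measure lebesgue (B - E))"
    using sets_lebesgue_inner_closed[OF fmeasurableD[OF BE] pos] by metis
  have "bounded K" using K(2) B(2) by (meson Diff_subset bounded_subset subset_trans)
  then have Kc: "compact K" using K(1) by (simp add: compact_eq_bounded_closed)
  then have Km: "K \<in> lmeasurable" by (rule lmeasurable_compact)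
  define m where "m = measure lebesgue K"
  have m: "m > 0"
  proof -
    have "measure lebesgue (B - E - K) < measure lebesgue (B - E)"
      using K(3,4) pos by (simp add: emeasure_eq_measure2 ennreal_less_iff)
    moreover have "measure lebesgue (B - E) = measure lebesgue (B - E - K) + m"
      using measurable_measure_Diff[OF BE _ K(2)] Km by (simp add: m_def fmeasurableD)
    ultimately show ?thesis by linarith
  qed
  \<comment> \<open>The excess \<open>c * m\<close> is the threshold at which the two sides of the
    final estimate collide.\<close>
  obtain V where V: "open V" "K \<subseteq> V" "V - K \<in> lmeasurable" "emeasure lebesgue (V - K) < ennreal (c * m)"
    using sets_lebesgue_outer_open[OF fmeasurableD[OF Km], of "c * m"] c m by auto
  obtain \<delta> where \<delta>: "\<delta> > 0" "(\<Union>x\<in>K. ball x \<delta>) \<subseteq> V"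
    using compact_subset_open_imp_ball_epsilon_subset[OF Kc V(1,2)] by metis
  obtain \<epsilon> where \<epsilon>: "\<epsilon> > 0" "\<epsilon> < \<delta>" and
    low: "\<And>z. z \<in> B \<Longrightarrow> c * bump_mass \<epsilon> \<le> (\<integral>x. indicator E x * bump z \<epsilon> x \<partial>lebesgue)"
    using ge[OF \<delta>(1)] by blast
  have mass: "bump_mass \<epsilon> > 0"
  proof -
    have "0 < \<epsilon>\<^sup>2 / 4" using \<epsilon>(1) by simp
    then show ?thesis using bump_mass_ge[OF \<epsilon>(1)] by linarith
  qed
  have VK: "V - K \<in> sets borel" "K \<in> sets borel" using V(1) K(1) by auto
  \<comment> \<open>A bump centred in \<open>K\<close> is supported in \<open>V\<close>, as
    \<epsilon> < \<delta>, and \<open>E\<close> avoids \<open>K\<close>; so all that it sees of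
    \<open>E\<close> lies in \<open>V - K\<close>.\<close>
  have inner: "ennreal (c * bump_mass \<epsilon>) \<le> (\<integral>\<^sup>+x. indicator (V - K) x * ennreal (bump z \<epsilon> x) \<partial>lborel)"
    if z: "z \<in> K" for z
  proof -
    have VL: "V - K \<in> sets lebesgue" using VK(1) by simp
    have "c * bump_mass \<epsilon> \<le> (\<integral>x. indicator E x * bump z \<epsilon> x \<partial>lebesgue)"
      using low z K(2) by auto
    also have "\<dots> \<le> (\<integral>x. indicator (V - K) x * bump z \<epsilon> x \<partial>lebesgue)"
    proof (rule integral_mono[OF integrable_bump(1)[OF E \<epsilon>(1)] integrable_bump(1)[OF VL \<epsilon>(1)]])
      fix x
      show "indicator E x * bump z \<epsilon> x \<le> indicator (V - K) x * bump z \<epsilon> x"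
      proof (cases "x \<in> ball z \<epsilon>")
        case True
        then have "x \<in> V" using \<delta>(2) \<epsilon>(2) z by fastforce
        then show ?thesis using K(2) bump_nonneg[of z \<epsilon> x] by (auto simp: indicator_def)
      next
        case False
        then show ?thesis using bump_outside(1)[OF \<epsilon>(1)] by simp
      qed
    qed
    finally have "ennreal (c * bump_mass \<epsilon>) \<le> ennreal (\<integral>x. indicator (V - K) x * bump z \<epsilon> x \<partial>lebesgue)"
      by (rule ennreal_leI)
    also have "\<dots> = (\<integral>\<^sup>+x. ennreal (indicator (V - K) x * bump z \<epsilon> x) \<partial>lebesgue)"
      by (rule nn_integral_eq_integral[symmetric, OF integrable_bump(1)[OF VL \<epsilon>(1)]])
         (simp add: bump_nonneg)
    also have "\<dots> = (\<integral>\<^sup>+x. ennreal (indicator (V - K) x * bump z \<epsilon> x) \<partial>lborel)"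
      by (rule nn_integral_completion)
    also have "\<dots> = (\<integral>\<^sup>+x. indicator (V - K) x * ennreal (bump z \<epsilon> x) \<partial>lborel)"
      by (rule nn_integral_cong) (simp add: indicator_def)
    finally show ?thesis .
  qed
  let ?h = "\<lambda>p::R2 \<times> R2. ennreal (bump (fst p) \<epsilon> (snd p)) * (indicator K (fst p) * indicator (V - K) (snd p))"
  have meas: "?h \<in> borel_measurable (lborel \<Otimes>\<^sub>M lborel)"
  proof -
    have "continuous_on UNIV (\<lambda>p::R2 \<times> R2. bump 0 \<epsilon> (snd p - fst p))"
      by (intro continuous_on_compose2[OF C1_continuous[OF C1_bump, of UNIV]] continuous_intros) auto
    then have "(\<lambda>p::R2 \<times> R2. bump (fst p) \<epsilon> (snd p)) \<in> borel_measurable borel"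
      unfolding bump_translate(1)[of "fst _"] by (rule borel_measurable_continuous_onI)
    then have 1: "(\<lambda>p::R2 \<times> R2. bump (fst p) \<epsilon> (snd p)) \<in> borel_measurable (lborel \<Otimes>\<^sub>M lborel)"
      by (simp add: lborel_prod)
    have 2: "(\<lambda>p::R2 \<times> R2. indicator K (fst p) :: ennreal) \<in> borel_measurable (lborel \<Otimes>\<^sub>M lborel)"
      "(\<lambda>p::R2 \<times> R2. indicator (V - K) (snd p) :: ennreal) \<in> borel_measurable (lborel \<Otimes>\<^sub>M lborel)"
      using VK by measurable
    show ?thesis using 1 2 by measurable
  qed
  have "ennreal (c * bump_mass \<epsilon>) * ennreal m = (\<integral>\<^sup>+z. ennreal (c * bump_mass \<epsilon>) * indicator K z \<partial>lborel)"
  proof -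
    have "emeasure lebesgue K = ennreal m" using Km by (simp add: m_def emeasure_eq_measure2)
    then have "emeasure lborel K = ennreal m" using VK(2) by simp
    then show ?thesis using VK(2) by (simp add: nn_integral_cmult_indicator)
  qed
  also have "\<dots> \<le> (\<integral>\<^sup>+z. \<integral>\<^sup>+x. ?h (z, x) \<partial>lborel \<partial>lborel)"
    by (rule nn_integral_mono) (use inner in \<open>auto simp: indicator_def mult.commute if_distrib cong: if_cong\<close>)
  \<comment> \<open>After the exchange the inner integral runs over the centres. By symmetry of the
    bump it is at most a full \<open>bump_mass\<close>, and it is counted only for \<open>x\<close>
    in \<open>V - K\<close>.\<close>
  also have "\<dots> = (\<integral>\<^sup>+x. \<integral>\<^sup>+z. ?h (z, x) \<partial>lborel \<partial>lborel)"
    by (rule lborel_pair.Fubini'[symmetric]) (use meas in \<open>simp add: case_prod_unfold\<close>)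
  also have "\<dots> \<le> (\<integral>\<^sup>+x. ennreal (bump_mass \<epsilon>) * indicator (V - K) x \<partial>lborel)"
  proof (rule nn_integral_mono)
    fix x
    have "(\<integral>\<^sup>+z. ?h (z, x) \<partial>lborel) \<le> (\<integral>\<^sup>+z. ennreal (bump x \<epsilon> z) * indicator (V - K) x \<partial>lborel)"
      by (rule nn_integral_mono) (auto simp: indicator_def bump_commute)
    also have "\<dots> = ennreal (bump_mass \<epsilon>) * indicator (V - K) x"
      using nn_integral_bump[OF \<epsilon>(1), of x] by (auto simp: indicator_def)
    finally show "(\<integral>\<^sup>+z. ?h (z, x) \<partial>lborel) \<le> ennreal (bump_mass \<epsilon>) * indicator (V - K) x" .
  qed
  also have "\<dots> = ennreal (bump_mass \<epsilon>) * emeasure lebesgue (V - K)"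
    using VK(1) by (simp add: nn_integral_cmult_indicator)
  also have "\<dots> < ennreal (bump_mass \<epsilon>) * ennreal (c * m)"
    using V(4) mass by (intro ennreal_mult_strict_left_mono) auto
  also have "\<dots> = ennreal (c * bump_mass \<epsilon>) * ennreal m"
    using c m mass by (simp add: ennreal_mult[symmetric] mult_ac)
  finally show False by simp
qed

text \<open>The gradient bound lets the mollified indicator differ from its value at
  \<open>y\<close> by at most C \<rho> \<epsilon>^2, which is at most an eighth of the bump mass. If
  that value is at least half the mass at arbitrarily small scales, it exceeds a quarter of it
  throughout the disc and \<open>E\<close> fills the disc; otherwise the same applies to the
  complement. Either way the disc carries no perimeter.\<close>

lemma perimeter_zero_small_gradient:
  fixes E :: "R2 set"
  assumes E: "E \<in> sets lebesgue" and \<rho>: "\<rho> > 0" and C: "0 \<le> C" "C * \<rho> \<le> 1 / 32"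
    and le: "\<And>z \<epsilon> e. \<lbrakk>0 < \<epsilon>; norm e = 1; cball z \<epsilon> \<subseteq> ball y (2 * \<rho>)\<rbrakk> \<Longrightarrow>
       (\<integral>x. indicator E x * (bump_grad z \<epsilon> x \<bullet> e) \<partial>lebesgue) \<le> C * \<epsilon>\<^sup>2"
  shows "perimeter E (ball y \<rho>) = 0"
proof -
  let ?w = "\<lambda>\<epsilon> z. \<integral>x. indicator E x * bump z \<epsilon> x \<partial>lebesgue"
  have osc: "?w \<epsilon> z - ?w \<epsilon> z' \<le> bump_mass \<epsilon> / 8"
    if \<epsilon>: "0 < \<epsilon>" "\<epsilon> < \<rho>" and z: "z \<in> ball y \<rho>" "z' \<in> ball y \<rho>" "z = y \<or> z' = y" for \<epsilon> z z'
  proof -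
    have "?w \<epsilon> z - ?w \<epsilon> z' \<le> C * \<epsilon>\<^sup>2 * dist z' z"
    proof (rule mollified_lipschitz[OF E \<epsilon>(1) convex_ball z(2,1)])
      fix p and e :: R2 assume "p \<in> ball y \<rho>" "norm e = 1"
      then show "(\<integral>x. indicator E x * (bump_grad p \<epsilon> x \<bullet> e) \<partial>lebesgue) \<le> C * \<epsilon>\<^sup>2"
        using \<epsilon> by (intro le) (auto simp: cball_subset_ball_iff dist_commute)
    qed
    also have "\<dots> \<le> C * \<epsilon>\<^sup>2 * \<rho>"
      using z C(1) by (intro mult_left_mono) (auto simp: dist_commute)
    also have "\<dots> = C * \<rho> * \<epsilon>\<^sup>2" by simp
    also have "\<dots> \<le> 1 / 32 * \<epsilon>\<^sup>2" by (intro mult_right_mono C(2)) simp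
    also have "\<dots> \<le> bump_mass \<epsilon> / 8" using bump_mass_ge[OF \<epsilon>(1)] by simp
    finally show ?thesis .
  qed
  have yB: "y \<in> ball y \<rho>" using \<rho> by simp
  have mnn: "bump_mass \<epsilon> \<ge> 0" if "\<epsilon> > 0" for \<epsilon>
    using bump_mass_ge[OF that] zero_le_power2[of \<epsilon>] by linarith
  show ?thesis
  proof (cases "\<forall>\<delta>>0. \<exists>\<epsilon>>0. \<epsilon> < \<delta> \<and> bump_mass \<epsilon> / 2 \<le> ?w \<epsilon> y")
    case True
    have "ball y \<rho> - E \<in> null_sets lebesgue"
    proof (rule null_set_mollified[OF E _ bounded_ball, where c="1 / 4"])
      fix \<delta> :: real assume "\<delta> > 0"
      then obtain \<epsilon> where \<epsilon>: "\<epsilon> > 0" "\<epsilon> < min \<delta> \<rho>" "bump_mass \<epsilon> / 2 \<le> ?w \<epsilon> y"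
        using True \<rho> by (metis min_less_iff_conj)
      have "1 / 4 * bump_mass \<epsilon> \<le> ?w \<epsilon> z" if "z \<in> ball y \<rho>" for z
        using osc[OF \<epsilon>(1) _ yB that] \<epsilon> mnn[OF \<epsilon>(1)] by simp
      then show "\<exists>\<epsilon>>0. \<epsilon> < \<delta> \<and> (\<forall>z\<in>ball y \<rho>. 1 / 4 * bump_mass \<epsilon> \<le> ?w \<epsilon> z)"
        using \<epsilon> by auto
    qed auto
    then have "AE x in lebesgue. x \<notin> ball y \<rho> - E" by (rule AE_not_in)
    then show ?thesis by (intro perimeter_conull[OF E]) auto
  next
    case False
    then obtain \<delta>0 where \<delta>0: "\<delta>0 > 0" "\<And>\<epsilon>. \<epsilon> > 0 \<Longrightarrow> \<epsilon> < \<delta>0 \<Longrightarrow> ?w \<epsilon> y < bump_mass \<epsilon> / 2"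
      by (meson not_le)
    have nE: "- E \<in> sets lebesgue" using E by (simp add: Compl_in_sets_lebesgue)
    have "ball y \<rho> - (- E) \<in> null_sets lebesgue"
    proof (rule null_set_mollified[OF nE _ bounded_ball, where c="1 / 4"])
      fix \<delta> :: real assume "\<delta> > 0"
      then have "0 < min \<delta> (min \<delta>0 \<rho>)" using \<delta>0(1) \<rho> by simp
      then obtain \<epsilon> where \<epsilon>: "\<epsilon> > 0" "\<epsilon> < min \<delta> (min \<delta>0 \<rho>)" using dense by blast
      have "1 / 4 * bump_mass \<epsilon> \<le> (\<integral>x. indicator (- E) x * bump z \<epsilon> x \<partial>lebesgue)" if z: "z \<in> ball y \<rho>" for z
      proof -
        have i: "integrable lebesgue (bump z \<epsilon>)" using integrable_bump(1)[of UNIV] \<epsilon> by simp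
        have "(\<integral>x. indicator (- E) x * bump z \<epsilon> x \<partial>lebesgue) = (\<integral>x. bump z \<epsilon> x - indicator E x * bump z \<epsilon> x \<partial>lebesgue)"
          by (rule Bochner_Integration.integral_cong) (auto simp: indicator_def)
        also have "\<dots> = bump_mass \<epsilon> - ?w \<epsilon> z"
          using i integrable_bump(1)[OF E \<epsilon>(1)] by (simp add: integral_bump)
        finally show ?thesis using osc[OF \<epsilon>(1) _ z yB] \<delta>0(2)[of \<epsilon>] \<epsilon> mnn[OF \<epsilon>(1)] by simp
      qed
      then show "\<exists>\<epsilon>>0. \<epsilon> < \<delta> \<and> (\<forall>z\<in>ball y \<rho>. 1 / 4 * bump_mass \<epsilon> \<le> (\<integral>x. indicator (- E) x * bump z \<epsilon> x \<partial>lebesgue))"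
        using \<epsilon> by auto
    qed auto
    then have "AE x in lebesgue. x \<notin> ball y \<rho> - (- E)" by (rule AE_not_in)
    then show ?thesis by (intro perimeter_null[OF E]) auto
  qed
qed

subsection \<open>Local deformations\<close>

text \<open>The scalar integrand is wrapped into \<open>real^1\<close> to fit the vector-valued
  change of variables.\<close>

lemma change_of_variables_real:
  fixes w :: "R2 \<Rightarrow> real" and \<Phi> :: "R2 \<Rightarrow> R2"
  assumes "S \<in> sets lebesgue" "\<And>x. (\<Phi> has_derivative \<Phi>' x) (at x)" "inj \<Phi>"
    and int: "integrable lebesgue (\<lambda>x. indicator (\<Phi> ` S) x * w x)"
  shows "integrable lebesgue (\<lambda>x. indicator S x * (\<bar>det (matrix (\<Phi>' x))\<bar> * w (\<Phi> x)))"
    "(\<integral>x. indicator (\<Phi> ` S) x * w x \<partial>lebesgue)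
      = (\<integral>x. indicator S x * (\<bar>det (matrix (\<Phi>' x))\<bar> * w (\<Phi> x)) \<partial>lebesgue)"
proof -
  let ?w = "\<lambda>x. vec (w x) :: real^1"
  let ?J = "\<lambda>x. \<bar>det (matrix (\<Phi>' x))\<bar>"
  have a: "w absolutely_integrable_on (\<Phi> ` S)"
    using int unfolding set_integrable_def by simp
  have cv: "(\<lambda>x. ?J x *\<^sub>R ?w (\<Phi> x)) absolutely_integrable_on S \<and>
      integral S (\<lambda>x. ?J x *\<^sub>R ?w (\<Phi> x)) = vec (integral (\<Phi> ` S) w)"
    using has_absolute_integral_change_of_variables[of S \<Phi> \<Phi>' ?w "vec (integral (\<Phi> ` S) w)"] a
      assms(1) has_derivative_at_withinI[OF assms(2)] inj_on_subset[OF assms(3) subset_UNIV]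
    by (simp add: absolutely_integrable_on_1_iff integral_on_1_eq)
  then have b: "(\<lambda>x. ?J x * w (\<Phi> x)) absolutely_integrable_on S"
    and i: "integral S (\<lambda>x. ?J x * w (\<Phi> x)) = integral (\<Phi> ` S) w"
    by (simp_all add: absolutely_integrable_on_1_iff integral_on_1_eq)
  show "integrable lebesgue (\<lambda>x. indicator S x * (?J x * w (\<Phi> x)))"
    using b unfolding set_integrable_def by simp
  show "(\<integral>x. indicator (\<Phi> ` S) x * w x \<partial>lebesgue)
      = (\<integral>x. indicator S x * (?J x * w (\<Phi> x)) \<partial>lebesgue)"
    using set_lebesgue_integral_eq_integral(2)[OF a] set_lebesgue_integral_eq_integral(2)[OF b] i
    unfolding set_lebesgue_integral_def by simp
qed

text \<open>The bump has slope at most 6/\<epsilon>, so the bound on \<open>t\<close> makes the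
  displacement Lipschitz with constant 1/2. Invertibility, \<open>J \<ge> 1/2\<close> and
  \<open>\<kappa> \<le> 2\<close> all rest on this. No assumption involves \<open>z\<close>, which
  is why the locale predicate has only the arguments \<open>e\<close>, \<epsilon> and
  \<open>t\<close>.\<close>

locale deform =
  fixes z e :: R2 and \<epsilon> t :: real
  assumes \<epsilon>: "\<epsilon> > 0" and e: "norm e = 1" and t: "12 * \<bar>t\<bar> \<le> \<epsilon>"
begin

abbreviation h where "h \<equiv> bump z \<epsilon>"
abbreviation gr where "gr \<equiv> bump_grad z \<epsilon>"
abbreviation D where "D \<equiv> cball z \<epsilon>"

definition \<Phi> :: "R2 \<Rightarrow> R2" where "\<Phi> x = x + (t * h x) *\<^sub>R e"
definition J :: "R2 \<Rightarrow> real" where "J x = 1 + t * (gr x \<bullet> e)"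
text \<open>The norm bound of the Piola transform: 6|t|/\<epsilon> from the Jacobian and as much
  again from the rank-one correction.\<close>

definition \<kappa> :: real where "\<kappa> = 1 + 12 * \<bar>t\<bar> / \<epsilon>"

lemma \<kappa>: "1 \<le> \<kappa>" "\<kappa> \<le> 2"
  using \<epsilon> t by (simp_all add: \<kappa>_def)

lemma \<Phi>_derivative: "(\<Phi> has_derivative (\<lambda>v. v + (t * (gr x \<bullet> v)) *\<^sub>R e)) (at x)"
  unfolding \<Phi>_def[abs_def]
  by (auto intro!: derivative_eq_intros bump_derivative simp: mult.commute)

lemma t_gr: "\<bar>t * (gr x \<bullet> v)\<bar> \<le> 6 * \<bar>t\<bar> / \<epsilon> * norm v"
proof -
  have "\<bar>gr x \<bullet> v\<bar> \<le> 6 / \<epsilon> * norm v"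
    using Cauchy_Schwarz_ineq2[of "gr x" v] norm_bump_grad[OF \<epsilon>, of z x] mult_right_mono[of "norm (gr x)" "6 / \<epsilon>" "norm v"]
    by simp
  then have "\<bar>t\<bar> * \<bar>gr x \<bullet> v\<bar> \<le> \<bar>t\<bar> * (6 / \<epsilon> * norm v)" by (intro mult_left_mono) auto
  then show ?thesis by (simp add: abs_mult mult_ac)
qed

lemma t_half: "6 * \<bar>t\<bar> / \<epsilon> \<le> 1 / 2"
  using t \<epsilon> by (simp add: divide_simps)

lemma J_bounds: "1 / 2 \<le> J x" "\<bar>J x - 1\<bar> \<le> 6 * \<bar>t\<bar> / \<epsilon>"
proof -
  show "\<bar>J x - 1\<bar> \<le> 6 * \<bar>t\<bar> / \<epsilon>" using t_gr[of x e] e by (simp add: J_def)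
  then show "1 / 2 \<le> J x" using t_half by linarith
qed

lemma det_\<Phi>: "\<bar>det (matrix (\<lambda>v. v + (t * (gr x \<bullet> v)) *\<^sub>R e))\<bar> = J x"
proof -
  have "det (matrix (\<lambda>v. v + (t * (gr x \<bullet> v)) *\<^sub>R e)) = J x"
    by (simp add: det_2 matrix_def axis_def J_def inner_vec_def sum_2 algebra_simps)
  then show ?thesis using J_bounds(1)[of x] by simp
qed

lemma \<Phi>_perturb: "norm ((\<Phi> x - x) - (\<Phi> y - y)) \<le> 1 / 2 * norm (x - y)"
proof -
  have "\<bar>t * h x - t * h y\<bar> \<le> 6 * \<bar>t\<bar> / \<epsilon> * norm (x - y)"
  proof -
    have "\<bar>h x - h y\<bar> \<le> 6 / \<epsilon> * norm (x - y)"
      using C1_lipschitz_bound[OF C1_bump, of z \<epsilon> "6 / \<epsilon>" x y]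
        order_trans[OF Cauchy_Schwarz_ineq2 mult_right_mono[OF norm_bump_grad[OF \<epsilon>] norm_ge_zero]]
      by (simp add: fd_bump)
    then have "\<bar>t\<bar> * \<bar>h x - h y\<bar> \<le> \<bar>t\<bar> * (6 / \<epsilon> * norm (x - y))" by (intro mult_left_mono) auto
    then show ?thesis by (simp add: abs_mult[symmetric] right_diff_distrib mult_ac)
  qed
  also have "\<dots> \<le> 1 / 2 * norm (x - y)" by (intro mult_right_mono t_half) simp
  finally have "\<bar>t * h x - t * h y\<bar> \<le> 1 / 2 * norm (x - y)" .
  moreover have "(\<Phi> x - x) - (\<Phi> y - y) = (t * h x - t * h y) *\<^sub>R e"
    by (simp add: \<Phi>_def algebra_simps)
  ultimately show ?thesis using e by simp
qed

lemma \<Phi>_expand: "norm (x - y) \<le> 2 * norm (\<Phi> x - \<Phi> y)"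
proof -
  have "x - y = (\<Phi> x - \<Phi> y) - ((\<Phi> x - x) - (\<Phi> y - y))" by simp
  then have "norm (x - y) \<le> norm (\<Phi> x - \<Phi> y) + norm ((\<Phi> x - x) - (\<Phi> y - y))"
    by (metis norm_triangle_ineq4)
  then show ?thesis using \<Phi>_perturb[of x y] by linarith
qed

lemma inj_\<Phi>: "inj \<Phi>"
proof (rule injI)
  show "x = y" if "\<Phi> x = \<Phi> y" for x y using \<Phi>_expand[of x y] that by simp
qed

lemma surj_\<Phi>: "surj \<Phi>"
proof -
  have "\<exists>x. \<Phi> x = y" for y
  proof -
    \<comment> \<open>A preimage of \<open>y\<close> is a fixed point of a contraction with factor
      1/2.\<close>
    have "\<exists>!x. y - (\<Phi> x - x) = x"
    proof (rule banach_fix_type[of "1 / 2"])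
      have "norm ((y - (\<Phi> a - a)) - (y - (\<Phi> b - b))) \<le> 1 / 2 * norm (a - b)" for a b
      proof -
        have "(y - (\<Phi> a - a)) - (y - (\<Phi> b - b)) = - ((\<Phi> a - a) - (\<Phi> b - b))" by simp
        then show ?thesis using \<Phi>_perturb[of a b] by (metis norm_minus_cancel)
      qed
      then show "\<forall>a b. dist (y - (\<Phi> a - a)) (y - (\<Phi> b - b)) \<le> 1 / 2 * dist a b"
        unfolding dist_norm by blast
    qed auto
    then obtain x where "y - (\<Phi> x - x) = x" by blast
    then have "\<Phi> x = y" by (simp add: algebra_simps)
    then show ?thesis by blast
  qed
  then show ?thesis unfolding surj_def by metis
qed

lemma bij_\<Phi>: "bij \<Phi>"
  using inj_\<Phi> surj_\<Phi> by (simp add: bij_def)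

lemma continuous_\<Phi>: "continuous_on S \<Phi>"
  by (rule continuous_at_imp_continuous_on) (auto intro: has_derivative_continuous \<Phi>_derivative)

lemma continuous_inv_\<Phi>: "continuous_on S (inv \<Phi>)"
proof -
  have "2-lipschitz_on S (inv \<Phi>)"
  proof (rule lipschitz_onI)
    fix x y
    show "dist (inv \<Phi> x) (inv \<Phi> y) \<le> 2 * dist x y"
      using \<Phi>_expand[of "inv \<Phi> x" "inv \<Phi> y"] surj_f_inv_f[OF surj_\<Phi>] by (simp add: dist_norm)
  qed simp
  then show ?thesis by (rule lipschitz_on_continuous_on)
qed

lemma image_\<Phi>: "\<Phi> ` S = inv \<Phi> -` S"
  using bij_vimage_eq_inv_image[OF bij_imp_bij_inv[OF bij_\<Phi>], of S] by (simp add: inv_inv_eq bij_\<Phi>)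

lemma open_\<Phi>: "open S \<Longrightarrow> open (\<Phi> ` S)" "open S \<Longrightarrow> open (\<Phi> -` S)"
  using continuous_\<Phi>[of UNIV] continuous_inv_\<Phi>[of UNIV]
  by (auto simp: image_\<Phi> intro: open_vimage)

lemma borel_\<Phi>: "S \<in> sets borel \<Longrightarrow> \<Phi> -` S \<in> sets borel"
  using measurable_sets[OF borel_measurable_continuous_onI[OF continuous_\<Phi>], of S] by simp

lemma lebesgue_\<Phi>: "S \<in> sets lebesgue \<Longrightarrow> \<Phi> ` S \<in> sets lebesgue"
  by (rule differentiable_image_in_sets_lebesgue)
     (auto simp: differentiable_on_def differentiable_def intro: has_derivative_at_withinI \<Phi>_derivative)

lemma \<Phi>_outside: "x \<notin> ball z \<epsilon> \<Longrightarrow> \<Phi> x = x"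
  by (simp add: \<Phi>_def bump_outside(1)[OF \<epsilon>])

lemma \<Phi>_in_iff: "D \<subseteq> S \<Longrightarrow> \<Phi> x \<in> S \<longleftrightarrow> x \<in> S"
proof -
  \<comment> \<open>A point leaving the disc would arrive at a fixed point of \<Phi>, against
    injectivity.\<close>
  have *: "\<Phi> x \<in> D" if "x \<in> D" for x
  proof (rule ccontr)
    assume n: "\<Phi> x \<notin> D"
    then have "\<Phi> (\<Phi> x) = \<Phi> x" using \<Phi>_outside[of "\<Phi> x"] by auto
    then show False using injD[OF inj_\<Phi>] n that by metis
  qed
  show "\<Phi> x \<in> S \<longleftrightarrow> x \<in> S" if "D \<subseteq> S"
    using *[of x] that \<Phi>_outside[of x] by (cases "x \<in> D") auto
qed

lemma vimage_\<Phi>_eq: "D \<subseteq> S \<Longrightarrow> \<Phi> -` S = S"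
  using \<Phi>_in_iff by auto

lemma image_\<Phi>_eq: "D \<subseteq> S \<Longrightarrow> \<Phi> ` S = S"
  using vimage_\<Phi>_eq[of S] surj_image_vimage_eq[OF surj_\<Phi>, of S] by simp

lemma image_\<Phi>_diff: "\<Phi> ` S - D = S - D"
proof -
  have "x \<in> \<Phi> ` S \<longleftrightarrow> x \<in> S" if "x \<notin> D" for x
  proof -
    have "\<Phi> x = x" using that \<Phi>_outside[of x] by auto
    then show ?thesis using inj_image_mem_iff[OF inj_\<Phi>, of x S] by simp
  qed
  then show ?thesis by (intro set_eqI) (simp only: Diff_iff, blast)
qed

lemma norm_\<Phi>: "norm (\<Phi> x - x) \<le> \<bar>t\<bar>"
  using bump_le_1[of z \<epsilon> x] bump_nonneg[of z \<epsilon> x] e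
  by (simp add: \<Phi>_def abs_mult mult_left_le)

lemma integral_\<Phi>:
  assumes "S \<in> sets lebesgue" "integrable lebesgue (\<lambda>x. indicator (\<Phi> ` S) x * w x)"
  shows "integrable lebesgue (\<lambda>x. indicator S x * (J x * w (\<Phi> x)))"
    "(\<integral>x. indicator (\<Phi> ` S) x * w x \<partial>lebesgue) = (\<integral>x. indicator S x * (J x * w (\<Phi> x)) \<partial>lebesgue)"
  using change_of_variables_real[OF assms(1) \<Phi>_derivative inj_\<Phi> assms(2)] unfolding det_\<Phi> by auto

text \<open>The cofactor matrix of the derivative applied to the pulled back field. The derivative
  is the identity plus the rank-one map sending v to t (grad h . v) e, so determinant times inverse
  is J times the identity minus that map.\<close>

definition piola :: "(R2 \<Rightarrow> R2) \<Rightarrow> R2 \<Rightarrow> R2" where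
  "piola \<phi> x = J x *\<^sub>R \<phi> (\<Phi> x) - (t * (gr x \<bullet> \<phi> (\<Phi> x))) *\<^sub>R e"

text \<open>Derivatives that fall on the cofactors contribute the Hessian of the bump twice with
  opposite signs, and its symmetry cancels them. What remains is J times the trace of the derivative
  of the field.\<close>

lemma
  assumes \<phi>: "C1 \<phi>"
  shows C1_piola: "C1 (piola \<phi>)"
    and divergence_piola: "divergence (piola \<phi>) x = J x * divergence \<phi> (\<Phi> x)"
proof -
  let ?A = "\<lambda>x. fd \<phi> (\<Phi> x)"
  let ?H = "bump_hess z \<epsilon>"
  define B where "B x v = ?A x v + (t * (gr x \<bullet> v)) *\<^sub>R ?A x e" for x v
  have A: "linear (?A x)" for x by (rule C1_linear[OF \<phi>])
  have c: "((\<lambda>x. \<phi> (\<Phi> x)) has_derivative B x) (at x)" for x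
  proof -
    have "((\<lambda>x. \<phi> (\<Phi> x)) has_derivative (\<lambda>v. ?A x (v + (t * (gr x \<bullet> v)) *\<^sub>R e))) (at x)"
      by (rule has_derivative_compose[OF \<Phi>_derivative C1_has_derivative[OF \<phi>]])
    then show ?thesis
      by (rule has_derivative_eq_rhs) (simp add: B_def fun_eq_iff linear_add[OF A] linear_cmul[OF A])
  qed
  have J': "(J has_derivative (\<lambda>v. t * (?H x v \<bullet> e))) (at x)" for x
    unfolding J_def[abs_def] by (auto intro!: derivative_eq_intros bump_grad_derivative)
  define P where "P x v = J x *\<^sub>R B x v + (t * (?H x v \<bullet> e)) *\<^sub>R \<phi> (\<Phi> x)
      - (t * (gr x \<bullet> B x v + ?H x v \<bullet> \<phi> (\<Phi> x))) *\<^sub>R e" for x v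
  have d: "(piola \<phi> has_derivative P x) (at x)" for x
  proof -
    have "(piola \<phi> has_derivative (\<lambda>v. (J x *\<^sub>R B x v + (t * (?H x v \<bullet> e)) *\<^sub>R \<phi> (\<Phi> x))
      - (t * (gr x \<bullet> B x v + ?H x v \<bullet> \<phi> (\<Phi> x))) *\<^sub>R e)) (at x)"
      unfolding piola_def[abs_def]
      by (intro has_derivative_diff has_derivative_scaleR J' c has_derivative_scaleR_left
          has_derivative_mult_right has_derivative_inner bump_grad_derivative)
    then show ?thesis unfolding P_def .
  qed
  have c\<Phi>: "continuous_on UNIV \<Phi>" by (rule continuous_\<Phi>)
  have cA: "continuous_on UNIV (\<lambda>x. ?A x v)" for v
    by (rule continuous_on_compose2[OF C1_fd_continuous[OF \<phi>, of UNIV] c\<Phi>]) auto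
  have c\<phi>: "continuous_on UNIV (\<lambda>x. \<phi> (\<Phi> x))"
    by (rule continuous_on_compose2[OF C1_continuous[OF \<phi>, of UNIV] c\<Phi>]) auto
  have cB: "continuous_on UNIV (\<lambda>x. B x v)" for v
    unfolding B_def by (intro continuous_intros cA continuous_bump_grad)
  have cJ: "continuous_on UNIV J"
    unfolding J_def[abs_def] by (intro continuous_intros continuous_bump_grad)
  show "C1 (piola \<phi>)"
    by (rule C1I[OF d]) (unfold P_def, intro continuous_intros cJ cB c\<phi> continuous_bump_hess continuous_bump_grad)
  have fdP: "fd (piola \<phi>) x = P x" using fd_eq[OF d] .
  have Ae: "?A x e = (e $ 1) *\<^sub>R ?A x (axis 1 1) + (e $ 2) *\<^sub>R ?A x (axis 2 1)"
    using linear_axis_expansion[OF A, of x e] by (simp add: sum_2)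
  have hess: "(\<Sum>i\<in>UNIV. (?H x (axis i 1) \<bullet> w) * u $ i) = ?H x w \<bullet> u" for u w
  proof -
    have "?H x (axis i 1) \<bullet> w = ?H x w $ i" for i
      by (subst bump_hess_symmetric) (simp add: inner_axis)
    then show ?thesis by (simp add: inner_vec_def)
  qed
  have "divergence (piola \<phi>) x = (\<Sum>i\<in>UNIV. J x * B x (axis i 1) $ i - t * (gr x \<bullet> B x (axis i 1)) * e $ i)
     + t * ((\<Sum>i\<in>UNIV. (?H x (axis i 1) \<bullet> e) * \<phi> (\<Phi> x) $ i) - (\<Sum>i\<in>UNIV. (?H x (axis i 1) \<bullet> \<phi> (\<Phi> x)) * e $ i))"
    unfolding divergence_def fdP P_def
    by (simp add: sum.distrib sum_subtractf sum_distrib_left algebra_simps)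
  \<comment> \<open>The bracket of the previous line vanishes by symmetry of the Hessian; the rest
    is an identity between 2 by 2 matrices, checked in coordinates.\<close>
  also have "\<dots> = (\<Sum>i\<in>UNIV. J x * B x (axis i 1) $ i - t * (gr x \<bullet> B x (axis i 1)) * e $ i)"
    unfolding hess using bump_hess_symmetric[of z \<epsilon> x e "\<phi> (\<Phi> x)"] by simp
  also have "\<dots> = J x * divergence \<phi> (\<Phi> x)"
    unfolding divergence_def B_def J_def Ae
    by (simp add: sum_2 inner_vec_def inner_axis algebra_simps axis_def)
  finally show "divergence (piola \<phi>) x = J x * divergence \<phi> (\<Phi> x)" .
qed

lemma norm_piola:
  assumes "norm (\<phi> (\<Phi> x)) \<le> 1"
  shows "norm (piola \<phi> x) \<le> \<kappa>"
proof -
  have "norm (J x *\<^sub>R \<phi> (\<Phi> x)) \<le> \<bar>J x\<bar> * 1"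
    using assms by (simp add: mult_left_le)
  also have "\<dots> \<le> 1 + 6 * \<bar>t\<bar> / \<epsilon>" using J_bounds[of x] by linarith
  finally have 1: "norm (J x *\<^sub>R \<phi> (\<Phi> x)) \<le> 1 + 6 * \<bar>t\<bar> / \<epsilon>" .
  have "\<bar>t * (gr x \<bullet> \<phi> (\<Phi> x))\<bar> \<le> 6 * \<bar>t\<bar> / \<epsilon> * 1"
    using \<epsilon> by (intro order_trans[OF t_gr mult_left_mono[OF assms]]) simp
  then have 2: "norm ((t * (gr x \<bullet> \<phi> (\<Phi> x))) *\<^sub>R e) \<le> 6 * \<bar>t\<bar> / \<epsilon>" using e by simp
  show ?thesis
    unfolding piola_def \<kappa>_def
    by (rule order_trans[OF norm_triangle_ineq4]) (use 1 2 in linarith)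
qed

text \<open>By change of variables, testing the image with a field is testing \<open>F\<close> with
  its Piola transform, which becomes admissible after division by \<kappa>.\<close>

lemma perimeter_\<Phi>:
  assumes F: "F \<in> sets lebesgue"
  shows "perimeter (\<Phi> ` F) W \<le> ennreal \<kappa> * perimeter F (\<Phi> -` W)"
proof (rule perimeter_least)
  fix \<phi> assume \<phi>: "\<phi> \<in> test_fields W"
  note T = test_fieldsD[OF \<phi>]
  have s: "supp (piola \<phi>) \<subseteq> \<Phi> -` supp \<phi>"
  proof (rule supp_subset_closed)
    show "closed (\<Phi> -` supp \<phi>)"
      using continuous_\<Phi>[of UNIV] by (intro closed_vimage) auto
    show "piola \<phi> x = 0" if "x \<notin> \<Phi> -` supp \<phi>" for x
      using that supp_zero[of "\<Phi> x" \<phi>] by (simp add: piola_def)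
  qed
  have "\<Phi> -` supp \<phi> = inv \<Phi> ` supp \<phi>" by (rule bij_vimage_eq_inv_image[OF bij_\<Phi>])
  then have "compact (\<Phi> -` supp \<phi>)"
    using compact_continuous_image[OF continuous_inv_\<Phi> T(2)] by simp
  then have K: "compact (supp (piola \<phi>))" using compact_supp_subset[OF _ s] by blast
  have \<psi>: "(\<lambda>x. (1 / \<kappa>) *\<^sub>R piola \<phi> x) \<in> test_fields (\<Phi> -` W)"
  proof (rule test_fields_scaleR[OF C1_piola[OF T(1)] K])
    show "supp (piola \<phi>) \<subseteq> \<Phi> -` W" using s T(3) by blast
    show "norm ((1 / \<kappa>) *\<^sub>R piola \<phi> x) \<le> 1" for x
      using norm_piola[of \<phi> x, OF T(4)] \<kappa>(1) by (simp add: divide_simps)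
  qed
  have "divint (\<Phi> ` F) \<phi> = (\<integral>x. indicator F x * (J x * divergence \<phi> (\<Phi> x)) \<partial>lebesgue)"
    by (rule integral_\<Phi>(2)[OF F integrable_divergence[OF lebesgue_\<Phi>[OF F] T(1,2)]])
  also have "\<dots> = divint F (piola \<phi>)"
    by (simp add: divergence_piola[OF T(1)])
  also have "\<dots> = \<kappa> * divint F (\<lambda>x. (1 / \<kappa>) *\<^sub>R piola \<phi> x)"
    using divint_cmul[OF C1_piola[OF T(1)], of F "1 / \<kappa>"] \<kappa>(1) by simp
  finally have "ennreal (divint (\<Phi> ` F) \<phi>) = ennreal \<kappa> * ennreal (divint F (\<lambda>x. (1 / \<kappa>) *\<^sub>R piola \<phi> x))"
    using \<kappa>(1) by (simp add: ennreal_mult')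
  also have "\<dots> \<le> ennreal \<kappa> * perimeter F (\<Phi> -` W)"
    by (intro mult_left_mono perimeter_upper[OF \<psi>]) simp
  finally show "ennreal (divint (\<Phi> ` F) \<phi>) \<le> ennreal \<kappa> * perimeter F (\<Phi> -` W)" .
qed

lemma outer_perimeter_\<Phi>:
  assumes F: "F \<in> sets lebesgue" and U: "D \<subseteq> U"
  shows "outer_perimeter U (\<Phi> ` F) A \<le> ennreal \<kappa> * outer_perimeter U F (\<Phi> -` A)"
proof -
  \<comment> \<open>Dividing by \<kappa> first moves the constant to the left, so that the infimum
    on the right can be bounded set by set.\<close>
  have inv: "ennreal (1 / \<kappa>) * (ennreal \<kappa> * a) = a" "ennreal \<kappa> * (ennreal (1 / \<kappa>) * a) = a" for a
    using \<kappa>(1) by (simp_all add: mult.assoc[symmetric] ennreal_mult'[symmetric])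
  have "ennreal (1 / \<kappa>) * outer_perimeter U (\<Phi> ` F) A \<le> outer_perimeter U F (\<Phi> -` A)"
  proof (rule outer_perimeter_greatest)
    fix W assume W: "open W" "\<Phi> -` A \<subseteq> W" "W \<subseteq> U"
    have "outer_perimeter U (\<Phi> ` F) A \<le> perimeter (\<Phi> ` F) (\<Phi> ` W)"
    proof (rule outer_perimeter_le[OF open_\<Phi>(1)[OF W(1)]])
      show "A \<subseteq> \<Phi> ` W" using W(2) surj_image_vimage_eq[OF surj_\<Phi>, of A] by blast
      show "\<Phi> ` W \<subseteq> U" using image_\<Phi>_eq[OF U] W(3) by blast
    qed
    also have "\<dots> \<le> ennreal \<kappa> * perimeter F (\<Phi> -` \<Phi> ` W)" by (rule perimeter_\<Phi>[OF F])
    also have "\<Phi> -` \<Phi> ` W = W" by (rule inj_vimage_image_eq[OF inj_\<Phi>])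
    finally have "ennreal (1 / \<kappa>) * outer_perimeter U (\<Phi> ` F) A \<le> ennreal (1 / \<kappa>) * (ennreal \<kappa> * perimeter F W)"
      by (intro mult_left_mono) auto
    then show "ennreal (1 / \<kappa>) * outer_perimeter U (\<Phi> ` F) A \<le> perimeter F W" unfolding inv .
  qed
  from mult_left_mono[OF this, of "ennreal \<kappa>"] show ?thesis unfolding inv by simp
qed

text \<open>The estimate holds for measures: the variation of the image is at most \<kappa> times
  the push-forward of the variation of \<open>F\<close>. This makes sense on \<open>U\<close>
  because \<Phi> maps \<open>U\<close> onto itself.\<close>

lemma set_nn_integral_\<Phi>:
  assumes F: "F \<in> sets lebesgue" and U: "open U" "D \<subseteq> U" and g: "continuous_on U g"
  shows "(\<integral>\<^sup>+x\<in>D. ennreal (g x) \<partial>Dchi U (\<Phi> ` F)) \<le> ennreal \<kappa> * (\<integral>\<^sup>+x\<in>D. ennreal (g (\<Phi> x)) \<partial>Dchi U F)"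
proof -
  let ?M = "Dchi U F" and ?G = "Dchi U (\<Phi> ` F)"
  have DS: "D \<in> sets (Dchi U H)" for H using in_sets_Dchi U by auto
  have vU: "\<Phi> -` U = U" by (rule vimage_\<Phi>_eq[OF U(2)])
  have m\<Phi>: "\<Phi> \<in> measurable ?M ?G"
  proof (rule measurableI)
    show "\<Phi> x \<in> space ?G" if "x \<in> space ?M" for x using that \<Phi>_in_iff[OF U(2)] by (simp add: space_Dchi)
    show "\<Phi> -` A \<inter> space ?M \<in> sets ?M" if "A \<in> sets ?G" for A
      using that borel_\<Phi>[of A] in_sets_Dchi[OF U(1)] U(1) by (auto simp: space_Dchi)
  qed
  let ?N = "scale_measure (ennreal \<kappa>) (distr ?M ?G \<Phi>)"
  have le: "?G \<le> ?N"
  proof -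
    have "emeasure ?G A \<le> emeasure ?N A" for A
    proof (cases "A \<in> sets ?G")
      case True
      then have A: "A \<in> sets borel" "A \<subseteq> U" using in_sets_Dchi U(1) by blast+
      have v: "\<Phi> -` A \<in> sets borel" "\<Phi> -` A \<subseteq> U" using borel_\<Phi> A vU by auto
      have "emeasure ?G A = outer_perimeter U (\<Phi> ` F) A"
        by (rule emeasure_Dchi[OF lebesgue_\<Phi>[OF F] U(1) A])
      also have "\<dots> \<le> ennreal \<kappa> * outer_perimeter U F (\<Phi> -` A)"
        by (rule outer_perimeter_\<Phi>[OF F U(2)])
      also have "outer_perimeter U F (\<Phi> -` A) = emeasure ?M (\<Phi> -` A \<inter> space ?M)"
        using emeasure_Dchi[OF F U(1) v] v(2) by (simp add: space_Dchi Int_absorb2)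
      also have "ennreal \<kappa> * \<dots> = emeasure ?N A"
        using emeasure_distr[OF m\<Phi> True] by simp
      finally show ?thesis .
    qed (simp add: emeasure_notin_sets)
    moreover have "sets ?G = sets ?N" by simp
    moreover have "space ?G = space ?N" by (rule sets_eq_imp_space_eq) simp
    ultimately show ?thesis unfolding le_measure_iff by (simp add: le_funI)
  qed
  have mg: "(\<lambda>x. ennreal (g x) * indicator D x) \<in> borel_measurable ?G"
    by (intro borel_measurable_times_ennreal measurable_Dchi[OF g] borel_measurable_indicator DS)
  have "(\<integral>\<^sup>+x\<in>D. ennreal (g x) \<partial>?G) \<le> (\<integral>\<^sup>+x\<in>D. ennreal (g x) \<partial>?N)"
    by (rule nn_integral_mono_measure[OF _ le]) simp
  also have "\<dots> = ennreal \<kappa> * (\<integral>\<^sup>+x\<in>D. ennreal (g x) \<partial>distr ?M ?G \<Phi>)"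
    by (rule nn_integral_scale_measure) (use mg in simp)
  also have "(\<integral>\<^sup>+x\<in>D. ennreal (g x) \<partial>distr ?M ?G \<Phi>) = (\<integral>\<^sup>+x. ennreal (g (\<Phi> x)) * indicator D (\<Phi> x) \<partial>?M)"
    by (rule nn_integral_distr[OF m\<Phi>]) (use mg in simp)
  also have "\<dots> = (\<integral>\<^sup>+x\<in>D. ennreal (g (\<Phi> x)) \<partial>?M)"
    using \<Phi>_in_iff[of D] by (intro nn_integral_cong) (auto simp: indicator_def)
  finally show ?thesis .
qed

text \<open>Two effects of order \<open>t\<close>: the stretching factor \<kappa> - 1 =
  12|t|/\<epsilon> acts on a weight of at most \<open>M\<close>, and displacing the argument of
  \<open>g\<close> by at most |t| costs L|t|, doubled by \<open>\<kappa> \<le> 2\<close>.\<close>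

lemma set_nn_integral_\<Phi>_le:
  assumes F: "F \<in> sets lebesgue" and U: "open U" "D \<subseteq> U" and g: "continuous_on U g"
    and L: "L-lipschitz_on D g" and M: "\<And>x. x \<in> D \<Longrightarrow> 0 \<le> g x" "\<And>x. x \<in> D \<Longrightarrow> g x \<le> M"
  shows "(\<integral>\<^sup>+x\<in>D. ennreal (g x) \<partial>Dchi U (\<Phi> ` F)) \<le>
    (\<integral>\<^sup>+x\<in>D. ennreal (g x) \<partial>Dchi U F) + ennreal ((12 * M / \<epsilon> + 2 * L) * \<bar>t\<bar>) * emeasure (Dchi U F) D"
proof -
  let ?M = "Dchi U F"
  have DS: "D \<in> sets ?M" using in_sets_Dchi U by auto
  have L0: "0 \<le> L" using L by (rule lipschitz_on_nonneg)
  have zD: "z \<in> D" using \<epsilon> by simp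
  have M0: "0 \<le> M" using M[OF zD] by linarith
  have pt: "\<kappa> * g (\<Phi> x) \<le> g x + (12 * M / \<epsilon> + 2 * L) * \<bar>t\<bar>" if x: "x \<in> D" for x
  proof -
    have \<Phi>D: "\<Phi> x \<in> D" using \<Phi>_in_iff[of D x] x by simp
    have "\<bar>g (\<Phi> x) - g x\<bar> \<le> L * \<bar>t\<bar>"
      using lipschitz_onD[OF L \<Phi>D x] mult_left_mono[OF norm_\<Phi>[of x] L0] by (simp add: dist_norm)
    then have le: "g (\<Phi> x) \<le> g x + L * \<bar>t\<bar>" by linarith
    have "\<kappa> * g (\<Phi> x) \<le> \<kappa> * (g x + L * \<bar>t\<bar>)" using le \<kappa>(1) by (intro mult_left_mono) auto
    also have "\<dots> = g x + (\<kappa> - 1) * g x + \<kappa> * (L * \<bar>t\<bar>)" by (simp add: algebra_simps)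
    also have "\<dots> \<le> g x + (\<kappa> - 1) * M + 2 * (L * \<bar>t\<bar>)"
      using M(2)[OF x] \<kappa> L0 by (intro add_mono mult_left_mono mult_right_mono order_refl) auto
    also have "\<dots> = g x + (12 * M / \<epsilon> + 2 * L) * \<bar>t\<bar>" by (simp add: \<kappa>_def algebra_simps)
    finally show ?thesis .
  qed
  have "(\<integral>\<^sup>+x\<in>D. ennreal (g x) \<partial>Dchi U (\<Phi> ` F)) \<le> ennreal \<kappa> * (\<integral>\<^sup>+x\<in>D. ennreal (g (\<Phi> x)) \<partial>?M)"
    by (rule set_nn_integral_\<Phi>[OF F U g])
  also have "\<dots> = (\<integral>\<^sup>+x. ennreal \<kappa> * (ennreal (g (\<Phi> x)) * indicator D x) \<partial>?M)"
  proof (rule nn_integral_cmult[symmetric])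
    have "continuous_on U (\<lambda>x. g (\<Phi> x))"
      by (rule continuous_on_compose2[OF g continuous_\<Phi>]) (use \<Phi>_in_iff[OF U(2)] in auto)
    then show "(\<lambda>x. ennreal (g (\<Phi> x)) * indicator D x) \<in> borel_measurable ?M"
      by (intro borel_measurable_times_ennreal measurable_Dchi borel_measurable_indicator DS)
  qed
  also have "\<dots> \<le> (\<integral>\<^sup>+x. ennreal (g x) * indicator D x + ennreal ((12 * M / \<epsilon> + 2 * L) * \<bar>t\<bar>) * indicator D x \<partial>?M)"
  proof (rule nn_integral_mono)
    fix x
    show "ennreal \<kappa> * (ennreal (g (\<Phi> x)) * indicator D x)
      \<le> ennreal (g x) * indicator D x + ennreal ((12 * M / \<epsilon> + 2 * L) * \<bar>t\<bar>) * indicator D x"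
    proof (cases "x \<in> D")
      case True
      have "ennreal \<kappa> * ennreal (g (\<Phi> x)) = ennreal (\<kappa> * g (\<Phi> x))"
        using \<kappa>(1) by (simp add: ennreal_mult')
      also have "\<dots> \<le> ennreal (g x + (12 * M / \<epsilon> + 2 * L) * \<bar>t\<bar>)" by (rule ennreal_leI[OF pt[OF True]])
      also have "\<dots> = ennreal (g x) + ennreal ((12 * M / \<epsilon> + 2 * L) * \<bar>t\<bar>)"
        using M(1)[OF True] M0 L0 \<epsilon> by (intro ennreal_plus) auto
      finally show ?thesis using True by simp
    qed simp
  qed
  also have "\<dots> = (\<integral>\<^sup>+x\<in>D. ennreal (g x) \<partial>?M) + (\<integral>\<^sup>+x. ennreal ((12 * M / \<epsilon> + 2 * L) * \<bar>t\<bar>) * indicator D x \<partial>?M)"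
    by (intro nn_integral_add borel_measurable_times_ennreal measurable_Dchi[OF g]
        borel_measurable_indicator DS borel_measurable_const)
  also have "(\<integral>\<^sup>+x. ennreal ((12 * M / \<epsilon> + 2 * L) * \<bar>t\<bar>) * indicator D x \<partial>?M)
      = ennreal ((12 * M / \<epsilon> + 2 * L) * \<bar>t\<bar>) * emeasure ?M D"
    by (rule nn_integral_cmult_indicator[OF DS])
  finally show ?thesis .
qed

end

section \<open>Volume change produced by a deformation\<close>

lemma
  assumes U: "open U" and f: "continuous_on U f" and D: "compact D" "D \<subseteq> U"
    and nn: "\<And>x. x \<in> D \<Longrightarrow> 0 \<le> f x" and A: "A \<in> sets lebesgue" "A \<subseteq> D"
  shows integrable_fvol: "integrable lebesgue (\<lambda>x. indicator A x * f x)"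
    and emeasure_fvol_integral: "emeasure (fvol U f) A = ennreal (\<integral>x. indicator A x * f x \<partial>lebesgue)"
    and measure_fvol_integral: "measure (fvol U f) A = (\<integral>x. indicator A x * f x \<partial>lebesgue)"
proof -
  have "bounded (f ` D)"
    using D f by (meson compact_continuous_image compact_imp_bounded continuous_on_subset)
  then obtain M where M: "M > 0" "\<And>x. x \<in> D \<Longrightarrow> \<bar>f x\<bar> \<le> M"
    unfolding bounded_pos by auto
  have "(\<lambda>x. indicator U x *\<^sub>R f x) \<in> borel_measurable borel"
    using U f by (intro borel_measurable_continuous_on_indicator) auto
  then have m: "(\<lambda>x. indicator U x *\<^sub>R f x) \<in> borel_measurable lebesgue"
    by (simp add: measurable_completion)
  have "(\<lambda>x. indicator A x * (indicator U x *\<^sub>R f x)) \<in> borel_measurable lebesgue"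
    by (intro borel_measurable_times borel_measurable_indicator A m)
  moreover have "(\<lambda>x. indicator A x * (indicator U x *\<^sub>R f x)) = (\<lambda>x. indicator A x * f x)"
    using A(2) D(2) by (intro ext) (auto simp: indicator_def)
  ultimately have m': "(\<lambda>x. indicator A x * f x) \<in> borel_measurable lebesgue" by simp
  show int: "integrable lebesgue (\<lambda>x. indicator A x * f x)"
  proof (rule integrable_bounded_support[OF m' compact_imp_bounded[OF D(1)]])
    show "indicator A x * f x = 0" if "x \<notin> D" for x using that A(2) by (auto simp: indicator_def)
    show "\<bar>indicator A x * f x\<bar> \<le> M" for x using M A(2) by (auto simp: indicator_def)
  qed
  have nn': "0 \<le> indicator A x * f x" for x using nn A(2) by (auto simp: indicator_def)
  have "emeasure (fvol U f) A = (\<integral>\<^sup>+x. ennreal (indicator A x * f x) \<partial>lebesgue)"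
    unfolding emeasure_fvol[OF U f A(1)]
    by (rule nn_integral_cong) (use A(2) D(2) in \<open>auto simp: indicator_def\<close>)
  also have "\<dots> = ennreal (\<integral>x. indicator A x * f x \<partial>lebesgue)"
    by (rule nn_integral_eq_integral[OF int]) (simp add: nn')
  finally show eq: "emeasure (fvol U f) A = ennreal (\<integral>x. indicator A x * f x \<partial>lebesgue)" .
  show "measure (fvol U f) A = (\<integral>x. indicator A x * f x \<partial>lebesgue)"
    unfolding measure_def eq by (rule enn2real_ennreal) (simp add: nn')
qed

lemma locally_lipschitz_on_cball:
  assumes U: "open U" "y \<in> U" and f: "locally_lipschitz_on U f"
  obtains r L where "r > 0" "cball y r \<subseteq> U" "L-lipschitz_on (cball y r) f"
proof -
  obtain e L where e: "e > 0" "L-lipschitz_on (cball y e \<inter> U) f"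
    using f U(2) unfolding locally_lipschitz_on_def by blast
  obtain e' where e': "e' > 0" "cball y e' \<subseteq> U" using U open_contains_cball by blast
  have "L-lipschitz_on (cball y (min e e')) f"
    by (rule lipschitz_on_subset[OF e(2)]) (use e'(2) in \<open>auto simp: subset_iff\<close>)
  moreover have "cball y (min e e') \<subseteq> U" using e'(2) by (auto simp: subset_iff)
  ultimately show ?thesis using that[of "min e e'" L] e(1) e'(1) by auto
qed

text \<open>The set \<^term>\<open>E\<close> oscillates so strongly near a point of its boundary that the first variation
  of the volume along some \<^term>\<open>bump z \<epsilon>\<close> beats every error caused by the density being merely
  Lipschitz.\<close>

lemma volume_variation:
  fixes E :: "R2 set"
  assumes E: "E \<in> sets lebesgue" and y: "\<And>\<rho>. \<rho> > 0 \<Longrightarrow> perimeter E (ball y \<rho>) \<noteq> 0"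
    and r: "r > 0" and L: "L-lipschitz_on (cball y r) f" and pos: "\<And>x. x \<in> cball y r \<Longrightarrow> 0 < f x"
    and U: "open U" "cball y r \<subseteq> U" and f: "continuous_on U f"
  obtains z e \<epsilon> where "\<epsilon> > 0" "norm e = 1" "cball z \<epsilon> \<subseteq> cball y r"
    "\<And>\<delta>. \<bar>\<delta>\<bar> \<le> \<epsilon> ^ 3 / 12 \<Longrightarrow> \<exists>t. deform e \<epsilon> t \<and> \<bar>t\<bar> * \<epsilon>\<^sup>2 \<le> \<bar>\<delta>\<bar> \<and>
       measure (fvol U f) (deform.\<Phi> z e \<epsilon> t ` (E \<inter> cball z \<epsilon>)) = measure (fvol U f) (E \<inter> cball z \<epsilon>) + \<delta>"
proof -
  have fc: "continuous_on (cball y r) f" by (rule continuous_on_subset[OF f U(2)])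
  have ne: "cball y r \<noteq> {}" using r by auto
  obtain a where a: "a \<in> cball y r" "\<And>x. x \<in> cball y r \<Longrightarrow> f a \<le> f x"
    using continuous_attains_inf[OF compact_cball ne fc] by blast
  obtain b where b: "b \<in> cball y r" "\<And>x. x \<in> cball y r \<Longrightarrow> f x \<le> f b"
    using continuous_attains_sup[OF compact_cball ne fc] by blast
  define m where "m = f a"
  define M where "M = f b"
  have m: "m > 0" "\<And>x. x \<in> cball y r \<Longrightarrow> m \<le> f x" using a pos by (auto simp: m_def)
  have M: "\<And>x. x \<in> cball y r \<Longrightarrow> f x \<le> M" using b by (auto simp: M_def)
  have L0: "0 \<le> L" using L by (rule lipschitz_on_nonneg)
  \<comment> \<open>The part 7 pi L pays for the error of the first variation, the extra 1 leaves a
    net rate of at least \<epsilon>^2, and division by the minimum \<open>m\<close> of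
    \<open>f\<close> compensates for the factor \<open>f z\<close> in the main term.\<close>
  define C where "C = (7 * pi * L + 1) / m"
  have C: "C > 0" using m(1) L0 by (auto simp: C_def intro!: divide_pos_pos add_nonneg_pos)
  \<comment> \<open>The first entry keeps the discs of radius 2 \<rho> where \<open>f\<close> is
    controlled, the second is the smallness demanded by the vanishing criterion.\<close>
  define \<rho> where "\<rho> = min (r / 2) (1 / (32 * C))"
  have \<rho>: "\<rho> > 0" "2 * \<rho> \<le> r" "C * \<rho> \<le> 1 / 32"
  proof -
    show "\<rho> > 0" using r C by (simp add: \<rho>_def)
    show "2 * \<rho> \<le> r" by (simp add: \<rho>_def min_def)
    have "C * \<rho> \<le> C * (1 / (32 * C))" using C by (intro mult_left_mono) (auto simp: \<rho>_def)
    then show "C * \<rho> \<le> 1 / 32" using C by simp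
  qed
  have "\<not> (\<forall>z \<epsilon> e. 0 < \<epsilon> \<longrightarrow> norm e = 1 \<longrightarrow> cball z \<epsilon> \<subseteq> ball y (2 * \<rho>) \<longrightarrow>
       (\<integral>x. indicator E x * (bump_grad z \<epsilon> x \<bullet> e) \<partial>lebesgue) \<le> C * \<epsilon>\<^sup>2)"
    using perimeter_zero_small_gradient[OF E \<rho>(1) less_imp_le[OF C] \<rho>(3), of y] y[OF \<rho>(1)] by blast
  then obtain z \<epsilon> e where \<epsilon>: "0 < \<epsilon>" and e: "norm e = 1" and D\<rho>: "cball z \<epsilon> \<subseteq> ball y (2 * \<rho>)"
    and I: "C * \<epsilon>\<^sup>2 < (\<integral>x. indicator E x * (bump_grad z \<epsilon> x \<bullet> e) \<partial>lebesgue)"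
    by (auto simp: not_le)
  define D where "D = cball z \<epsilon>"
  have D: "D \<subseteq> cball y r" using D\<rho> \<rho>(2) unfolding D_def by (auto simp: subset_iff)
  have DU: "D \<subseteq> U" using D U(2) by blast
  have zD: "z \<in> D" using \<epsilon> by (simp add: D_def)
  have cD: "compact D" by (simp add: D_def)
  have nnD: "0 \<le> f x" if "x \<in> D" for x using pos[of x] D that by auto
  define I where "I = (\<integral>x. indicator E x * (bump_grad z \<epsilon> x \<bullet> e) \<partial>lebesgue)"
  have df: "deform e \<epsilon> t" if "\<bar>t\<bar> \<le> \<epsilon> / 12" for t
    by unfold_locales (use \<epsilon> e that in auto)
  define P where "P t = deform.\<Phi> z e \<epsilon> t" for t
  define J where "J t x = 1 + t * (bump_grad z \<epsilon> x \<bullet> e)" for t x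
  have P: "P t x = x + (t * bump z \<epsilon> x) *\<^sub>R e" if "\<bar>t\<bar> \<le> \<epsilon> / 12" for t x
    unfolding P_def by (rule deform.\<Phi>_def[OF df[OF that]])
  have PD: "P t x \<in> D" if "\<bar>t\<bar> \<le> \<epsilon> / 12" "x \<in> D" for t x
    using deform.\<Phi>_in_iff[OF df[OF that(1)], of z D x] that(2) by (simp add: P_def D_def)
  have lip: "\<bar>f p - f q\<bar> \<le> L * norm (p - q)" if "p \<in> D" "q \<in> D" for p q
    using lipschitz_onD[OF L, of p q] subsetD[OF D that(1)] subsetD[OF D that(2)] by (simp add: dist_norm)
  have gr: "\<bar>bump_grad z \<epsilon> x \<bullet> e\<bar> \<le> 6 / \<epsilon>" for x
    using Cauchy_Schwarz_ineq2[of "bump_grad z \<epsilon> x" e] norm_bump_grad[OF \<epsilon>, of z x] e by simp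
  define Q where "Q t x = J t x * f (P t x)" for t x
  have Qint: "integrable lebesgue (\<lambda>x. indicator (E \<inter> D) x * Q t x)"
    and Qvol: "measure (fvol U f) (P t ` (E \<inter> D)) = (\<integral>x. indicator (E \<inter> D) x * Q t x \<partial>lebesgue)"
    if t: "\<bar>t\<bar> \<le> \<epsilon> / 12" for t
  proof -
    note d = df[OF t]
    have ED: "E \<inter> D \<in> sets lebesgue" using E by (auto simp: D_def)
    have PL: "P t ` (E \<inter> D) \<in> sets lebesgue" unfolding P_def by (rule deform.lebesgue_\<Phi>[OF d ED])
    have sub: "P t ` (E \<inter> D) \<subseteq> D" using PD[OF t] by blast
    note i = integrable_fvol[OF U(1) f cD DU nnD PL sub]
    have QJ: "deform.J z e \<epsilon> t x * f (deform.\<Phi> z e \<epsilon> t x) = Q t x" for x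
      by (simp add: Q_def J_def deform.J_def[OF d] P_def)
    note v = deform.integral_\<Phi>[OF d ED i[unfolded P_def], unfolded QJ]
    show "integrable lebesgue (\<lambda>x. indicator (E \<inter> D) x * Q t x)" by (rule v(1))
    have "measure (fvol U f) (P t ` (E \<inter> D)) = (\<integral>x. indicator (P t ` (E \<inter> D)) x * f x \<partial>lebesgue)"
      by (rule measure_fvol_integral[OF U(1) f cD DU nnD PL sub])
    then show "measure (fvol U f) (P t ` (E \<inter> D)) = (\<integral>x. indicator (E \<inter> D) x * Q t x \<partial>lebesgue)"
      using v(2) unfolding P_def by (rule trans)
  qed
  define R where "R t = (\<integral>x. indicator (E \<inter> D) x * Q t x \<partial>lebesgue)" for t
  have iD: "integrable lebesgue (indicator D :: R2 \<Rightarrow> real)"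
    using fmeasurableD2[OF lmeasurable_cball[of z \<epsilon>]] by (simp add: D_def less_top)
  have mD: "measure lebesgue D = pi * \<epsilon>\<^sup>2"
    using content_cball[of \<epsilon> z] \<epsilon> by (simp add: unit_ball_vol_2 D_def)
  have t0: "\<bar>0\<bar> \<le> \<epsilon> / 12" using \<epsilon> by simp
  have Q0: "Q 0 x = f x" for x by (simp add: Q_def J_def P[OF t0])
  \<comment> \<open>Freezing \<open>f\<close> at the centre \<open>z\<close> in the derivative term
    leaves 7 L|t| pointwise: one part from moving the argument of \<open>f\<close>, six from the
    gradient bound 6/\<epsilon> times the oscillation L \<epsilon>. Integration over the disc gives
    the factor pi \<epsilon>^2.\<close>
  have first: "\<bar>R t - R 0 - t * f z * I\<bar> \<le> 7 * L * \<bar>t\<bar> * (pi * \<epsilon>\<^sup>2)" if t: "\<bar>t\<bar> \<le> \<epsilon> / 12" for t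
  proof -
    let ?k = "\<lambda>x. indicator E x * (bump_grad z \<epsilon> x \<bullet> e)"
    have ik: "integrable lebesgue ?k" by (rule integrable_bump(2)[OF E \<epsilon>])
    have "R t - R 0 - t * f z * I = (\<integral>x. indicator (E \<inter> D) x * Q t x - indicator (E \<inter> D) x * Q 0 x - t * f z * ?k x \<partial>lebesgue)"
      unfolding R_def I_def using Qint[OF t] Qint[OF t0] ik by simp
    moreover have "\<bar>\<dots>\<bar> \<le> (\<integral>x. 7 * L * \<bar>t\<bar> * indicator D x \<partial>lebesgue)"
    proof (rule integral_abs_bound_integral)
      show "integrable lebesgue (\<lambda>x. indicator (E \<inter> D) x * Q t x - indicator (E \<inter> D) x * Q 0 x - t * f z * ?k x)"
        using Qint[OF t] Qint[OF t0] ik by simp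
      show "integrable lebesgue (\<lambda>x. 7 * L * \<bar>t\<bar> * indicator D x)" using iD by simp
      fix x
      show "\<bar>indicator (E \<inter> D) x * Q t x - indicator (E \<inter> D) x * Q 0 x - t * f z * ?k x\<bar> \<le> 7 * L * \<bar>t\<bar> * indicator D x"
      proof (cases "x \<in> D")
        case False
        then have "bump_grad z \<epsilon> x = 0" by (intro bump_outside(2)[OF \<epsilon>]) (auto simp: D_def)
        then show ?thesis using False by simp
      next
        case True
        define k where "k = bump_grad z \<epsilon> x \<bullet> e"
        have k: "\<bar>k\<bar> \<le> 6 / \<epsilon>" using gr by (simp add: k_def)
        have 1: "\<bar>f (P t x) - f x\<bar> \<le> L * \<bar>t\<bar>"
          using order_trans[OF lip[OF PD[OF t True] True] mult_left_mono[OF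
                deform.norm_\<Phi>[OF df[OF t], of z x, folded P_def] L0]] .
        have 2: "\<bar>f (P t x) - f z\<bar> \<le> L * \<epsilon>"
        proof -
          have "norm (P t x - z) \<le> \<epsilon>" using PD[OF t True] by (simp add: D_def dist_norm norm_minus_commute)
          then show ?thesis using order_trans[OF lip[OF PD[OF t True] zD] mult_left_mono[OF _ L0]] by blast
        qed
        have "\<bar>Q t x - Q 0 x - t * f z * k\<bar> = \<bar>(f (P t x) - f x) + t * (k * (f (P t x) - f z))\<bar>"
          unfolding Q0 by (simp add: Q_def J_def k_def algebra_simps)
        also have "\<dots> \<le> \<bar>f (P t x) - f x\<bar> + \<bar>t\<bar> * (\<bar>k\<bar> * \<bar>f (P t x) - f z\<bar>)"
          by (rule order_trans[OF abs_triangle_ineq]) (simp add: abs_mult)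
        also have "\<dots> \<le> L * \<bar>t\<bar> + \<bar>t\<bar> * (6 / \<epsilon> * (L * \<epsilon>))"
          using 1 2 k \<epsilon> L0 by (intro add_mono mult_left_mono mult_mono) auto
        also have "\<dots> = 7 * L * \<bar>t\<bar>" using \<epsilon> by simp
        finally have "\<bar>Q t x - Q 0 x - t * f z * k\<bar> \<le> 7 * L * \<bar>t\<bar>" .
        then show ?thesis using True L0 by (auto simp: indicator_def k_def)
      qed
    qed
    moreover have "(\<integral>x. 7 * L * \<bar>t\<bar> * indicator D x \<partial>lebesgue) = 7 * L * \<bar>t\<bar> * (pi * \<epsilon>\<^sup>2)"
      by (simp add: mD)
    ultimately show ?thesis by (simp only:)
  qed
  have cont: "continuous_on {- (\<epsilon> / 12)..\<epsilon> / 12} R"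
  proof -
    \<comment> \<open>The factor \<open>J\<close> varies at rate 6/\<epsilon> against
      \<open>f \<le> M\<close>; the argument of \<open>f\<close> varies at rate at most 1 against
      \<open>\<bar>J\<bar> \<le> 2\<close>.\<close>
    define B where "B = 6 / \<epsilon> * M + 2 * L"
    have M0: "0 \<le> M" using M[of a] nnD[OF zD] M[of z] zD D by force
    have B0: "0 \<le> B" using L0 \<epsilon> M0 by (simp add: B_def)
    have Qlip: "\<bar>Q t x - Q s x\<bar> \<le> B * \<bar>t - s\<bar>"
      if t: "\<bar>t\<bar> \<le> \<epsilon> / 12" and s: "\<bar>s\<bar> \<le> \<epsilon> / 12" and x: "x \<in> D" for t s x
    proof -
      define k where "k = bump_grad z \<epsilon> x \<bullet> e"
      have k: "\<bar>k\<bar> \<le> 6 / \<epsilon>" using gr by (simp add: k_def)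
      have 1: "\<bar>f (P t x) - f (P s x)\<bar> \<le> L * \<bar>t - s\<bar>"
      proof -
        have "P t x - P s x = ((t - s) * bump z \<epsilon> x) *\<^sub>R e" by (simp add: P[OF t] P[OF s] algebra_simps)
        then have "norm (P t x - P s x) \<le> \<bar>t - s\<bar>"
          using e bump_le_1[of z \<epsilon> x] bump_nonneg[of z \<epsilon> x] by (simp add: abs_mult mult_left_le)
        then show ?thesis using order_trans[OF lip[OF PD[OF t x] PD[OF s x]] mult_left_mono[OF _ L0]] by blast
      qed
      have 2: "\<bar>f (P t x)\<bar> \<le> M" using M[of "P t x"] nnD[OF PD[OF t x]] PD[OF t x] D by auto
      have 3: "\<bar>J s x\<bar> \<le> 2"
      proof -
        have "\<bar>s\<bar> * \<bar>k\<bar> \<le> \<epsilon> / 12 * (6 / \<epsilon>)" using s k \<epsilon> by (intro mult_mono) auto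
        then have "\<bar>s * k\<bar> \<le> 1 / 2" using \<epsilon> by (simp add: abs_mult)
        then show ?thesis unfolding J_def k_def by linarith
      qed
      have "\<bar>Q t x - Q s x\<bar> = \<bar>(t - s) * k * f (P t x) + J s x * (f (P t x) - f (P s x))\<bar>"
        by (simp add: Q_def J_def k_def algebra_simps)
      also have "\<dots> \<le> \<bar>t - s\<bar> * (\<bar>k\<bar> * \<bar>f (P t x)\<bar>) + \<bar>J s x\<bar> * \<bar>f (P t x) - f (P s x)\<bar>"
        by (rule order_trans[OF abs_triangle_ineq]) (simp add: abs_mult)
      also have "\<dots> \<le> \<bar>t - s\<bar> * (6 / \<epsilon> * M) + 2 * (L * \<bar>t - s\<bar>)"
        using 1 2 3 k \<epsilon> by (intro add_mono mult_left_mono mult_mono) auto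
      also have "\<dots> = B * \<bar>t - s\<bar>" by (simp add: B_def algebra_simps)
      finally show ?thesis .
    qed
    have "(B * (pi * \<epsilon>\<^sup>2))-lipschitz_on {- (\<epsilon> / 12)..\<epsilon> / 12} R"
    proof (rule lipschitz_onI)
      fix t s assume "t \<in> {- (\<epsilon> / 12)..\<epsilon> / 12}" "s \<in> {- (\<epsilon> / 12)..\<epsilon> / 12}"
      then have t: "\<bar>t\<bar> \<le> \<epsilon> / 12" and s: "\<bar>s\<bar> \<le> \<epsilon> / 12" by auto
      have "R t - R s = (\<integral>x. indicator (E \<inter> D) x * Q t x - indicator (E \<inter> D) x * Q s x \<partial>lebesgue)"
        unfolding R_def using Qint[OF t] Qint[OF s] by simp
      moreover have "\<bar>\<dots>\<bar> \<le> (\<integral>x. B * \<bar>t - s\<bar> * indicator D x \<partial>lebesgue)"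
      proof (rule integral_abs_bound_integral)
        show "integrable lebesgue (\<lambda>x. indicator (E \<inter> D) x * Q t x - indicator (E \<inter> D) x * Q s x)"
          using Qint[OF t] Qint[OF s] by simp
        show "integrable lebesgue (\<lambda>x. B * \<bar>t - s\<bar> * indicator D x)" using iD by simp
        show "\<bar>indicator (E \<inter> D) x * Q t x - indicator (E \<inter> D) x * Q s x\<bar> \<le> B * \<bar>t - s\<bar> * indicator D x" for x
          using Qlip[OF t s, of x] B0 by (auto simp: indicator_def)
      qed
      ultimately show "dist (R t) (R s) \<le> B * (pi * \<epsilon>\<^sup>2) * dist t s"
        using mD by (simp add: dist_real_def mult_ac)
    qed (use B0 in simp)
    then show ?thesis by (rule lipschitz_on_continuous_on)
  qed
  have slope: "(7 * L * pi + 1) * \<epsilon>\<^sup>2 \<le> f z * I"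
  proof -
    have "(7 * L * pi + 1) * \<epsilon>\<^sup>2 = m * (C * \<epsilon>\<^sup>2)" using m(1) by (simp add: C_def field_simps)
    also have "\<dots> \<le> f z * I"
      using m zD D I C nnD[OF zD] by (intro mult_mono) (auto simp: I_def)
    finally show ?thesis .
  qed
  \<comment> \<open>The error of \<open>first\<close> is absorbed by the surplus in
    \<open>slope\<close>. No monotonicity in \<open>t\<close> is claimed, only growth measured from
    \<open>t = 0\<close>, which suffices both to reach every target volume and to bound the
    \<open>t\<close> that attains it.\<close>
  have grow: "t * \<epsilon>\<^sup>2 \<le> R t - R 0" if t: "0 \<le> t" "t \<le> \<epsilon> / 12" for t
  proof -
    have "t * ((7 * L * pi + 1) * \<epsilon>\<^sup>2) \<le> t * (f z * I)" using slope t by (intro mult_left_mono) auto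
    then show ?thesis using first[of t] t by (simp add: algebra_simps abs_le_iff)
  qed
  have grow': "R t - R 0 \<le> t * \<epsilon>\<^sup>2" if t: "t \<le> 0" "- (\<epsilon> / 12) \<le> t" for t
  proof -
    have "t * (f z * I) \<le> t * ((7 * L * pi + 1) * \<epsilon>\<^sup>2)" using slope t by (intro mult_left_mono_neg) auto
    then show ?thesis using first[of t] t by (simp add: algebra_simps abs_le_iff)
  qed
  show ?thesis
  proof (rule that[OF \<epsilon> e D[unfolded D_def]])
    fix \<delta> :: real assume \<delta>: "\<bar>\<delta>\<bar> \<le> \<epsilon> ^ 3 / 12"
    \<comment> \<open>At the largest admissible displacement \<epsilon>/12 the growth rate
      \<epsilon>^2 gives the range \<epsilon>^3/12 of attainable volume changes.\<close>
    have e3: "\<epsilon> / 12 * \<epsilon>\<^sup>2 = \<epsilon> ^ 3 / 12" by (simp add: power2_eq_square power3_eq_cube)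
    have "R (- (\<epsilon> / 12)) \<le> R 0 + \<delta>" "R 0 + \<delta> \<le> R (\<epsilon> / 12)"
      using grow[of "\<epsilon> / 12"] grow'[of "- (\<epsilon> / 12)"] \<delta> \<epsilon> e3 by (auto simp: abs_le_iff)
    then obtain t where t: "- (\<epsilon> / 12) \<le> t" "t \<le> \<epsilon> / 12" "R t = R 0 + \<delta>"
      using IVT'[of R "- (\<epsilon> / 12)" "R 0 + \<delta>" "\<epsilon> / 12"] cont \<epsilon> by auto
    then have t': "\<bar>t\<bar> \<le> \<epsilon> / 12" by auto
    have "\<bar>t\<bar> * \<epsilon>\<^sup>2 \<le> \<bar>\<delta>\<bar>"
      using grow[of t] grow'[of t] t by (cases "0 \<le> t") auto
    moreover have "R 0 = measure (fvol U f) (E \<inter> D)"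
    proof -
      have "P 0 ` (E \<inter> D) = E \<inter> D" using P[OF t0] by simp
      then show ?thesis using Qvol[OF t0] by (simp add: R_def)
    qed
    ultimately show "\<exists>t. deform e \<epsilon> t \<and> \<bar>t\<bar> * \<epsilon>\<^sup>2 \<le> \<bar>\<delta>\<bar> \<and>
       measure (fvol U f) (deform.\<Phi> z e \<epsilon> t ` (E \<inter> cball z \<epsilon>)) = measure (fvol U f) (E \<inter> cball z \<epsilon>) + \<delta>"
      using df[OF t'] Qvol[OF t'] t(3) by (intro exI[of _ t]) (simp add: R_def P_def D_def)
  qed
qed

section \<open>Restoring the volume of a modified minimiser\<close>

subsection \<open>Minimisers\<close>

locale minimiser =
  fixes U E :: "R2 set" and f g :: "R2 \<Rightarrow> real" and v :: real
  assumes U: "open U"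
    and fpos: "\<And>x. x \<in> U \<Longrightarrow> 0 < f x" and gpos: "\<And>x. x \<in> U \<Longrightarrow> 0 < g x"
    and fl: "locally_lipschitz_on U f" and gl: "locally_lipschitz_on U g"
    and v: "v > 0"
    and E: "finite_perimeter_in U E" and vol: "wvolume f E = ennreal v"
    and minimal: "\<And>F. finite_perimeter_in U F \<Longrightarrow> wvolume f F = ennreal v \<Longrightarrow>
      wperimeter U g E \<le> wperimeter U g F"
begin

lemma fc: "continuous_on U f" and gc: "continuous_on U g"
  by (rule locally_lipschitz_on_continuous[OF fl], rule locally_lipschitz_on_continuous[OF gl])

lemma EL: "E \<in> sets lebesgue" "E \<subseteq> U" "perimeter E U < \<infinity>"
  using E unfolding finite_perimeter_in_def by auto

lemma emeasure_E: "emeasure (fvol U f) E = ennreal v"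
  using wvolume_eq_fvol[OF U fc EL(1,2)] vol by simp

text \<open>Minimality alone permits an infinite minimum. If \<open>v\<close> is below the volume of
  \<open>U\<close>, a competitor of finite weighted perimeter exists; otherwise positivity of
  \<open>f\<close> makes \<open>U - E\<close> a null set and \<open>E\<close> has no perimeter in
  \<open>U\<close>.\<close>

lemma wperimeter_finite:
  assumes P: "perimeter E U \<noteq> 0"
  shows "wperimeter U g E < \<infinity>"
proof -
  have UL: "U \<in> sets lebesgue" "U - E \<in> sets lebesgue" using U EL(1) by auto
  have "ennreal v < emeasure (fvol U f) U"
  proof (rule ccontr)
    assume "\<not> ?thesis"
    then have le: "emeasure (fvol U f) U \<le> ennreal v" by simp
    have "emeasure (fvol U f) E + emeasure (fvol U f) (U - E) = emeasure (fvol U f) U"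
      using plus_emeasure[of E "fvol U f" "U - E"] EL UL by (simp add: sets_fvol Un_absorb1)
    then have "ennreal v + emeasure (fvol U f) (U - E) \<le> ennreal v + 0" using le emeasure_E by simp
    then have "emeasure (fvol U f) (U - E) = 0" by (subst (asm) ennreal_add_left_cancel_le) simp
    then have "(\<integral>\<^sup>+x. indicator U x * ennreal (f x) * indicator (U - E) x \<partial>lebesgue) = 0"
      unfolding emeasure_fvol[OF U fc UL(2)] .
    then have "AE x in lebesgue. indicator U x * ennreal (f x) * indicator (U - E) x = 0"
      by (subst (asm) nn_integral_0_iff_AE)
         (intro borel_measurable_times_ennreal measurable_fvol_density[OF U fc] borel_measurable_indicator UL)
    then have "AE x in lebesgue. x \<in> U \<longrightarrow> x \<in> E"
      by eventually_elim (use fpos in \<open>auto simp: indicator_def ennreal_eq_0_iff split: if_splits dest!: fpos\<close>)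
    then show False using perimeter_conull[OF EL(1)] P by blast
  qed
  then obtain F where "finite_perimeter_in U F" "wvolume f F = ennreal v" "wperimeter U g F < \<infinity>"
    using finite_wperimeter_competitor[OF U fc gc less_imp_le[OF v]] by blast
  then show ?thesis using minimal[of F] by (auto intro: le_less_trans)
qed

text \<open>The volume lost or gained inside \<^term>\<open>A\<close> is restored by a deformation supported in a disc
  centred at another boundary point, at a weighted perimeter cost proportional to the area of the
  disc that contains \<^term>\<open>A\<close>.\<close>

lemma local_comparison:
  assumes P: "perimeter E U \<noteq> 0" and p: "p \<in> U"
  obtains T C where "T > 0" "C \<ge> 0" "cball p (2 * T) \<subseteq> U"
    "\<And>x r A F. \<lbrakk>x \<in> ball p T; 0 < r; r < T; closed A; A \<subseteq> cball x r; F \<in> sets lebesgue; F \<subseteq> U;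
       perimeter F U < \<infinity>; F - A = E - A\<rbrakk> \<Longrightarrow>
      (\<integral>\<^sup>+x\<in>A. ennreal (g x) \<partial>Dchi U E) \<le> (\<integral>\<^sup>+x\<in>A. ennreal (g x) \<partial>Dchi U F) + ennreal (C * r\<^sup>2)"
proof -
  \<comment> \<open>Perimeter survives the deletion of \<open>p\<close>, so some other point
    \<open>y\<close> has positive perimeter in each of its discs.\<close>
  have "perimeter E (U - {p}) \<noteq> 0" using P perimeter_delete_point[OF EL(1)] by simp
  then have "\<not> (\<forall>y\<in>U - {p}. \<exists>\<rho>>0. perimeter E (ball y \<rho>) = 0)"
    using perimeter_zero_local[OF EL(1), of "U - {p}"] by blast
  then obtain y where y: "y \<in> U" "y \<noteq> p" "\<And>\<rho>. \<rho> > 0 \<Longrightarrow> perimeter E (ball y \<rho>) \<noteq> 0" by blast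
  obtain r1 L1 where 1: "r1 > 0" "cball y r1 \<subseteq> U" "L1-lipschitz_on (cball y r1) f"
    using locally_lipschitz_on_cball[OF U y(1) fl] .
  obtain r2 L where 2: "r2 > 0" "cball y r2 \<subseteq> U" "L-lipschitz_on (cball y r2) g"
    using locally_lipschitz_on_cball[OF U y(1) gl] .
  \<comment> \<open>A third of the distance, here and in \<open>T0\<close>, keeps the disc of the
    correction disjoint from the disc of the modification.\<close>
  define s where "s = min (min r1 r2) (dist p y / 3)"
  have s: "s > 0" "s \<le> dist p y / 3" using 1(1) 2(1) y(2) by (auto simp: s_def)
  have ss: "cball y s \<subseteq> cball y r1" "cball y s \<subseteq> cball y r2" by (auto simp: s_def)
  have sU: "cball y s \<subseteq> U" using ss(1) 1(2) by blast
  obtain z e \<epsilon> where \<epsilon>: "\<epsilon> > 0" "norm e = 1" and zs: "cball z \<epsilon> \<subseteq> cball y s"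
    and var: "\<And>\<delta>. \<bar>\<delta>\<bar> \<le> \<epsilon> ^ 3 / 12 \<Longrightarrow> \<exists>t. deform e \<epsilon> t \<and> \<bar>t\<bar> * \<epsilon>\<^sup>2 \<le> \<bar>\<delta>\<bar> \<and>
       measure (fvol U f) (deform.\<Phi> z e \<epsilon> t ` (E \<inter> cball z \<epsilon>)) = measure (fvol U f) (E \<inter> cball z \<epsilon>) + \<delta>"
    by (rule volume_variation[OF EL(1) y(3) s(1) lipschitz_on_subset[OF 1(3) ss(1)]
          fpos[OF subsetD[OF sU]] U sU fc], assumption, assumption) (rule that)
  define D where "D = cball z \<epsilon>"
  have DU: "D \<subseteq> U" using zs sU by (auto simp: D_def)
  have cD: "compact D" "closed D" "D \<in> sets borel" "D \<in> sets lebesgue" by (auto simp: D_def)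
  have Lg: "L-lipschitz_on D g" by (rule lipschitz_on_subset[OF 2(3)]) (use zs ss(2) in \<open>auto simp: D_def\<close>)
  have L0: "0 \<le> L" using Lg by (rule lipschitz_on_nonneg)
  have "bounded (g ` D)"
    using cD(1) gc DU by (meson compact_continuous_image compact_imp_bounded continuous_on_subset)
  then obtain M where M: "M > 0" "\<And>x. x \<in> D \<Longrightarrow> \<bar>g x\<bar> \<le> M" unfolding bounded_pos by auto
  obtain e0 where e0: "e0 > 0" "cball p e0 \<subseteq> U" using U p open_contains_cball by blast
  define T0 where "T0 = min e0 (dist p y / 3)"
  define B where "B = cball p T0"
  have T0: "T0 > 0" "T0 \<le> dist p y / 3" using e0(1) y(2) by (auto simp: T0_def)
  have BU: "B \<subseteq> U" using e0(2) by (auto simp: B_def T0_def)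
  have cB: "compact B" by (simp add: B_def)
  have disj: "D \<inter> B = {}"
  proof (rule ccontr)
    assume "D \<inter> B \<noteq> {}"
    then obtain q where "q \<in> D" "q \<in> B" by blast
    then have "q \<in> cball y s" "q \<in> cball p T0" using zs by (auto simp: D_def B_def)
    then have "dist y q \<le> s" "dist p q \<le> T0" by simp_all
    moreover have "dist p y \<le> dist p q + dist y q" by (metis dist_triangle dist_commute)
    moreover have "0 < dist p y" using y(2) by simp
    ultimately show False using s(2) T0(2) by linarith
  qed
  have "bounded (f ` B)"
    using cB fc BU by (meson compact_continuous_image compact_imp_bounded continuous_on_subset)
  then obtain N where N: "N > 0" "\<And>x. x \<in> B \<Longrightarrow> \<bar>f x\<bar> \<le> N" unfolding bounded_pos by auto
  \<comment> \<open>The three bounds keep \<open>A\<close> inside \<open>B\<close>, allow r^2 to be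
    estimated by \<open>T\<close>, and bring the volume defect below the attainable
    \<epsilon>^3/12.\<close>
  define T where "T = min (T0 / 2) (min 1 (\<epsilon> ^ 3 / (12 * N * pi)))"
  have T: "T > 0" "2 * T \<le> T0" "T \<le> 1" "N * pi * T \<le> \<epsilon> ^ 3 / 12"
  proof -
    show "T > 0" using T0(1) \<epsilon>(1) N(1) by (simp add: T_def)
    show "2 * T \<le> T0" "T \<le> 1" by (auto simp: T_def min_def)
    have "N * pi * T \<le> N * pi * (\<epsilon> ^ 3 / (12 * N * pi))"
      using N(1) by (intro mult_left_mono) (auto simp: T_def)
    also have "\<dots> = \<epsilon> ^ 3 / 12" using N(1) by simp
    finally show "N * pi * T \<le> \<epsilon> ^ 3 / 12" .
  qed
  define m where "m = measure (Dchi U E) D"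
  have m: "emeasure (Dchi U E) D = ennreal m"
  proof -
    have "emeasure (Dchi U E) D \<le> emeasure (Dchi U E) U"
      using in_sets_Dchi[OF U, of U E] U by (intro emeasure_mono DU) auto
    also have "\<dots> = perimeter E U" by (rule emeasure_Dchi_open[OF EL(1) U U]) auto
    finally have "emeasure (Dchi U E) D \<noteq> top" using EL(3) by auto
    then show ?thesis unfolding m_def by (rule emeasure_eq_ennreal_measure)
  qed
  define c where "c = 12 * M / \<epsilon> + 2 * L"
  \<comment> \<open>The deformation costs at most c|t|m, and |t| is at most the volume defect N pi
    r^2 divided by the rate \<epsilon>^2.\<close>
  define C where "C = c * m * (N * pi) / \<epsilon>\<^sup>2"
  have c0: "0 \<le> c" using M(1) \<epsilon>(1) L0 by (simp add: c_def)
  have m0: "0 \<le> m" by (simp add: m_def)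
  show ?thesis
  proof (rule that[of T C])
    show "T > 0" by (rule T(1))
    show "C \<ge> 0" using c0 m0 N(1) by (simp add: C_def)
    show "cball p (2 * T) \<subseteq> U" using BU T(2) by (auto simp: B_def subset_iff)
    fix x r A F
    assume x: "x \<in> ball p T" and r: "0 < r" "r < T" and A: "closed A" "A \<subseteq> cball x r"
      and F: "F \<in> sets lebesgue" "F \<subseteq> U" "perimeter F U < \<infinity>" and FA: "F - A = E - A"
    have AB: "A \<subseteq> B"
    proof
      fix q assume "q \<in> A"
      then have "dist x q \<le> r" using A(2) by auto
      then have "dist p q \<le> T0" using x r T(2) dist_triangle[of p q x] by simp
      then show "q \<in> B" by (simp add: B_def)
    qed
    have AU: "A \<subseteq> U" using AB BU by blast
    have AD: "A \<inter> D = {}" using AB disj by blast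
    have Ab: "A \<in> sets borel" "A \<in> sets lebesgue" using A(1) by auto
    let ?\<nu> = "fvol U f"
    have nnB: "0 \<le> f q" if "q \<in> B" for q using fpos[of q] BU that by (auto intro: less_imp_le)
    have nnD: "0 \<le> f q" if "q \<in> D" for q using fpos[of q] DU that by (auto intro: less_imp_le)
    have volA: "emeasure ?\<nu> (H \<inter> A) = ennreal (measure ?\<nu> (H \<inter> A))" "measure ?\<nu> (H \<inter> A) \<le> N * pi * r\<^sup>2"
      if H: "H \<in> sets lebesgue" for H
    proof -
      have HA: "H \<inter> A \<in> sets lebesgue" "H \<inter> A \<subseteq> B" using H Ab AB by auto
      show eq: "emeasure ?\<nu> (H \<inter> A) = ennreal (measure ?\<nu> (H \<inter> A))"
        using emeasure_fvol_integral[OF U fc cB BU nnB HA] measure_fvol_integral[OF U fc cB BU nnB HA] by simp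
      have "emeasure ?\<nu> (H \<inter> A) \<le> ennreal N * emeasure lebesgue (H \<inter> A)"
        by (rule emeasure_fvol_le[OF U fc HA(1)]) (use N(2) HA(2) in \<open>auto simp: abs_le_iff\<close>)
      also have "\<dots> \<le> ennreal N * emeasure lebesgue (cball x r)"
        using A(2) by (intro mult_left_mono emeasure_mono) auto
      also have "emeasure lebesgue (cball x r) = ennreal (pi * r\<^sup>2)"
        using content_cball[of r x] r(1) emeasure_eq_measure2[OF lmeasurable_cball[of x r]]
        by (simp add: unit_ball_vol_2)
      also have "ennreal N * ennreal (pi * r\<^sup>2) = ennreal (N * pi * r\<^sup>2)"
        using N(1) by (simp add: ennreal_mult'[symmetric] mult.assoc)
      finally show "measure ?\<nu> (H \<inter> A) \<le> N * pi * r\<^sup>2" unfolding eq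
        using N(1) by (subst (asm) ennreal_le_iff) auto
    qed
    \<comment> \<open>The signed defect: what \<open>F\<close> lacks in \<open>A\<close> compared
      with \<open>E\<close>, to be regained inside \<open>D\<close>.\<close>
    define \<delta> where "\<delta> = measure ?\<nu> (E \<inter> A) - measure ?\<nu> (F \<inter> A)"
    have \<delta>: "\<bar>\<delta>\<bar> \<le> N * pi * r\<^sup>2"
      using volA(2)[OF EL(1)] volA(2)[OF F(1)] measure_nonneg[of ?\<nu> "E \<inter> A"] measure_nonneg[of ?\<nu> "F \<inter> A"]
      unfolding \<delta>_def by linarith
    have "r\<^sup>2 \<le> T * 1" unfolding power2_eq_square using r T(3) by (intro mult_mono) auto
    then have "N * pi * r\<^sup>2 \<le> N * pi * T" using N(1) by (intro mult_left_mono) auto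
    then have "\<bar>\<delta>\<bar> \<le> \<epsilon> ^ 3 / 12" using \<delta> T(4) by linarith
    then obtain t where d: "deform e \<epsilon> t" and t: "\<bar>t\<bar> * \<epsilon>\<^sup>2 \<le> \<bar>\<delta>\<bar>" and
      tv: "measure ?\<nu> (deform.\<Phi> z e \<epsilon> t ` (E \<inter> D)) = measure ?\<nu> (E \<inter> D) + \<delta>"
      using var unfolding D_def by blast
    define \<Phi> where "\<Phi> = deform.\<Phi> z e \<epsilon> t"
    \<comment> \<open>All of \<open>F\<close> is pushed, but only \<open>D\<close> is affected, and
      there \<open>F\<close> coincides with \<open>E\<close> since \<open>A\<close> and
      \<open>D\<close> are disjoint. The volume gain computed for \<open>E\<close> is therefore the
      one obtained for \<open>F\<close>.\<close>
    define G where "G = \<Phi> ` F"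
    have GL: "G \<in> sets lebesgue" unfolding G_def \<Phi>_def by (rule deform.lebesgue_\<Phi>[OF d F(1)])
    have GU: "G \<subseteq> U"
      using deform.image_\<Phi>_eq[OF d DU[unfolded D_def]] F(2) unfolding G_def \<Phi>_def by blast
    have GD: "G - D = F - D" unfolding G_def \<Phi>_def D_def by (rule deform.image_\<Phi>_diff[OF d])
    have FD: "F \<inter> D = E \<inter> D" using FA AD by blast
    have GinD: "G \<inter> D = \<Phi> ` (E \<inter> D)"
    proof -
      have "\<Phi> ` (F \<inter> D) = \<Phi> ` F \<inter> \<Phi> ` D" unfolding \<Phi>_def by (rule image_Int[OF deform.inj_\<Phi>[OF d]])
      moreover have "\<Phi> ` D = D" unfolding \<Phi>_def D_def by (rule deform.image_\<Phi>_eq[OF d subset_refl])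
      ultimately show ?thesis using FD by (simp add: G_def)
    qed
    have GA: "G \<inter> A = F \<inter> A" using GD AD by blast
    have Gout: "G - (D \<union> A) = E - (D \<union> A)" using GD FA by blast
    have Gper: "perimeter G U < \<infinity>"
    proof -
      have "perimeter G U \<le> ennreal (deform.\<kappa> \<epsilon> t) * perimeter F (\<Phi> -` U)"
        unfolding G_def \<Phi>_def by (rule deform.perimeter_\<Phi>[OF d F(1)])
      also have "\<Phi> -` U = U" unfolding \<Phi>_def by (rule deform.vimage_\<Phi>_eq[OF d DU[unfolded D_def]])
      also have "ennreal (deform.\<kappa> \<epsilon> t) * perimeter F U < \<infinity>"
        using F(3) by (simp add: ennreal_mult_less_top)
      finally show ?thesis .
    qed
    have fp: "finite_perimeter_in U G" unfolding finite_perimeter_in_def using GL GU Gper by blast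
    have split: "emeasure ?\<nu> H = emeasure ?\<nu> (H \<inter> D) + (emeasure ?\<nu> (H \<inter> A) + emeasure ?\<nu> (H - (D \<union> A)))"
      if H: "H \<in> sets lebesgue" for H
    proof -
      have "emeasure ?\<nu> (H \<inter> A) + emeasure ?\<nu> (H - (D \<union> A)) = emeasure ?\<nu> ((H \<inter> A) \<union> (H - (D \<union> A)))"
        using H Ab cD(4) by (intro plus_emeasure) (auto simp: sets_fvol intro!: sets.Int sets.Diff sets.Un)
      moreover have "emeasure ?\<nu> (H \<inter> D) + emeasure ?\<nu> ((H \<inter> A) \<union> (H - (D \<union> A)))
          = emeasure ?\<nu> ((H \<inter> D) \<union> ((H \<inter> A) \<union> (H - (D \<union> A))))"
        using H Ab cD(4) AD by (intro plus_emeasure) (auto simp: sets_fvol intro!: sets.Int sets.Diff sets.Un)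
      moreover have "(H \<inter> D) \<union> ((H \<inter> A) \<union> (H - (D \<union> A))) = H" by blast
      ultimately show ?thesis by simp
    qed
    have volD: "emeasure ?\<nu> (H \<inter> D) = ennreal (measure ?\<nu> (H \<inter> D))" if H: "H \<in> sets lebesgue" for H
    proof -
      have HD: "H \<inter> D \<in> sets lebesgue" "H \<inter> D \<subseteq> D" using H cD(4) by auto
      show ?thesis
        using emeasure_fvol_integral[OF U fc cD(1) DU nnD HD] measure_fvol_integral[OF U fc cD(1) DU nnD HD] by simp
    qed
    have "emeasure ?\<nu> (G \<inter> D) + emeasure ?\<nu> (G \<inter> A) = emeasure ?\<nu> (E \<inter> D) + emeasure ?\<nu> (E \<inter> A)"
    proof -
      have "measure ?\<nu> (G \<inter> D) + measure ?\<nu> (G \<inter> A) = measure ?\<nu> (E \<inter> D) + measure ?\<nu> (E \<inter> A)"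
        using tv unfolding GinD GA \<delta>_def \<Phi>_def by simp
      then show ?thesis
        unfolding volD[OF GL] volD[OF EL(1)] volA(1)[OF GL] volA(1)[OF EL(1)]
        by (simp add: ennreal_plus[symmetric] del: ennreal_plus)
    qed
    then have "emeasure ?\<nu> G = emeasure ?\<nu> E"
      unfolding split[OF GL] split[OF EL(1)] Gout by (simp add: add.assoc[symmetric])
    then have "wvolume f G = ennreal v"
      using wvolume_eq_fvol[OF U fc GL GU] emeasure_E by simp
    then have le: "wperimeter U g E \<le> wperimeter U g G" by (rule minimal[OF fp])
    define I where "I H S = (\<integral>\<^sup>+x\<in>S. ennreal (g x) \<partial>Dchi U H)" for H S
    have Isplit: "wperimeter U g H = I H A + (I H D + I H (U - (D \<union> A)))" for H
    proof -
      have "I H (D \<union> A) = I H D + I H A"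
      proof -
        have S: "A \<in> sets (Dchi U H)" "D \<in> sets (Dchi U H)" using in_sets_Dchi[OF U] Ab cD AU DU by auto
        have "I H (D \<union> A) = (\<integral>\<^sup>+x. ennreal (g x) * indicator D x + ennreal (g x) * indicator A x \<partial>Dchi U H)"
          unfolding I_def by (rule nn_integral_cong) (use AD in \<open>auto simp: indicator_def\<close>)
        also have "\<dots> = I H D + I H A"
          unfolding I_def
          by (intro nn_integral_add borel_measurable_times_ennreal measurable_Dchi[OF gc] borel_measurable_indicator S)
        finally show ?thesis .
      qed
      then show ?thesis
        using wperimeter_split[OF U gc, of "D \<union> A" H] Ab(1) cD(3) AU DU by (simp add: I_def ac_simps)
    qed
    have out: "I G (U - (D \<union> A)) = I E (U - (D \<union> A))"
      unfolding I_def
      by (rule nn_integral_Dchi_local[OF GL EL(1) U, of "- (D \<union> A)"])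
         (use Gout A(1) cD U in \<open>auto simp: open_Compl\<close>)
    have inA: "I G A = I F A"
      unfolding I_def
      by (rule nn_integral_Dchi_local[OF GL F(1) U, of "- D"]) (use GD AD AU Ab cD in \<open>auto simp: open_Compl\<close>)
    have inD: "I F D = I E D"
      unfolding I_def
      by (rule nn_integral_Dchi_local[OF F(1) EL(1) U, of "- A"]) (use FA AD DU A(1) cD in \<open>auto simp: open_Compl\<close>)
    have mF: "emeasure (Dchi U F) D = ennreal m"
      unfolding m[symmetric]
      by (rule emeasure_Dchi_local[OF F(1) EL(1) U, of "- A"]) (use FA AD DU A(1) cD in \<open>auto simp: open_Compl\<close>)
    have GDle: "I G D \<le> I E D + ennreal (C * r\<^sup>2)"
    proof -
      have "I G D \<le> I F D + ennreal (c * \<bar>t\<bar>) * emeasure (Dchi U F) D"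
        unfolding I_def G_def \<Phi>_def c_def D_def
        by (rule deform.set_nn_integral_\<Phi>_le[OF d F(1) U DU[unfolded D_def] gc Lg[unfolded D_def]])
           (use M(2) less_imp_le[OF gpos[OF subsetD[OF DU]]] in \<open>auto simp: D_def abs_le_iff\<close>)
      also have "\<dots> = I E D + ennreal (c * \<bar>t\<bar> * m)"
        unfolding inD mF using c0 m0 by (simp add: ennreal_mult'')
      also have "\<dots> \<le> I E D + ennreal (C * r\<^sup>2)"
      proof (intro add_left_mono ennreal_leI)
        have "\<bar>t\<bar> \<le> (N * pi * r\<^sup>2) / \<epsilon>\<^sup>2"
          using t \<delta> \<epsilon>(1) by (simp add: pos_le_divide_eq)
        then have "c * m * \<bar>t\<bar> \<le> c * m * ((N * pi * r\<^sup>2) / \<epsilon>\<^sup>2)"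
          using c0 m0 by (intro mult_left_mono) auto
        then show "c * \<bar>t\<bar> * m \<le> C * r\<^sup>2" by (simp add: C_def mult_ac)
      qed
      finally show ?thesis .
    qed
    \<comment> \<open>The part of the weighted perimeter of \<open>E\<close> outside
      \<open>A\<close> occurs on both sides; it can be cancelled in \<open>ennreal\<close> only
      because it is finite.\<close>
    define X where "X = I E D + I E (U - (D \<union> A))"
    have Xfin: "X \<noteq> \<infinity>"
    proof -
      have "X \<le> wperimeter U g E" unfolding Isplit[of E] X_def by simp
      then show ?thesis using wperimeter_finite[OF P] by auto
    qed
    have "X + I E A = wperimeter U g E" by (simp add: Isplit[of E] X_def ac_simps)
    also have "\<dots> \<le> I F A + (I G D + I E (U - (D \<union> A)))" using le unfolding Isplit[of G] inA out .
    also have "\<dots> \<le> I F A + ((I E D + ennreal (C * r\<^sup>2)) + I E (U - (D \<union> A)))"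
      by (intro add_left_mono add_right_mono GDle)
    also have "\<dots> = X + (I F A + ennreal (C * r\<^sup>2))" by (simp add: X_def ac_simps)
    finally have "I E A \<le> I F A + ennreal (C * r\<^sup>2)"
      using Xfin by (simp add: ennreal_add_left_cancel_le)
    then show "(\<integral>\<^sup>+x\<in>A. ennreal (g x) \<partial>Dchi U E) \<le> (\<integral>\<^sup>+x\<in>A. ennreal (g x) \<partial>Dchi U F) + ennreal (C * r\<^sup>2)"
      by (simp add: I_def)
  qed
qed

end

section \<open>From weighted comparison to the unweighted perimeter\<close>

text \<open>The oscillation \<open>k\<close> of the weight is kept as an added term on the right,
  which avoids truncated subtraction in \<open>ennreal\<close>.\<close>

lemma set_nn_integral_Dchi_ge:
  assumes g: "continuous_on U g" and A: "A \<in> sets (Dchi U F)"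
    and ge: "\<And>x. x \<in> A \<Longrightarrow> m \<le> g x + k" "\<And>x. x \<in> A \<Longrightarrow> 0 \<le> g x" and k: "0 \<le> k"
  shows "ennreal m * emeasure (Dchi U F) A \<le>
    (\<integral>\<^sup>+x\<in>A. ennreal (g x) \<partial>Dchi U F) + ennreal k * emeasure (Dchi U F) A"
proof -
  have "ennreal m * emeasure (Dchi U F) A = (\<integral>\<^sup>+x. ennreal m * indicator A x \<partial>Dchi U F)"
    by (rule nn_integral_cmult_indicator[OF A, symmetric])
  also have "\<dots> \<le> (\<integral>\<^sup>+x. ennreal (g x) * indicator A x + ennreal k * indicator A x \<partial>Dchi U F)"
  proof (rule nn_integral_mono)
    fix x
    show "ennreal m * indicator A x \<le> ennreal (g x) * indicator A x + ennreal k * indicator A x"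
    proof (cases "x \<in> A")
      case True
      then have "ennreal m \<le> ennreal (g x) + ennreal k"
        using ge[of x] k by (simp add: ennreal_leI flip: ennreal_plus)
      then show ?thesis using True by simp
    qed simp
  qed
  also have "\<dots> = (\<integral>\<^sup>+x\<in>A. ennreal (g x) \<partial>Dchi U F) + (\<integral>\<^sup>+x. ennreal k * indicator A x \<partial>Dchi U F)"
    by (intro nn_integral_add borel_measurable_times_ennreal measurable_Dchi[OF g]
        borel_measurable_indicator A borel_measurable_const)
  also have "(\<integral>\<^sup>+x. ennreal k * indicator A x \<partial>Dchi U F) = ennreal k * emeasure (Dchi U F) A"
    by (rule nn_integral_cmult_indicator[OF A])
  finally show ?thesis .
qed

context minimiser
begin

text \<open>The constants are uniform for centres \<open>x\<close> near \<open>p\<close>, which is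
  the form needed for a finite cover.\<close>

lemma local_almost_minimality:
  assumes p: "p \<in> U"
  shows "\<exists>T>0. \<exists>K>0. \<forall>x\<in>ball p T. \<forall>r. 0 < r \<and> r < T \<longrightarrow>
    perimeter E (ball x r)
      - (INF F\<in>{F. finite_perimeter_in U F \<and> compact (closure ((F - E) \<union> (E - F))) \<and>
                   closure ((F - E) \<union> (E - F)) \<subseteq> ball x r}. perimeter F (ball x r))
      \<le> ennreal (K * r\<^sup>2)"
\<comment> \<open>Without perimeter in \<open>U\<close> there is no second boundary point to work
  with, but then the left-hand side is 0 on small discs.\<close>
proof (cases "perimeter E U = 0")
  case True
  obtain e where e: "e > 0" "ball p e \<subseteq> U" using U p open_contains_ball by blast
  have "perimeter E (ball x r) = 0" if "x \<in> ball p (e / 2)" "r < e / 2" for x r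
  proof -
    have "ball x r \<subseteq> ball p e"
    proof
      fix q assume "q \<in> ball x r"
      then show "q \<in> ball p e" using that dist_triangle[of p q x] by simp
    qed
    then show ?thesis using perimeter_mono[of "ball x r" U E] e(2) True by auto
  qed
  then show ?thesis using e(1) by (intro exI[of _ "e / 2"] conjI exI[of _ "1::real"]) auto
next
  case False
  obtain T1 C where T1: "T1 > 0" "C \<ge> 0" "cball p (2 * T1) \<subseteq> U" and
    comp: "\<And>x r A F. \<lbrakk>x \<in> ball p T1; 0 < r; r < T1; closed A; A \<subseteq> cball x r; F \<in> sets lebesgue; F \<subseteq> U;
       perimeter F U < \<infinity>; F - A = E - A\<rbrakk> \<Longrightarrow>
      (\<integral>\<^sup>+x\<in>A. ennreal (g x) \<partial>Dchi U E) \<le> (\<integral>\<^sup>+x\<in>A. ennreal (g x) \<partial>Dchi U F) + ennreal (C * r\<^sup>2)"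
    by (rule local_comparison[OF False p]) (rule that)
  obtain r0 L where r0: "r0 > 0" "cball p r0 \<subseteq> U" "L-lipschitz_on (cball p r0) g"
    using locally_lipschitz_on_cball[OF U p gl] .
  have L0: "0 \<le> L" using r0(3) by (rule lipschitz_on_nonneg)
  have gc': "continuous_on (cball p r0) g" by (rule continuous_on_subset[OF gc r0(2)])
  have ne: "cball p r0 \<noteq> {}" using r0(1) by auto
  obtain a where a: "a \<in> cball p r0" "\<And>x. x \<in> cball p r0 \<Longrightarrow> g a \<le> g x"
    using continuous_attains_inf[OF compact_cball ne gc'] by blast
  obtain b where b: "b \<in> cball p r0" "\<And>x. x \<in> cball p r0 \<Longrightarrow> g x \<le> g b"
    using continuous_attains_sup[OF compact_cball ne gc'] by blast
  have ga: "g a > 0" using gpos a(1) r0(2) by blast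
  have gb: "g b > 0" using gpos b(1) r0(2) by blast
  define T where "T = min T1 (r0 / 2)"
  have T: "T > 0" "T \<le> T1" "2 * T \<le> r0" using T1(1) r0(1) by (auto simp: T_def)
  \<comment> \<open>Deleting the disc gives g(a) P <= 8 pi g(b) r + C r^2 for the perimeter P of
    \<open>E\<close> in it; with r < T the right side is linear in r.\<close>
  define N where "N = (8 * pi * g b + C * T) / g a"
  have N0: "N \<ge> 0" using ga gb T1(2) T(1) by (simp add: N_def)
  \<comment> \<open>The oscillation L r of \<open>g\<close> acts on two perimeters of at most N r
    each; together with \<open>C\<close> this is divided by the minimum of \<open>g\<close>. The
    extra 1 ensures positivity.\<close>
  define K where "K = (2 * L * N + C) / g a + 1"
  have K0: "K > 0" using L0 N0 T1(2) ga by (auto simp: K_def intro!: add_nonneg_pos)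
  have fin: "perimeter E S < \<infinity>" if "S \<subseteq> U" for S
    using perimeter_mono[OF that, of E] EL(3) by auto
  have main: "perimeter E (ball x r) \<le> perimeter F (ball x r) + ennreal (K * r\<^sup>2)"
    if x: "x \<in> ball p T" and r: "0 < r" "r < T" and F: "finite_perimeter_in U F"
      and FE: "compact (closure ((F - E) \<union> (E - F)))" "closure ((F - E) \<union> (E - F)) \<subseteq> ball x r" for x r F
  proof -
    have x1: "x \<in> ball p T1" "r < T1" using x r T(2) by auto
    have cb: "cball x r \<subseteq> cball p r0"
    proof
      fix q assume "q \<in> cball x r"
      then show "q \<in> cball p r0" using x r T(3) dist_triangle[of p q x] by simp
    qed
    then have cU: "cball x r \<subseteq> U" using r0(2) by blast
    then have bU: "ball x r \<subseteq> U" using ball_subset_cball[of x r] by blast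
    have sets: "cball x r \<in> sets (Dchi U H)" "ball x r \<in> sets (Dchi U H)" for H
      using in_sets_Dchi[OF U] cU bU by auto
    have gnn: "0 \<le> g q" if "q \<in> cball x r" for q using less_imp_le[OF gpos] cU that by blast
    define pe where "pe = enn2real (perimeter E (ball x r))"
    have pe: "perimeter E (ball x r) = ennreal pe" "0 \<le> pe"
      using fin[OF bU] by (simp_all add: pe_def)
    have peN: "pe \<le> N * r"
    proof -
      let ?F = "E - cball x r"
      have F': "?F \<in> sets lebesgue" "?F \<subseteq> U" "?F - cball x r = E - cball x r" using EL(1,2) by auto
      have "perimeter ?F U \<le> perimeter E (U - cball x r) + ennreal (8 * pi * r)"
        using perimeter_diff_cball[OF EL(1)] r(1) by simp
      also have "\<dots> < \<infinity>" using fin[of "U - cball x r"] by (simp add: Diff_subset)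
      finally have F'': "perimeter ?F U < \<infinity>" .
      have "ennreal (g a) * perimeter E (ball x r) \<le> ennreal (g a) * emeasure (Dchi U E) (cball x r)"
        using emeasure_Dchi_open[OF EL(1) U open_ball bU] emeasure_mono[OF ball_subset_cball sets(1)]
        by (metis mult_left_mono zero_le)
      also have "\<dots> \<le> (\<integral>\<^sup>+x\<in>cball x r. ennreal (g x) \<partial>Dchi U E)"
      proof -
        have "g a \<le> g q + 0" if "q \<in> cball x r" for q using a(2)[OF subsetD[OF cb that]] by simp
        from set_nn_integral_Dchi_ge[OF gc sets(1)[of E] this gnn order_refl] show ?thesis by simp
      qed
      also have "\<dots> \<le> (\<integral>\<^sup>+x\<in>cball x r. ennreal (g x) \<partial>Dchi U ?F) + ennreal (C * r\<^sup>2)"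
        by (rule comp[OF x1(1) r(1) x1(2) closed_cball subset_refl F'(1,2) F'' F'(3)])
      also have "(\<integral>\<^sup>+x\<in>cball x r. ennreal (g x) \<partial>Dchi U ?F) \<le> ennreal (g b) * emeasure (Dchi U ?F) (cball x r)"
        by (rule set_nn_integral_Dchi_le[OF sets(1)]) (use b(2) cb in blast)
      also have "\<dots> \<le> ennreal (g b) * ennreal (8 * pi * r)"
        by (intro mult_left_mono emeasure_Dchi_diff_cball[OF EL(1) U EL(3) _ cU]) (use r in auto)
      also have "ennreal (g b) * ennreal (8 * pi * r) + ennreal (C * r\<^sup>2) = ennreal (8 * pi * g b * r + C * r\<^sup>2)"
        using gb r T1(2) by (simp add: ennreal_mult[symmetric] ennreal_plus[symmetric] mult_ac del: ennreal_plus)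
      finally have "ennreal (g a * pe) \<le> ennreal (8 * pi * g b * r + C * r\<^sup>2)"
        unfolding pe using ga by (simp add: ennreal_mult' add_right_mono)
      then have "g a * pe \<le> 8 * pi * g b * r + C * r\<^sup>2"
        using gb r T1(2) by (subst (asm) ennreal_le_iff) auto
      also have "C * r\<^sup>2 \<le> C * (T * r)"
        unfolding power2_eq_square using r T1(2) by (intro mult_left_mono mult_right_mono) auto
      finally have "g a * pe \<le> (8 * pi * g b + C * T) * r" by (simp add: algebra_simps)
      then show ?thesis using ga by (simp add: N_def pos_le_divide_eq mult.commute)
    qed
    \<comment> \<open>Comparing on the support of the change, rather than on the whole disc, leaves
      an open region around its complement where \<open>E\<close> and \<open>F\<close> agree
      exactly.\<close>
    define A where "A = closure ((F - E) \<union> (E - F))"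
    have FL: "F \<in> sets lebesgue" "F \<subseteq> U" "perimeter F U < \<infinity>"
      using F unfolding finite_perimeter_in_def by auto
    have A: "closed A" "A \<subseteq> ball x r" "A \<subseteq> cball x r" "A \<subseteq> U" "A \<in> sets borel"
      using FE(2) bU ball_subset_cball[of x r] by (auto simp: A_def)
    have FA: "F - A = E - A"
      using closure_subset[of "(F - E) \<union> (E - F)"] by (auto simp: A_def)
    have AS: "A \<in> sets (Dchi U H)" for H using in_sets_Dchi[OF U] A(4,5) by auto
    show ?thesis
    \<comment> \<open>Only competitors with smaller perimeter matter; for those the perimeter is
      finite and inherits the bound N r.\<close>
    proof (cases "perimeter E (ball x r) \<le> perimeter F (ball x r)")
      case True
      then show ?thesis by (rule order_trans) simp
    next
      case nle: False
      define pf where "pf = enn2real (perimeter F (ball x r))"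
      have pf: "perimeter F (ball x r) = ennreal pf" "0 \<le> pf"
      proof -
        have "perimeter F (ball x r) < \<infinity>" using nle pe(1) by (metis ennreal_less_top infinity_ennreal_def less_trans not_le)
        then show "perimeter F (ball x r) = ennreal pf" by (simp add: pf_def)
      qed (simp add: pf_def)
      have pfe: "pf \<le> pe" using nle pe pf by (simp add: not_le ennreal_less_iff)
      define \<alpha> where "\<alpha> H = measure (Dchi U H) A" for H
      have parts: "emeasure (Dchi U H) A = ennreal (\<alpha> H)" "ph = \<alpha> H + measure (Dchi U H) (ball x r - A)" "0 \<le> \<alpha> H"
        if H: "H \<in> sets lebesgue" "perimeter H (ball x r) = ennreal ph" "0 \<le> ph" for H ph
      proof -
        have S: "ball x r - A \<in> sets (Dchi U H)" using sets(2) AS by blast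
        have e: "emeasure (Dchi U H) (ball x r) = ennreal ph"
          using emeasure_Dchi_open[OF H(1) U open_ball bU] H(2) by simp
        have f1: "emeasure (Dchi U H) A \<noteq> top"
          using emeasure_mono[OF A(2) sets(2)[of H]] e by (auto simp: top_unique)
        have f2: "emeasure (Dchi U H) (ball x r - A) \<noteq> top"
          using emeasure_mono[OF Diff_subset sets(2)[of H], of A] e by (auto simp: top_unique)
        show 1: "emeasure (Dchi U H) A = ennreal (\<alpha> H)"
          unfolding \<alpha>_def by (rule emeasure_eq_ennreal_measure[OF f1])
        show "0 \<le> \<alpha> H" by (simp add: \<alpha>_def)
        have "emeasure (Dchi U H) A + emeasure (Dchi U H) (ball x r - A) = emeasure (Dchi U H) (A \<union> (ball x r - A))"
          by (rule plus_emeasure[OF AS S]) auto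
        also have "A \<union> (ball x r - A) = ball x r" using A(2) by blast
        finally have "ennreal (\<alpha> H + measure (Dchi U H) (ball x r - A)) = ennreal ph"
          unfolding e 1 emeasure_eq_ennreal_measure[OF f2] by (simp add: \<alpha>_def)
        then show "ph = \<alpha> H + measure (Dchi U H) (ball x r - A)"
          by (subst (asm) ennreal_inj) (use H(3) in \<open>auto simp: \<alpha>_def\<close>)
      qed
      have "measure (Dchi U F) (ball x r - A) = measure (Dchi U E) (ball x r - A)"
        unfolding measure_def
        by (subst emeasure_Dchi_local[OF FL(1) EL(1) U, of "- A"]) (use FA A bU in \<open>auto simp: open_Compl\<close>)
      \<comment> \<open>Outside \<open>A\<close> the two variation measures coincide, so the
        difference of the perimeters is the difference of the masses of \<open>A\<close>.\<close>
      then have diff: "pe - pf = \<alpha> E - \<alpha> F" "\<alpha> E \<le> N * r" "\<alpha> F \<le> N * r"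
        using parts(2)[OF EL(1) pe] parts(2)[OF FL(1) pf] pfe peN
          measure_nonneg[of "Dchi U E" "ball x r - A"] by linarith+
      note mE = parts(1)[OF EL(1) pe] and mF = parts(1)[OF FL(1) pf]
      note nnE = parts(3)[OF EL(1) pe] and nnF = parts(3)[OF FL(1) pf]
      have gx: "g a \<le> g x" "0 \<le> g x" using a(2) gnn[of x] cb r by (auto simp: subset_iff)
      have osc: "\<bar>g q - g x\<bar> \<le> L * r" if "q \<in> A" for q
      proof -
        have qr: "q \<in> cball x r" "x \<in> cball x r" using that A(3) r(1) by auto
        then have "dist (g q) (g x) \<le> L * dist q x" "dist q x \<le> r"
          using lipschitz_onD[OF r0(3) subsetD[OF cb qr(1)] subsetD[OF cb qr(2)]] by (auto simp: dist_commute)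
        then show ?thesis using mult_left_mono[of "dist q x" r L] L0 by (simp add: dist_real_def)
      qed
      have k0: "0 \<le> L * r" using L0 r(1) by simp
      \<comment> \<open>On \<open>A\<close> the weight is frozen at the centre \<open>x\<close>,
        from below for \<open>E\<close> and from above for \<open>F\<close>, each time with error L
        r.\<close>
      have "ennreal (g x) * ennreal (\<alpha> E) \<le> (\<integral>\<^sup>+x\<in>A. ennreal (g x) \<partial>Dchi U E) + ennreal (L * r) * ennreal (\<alpha> E)"
        unfolding mE[symmetric]
      proof (rule set_nn_integral_Dchi_ge[OF gc AS _ _ k0])
        show "g x \<le> g q + L * r" if "q \<in> A" for q using osc[OF that] by linarith
        show "0 \<le> g q" if "q \<in> A" for q using gnn that A(3) by blast
      qed
      also have "(\<integral>\<^sup>+x\<in>A. ennreal (g x) \<partial>Dchi U E) \<le> (\<integral>\<^sup>+x\<in>A. ennreal (g x) \<partial>Dchi U F) + ennreal (C * r\<^sup>2)"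
        by (rule comp[OF x1(1) r(1) x1(2) A(1,3) FL FA])
      also have "(\<integral>\<^sup>+x\<in>A. ennreal (g x) \<partial>Dchi U F) \<le> ennreal (g x + L * r) * emeasure (Dchi U F) A"
      proof (rule set_nn_integral_Dchi_le[OF AS])
        show "g q \<le> g x + L * r" if "q \<in> A" for q using osc[OF that] by linarith
      qed
      also have "\<dots> = ennreal (g x + L * r) * ennreal (\<alpha> F)" by (simp add: mF)
      finally have "ennreal (g x * \<alpha> E) \<le> ennreal ((g x + L * r) * \<alpha> F + C * r\<^sup>2 + L * r * \<alpha> E)"
        using gx(2) k0 nnE nnF T1(2)
        by (simp add: ennreal_mult[symmetric] ennreal_plus[symmetric] add_right_mono del: ennreal_plus)
      then have "g x * \<alpha> E \<le> (g x + L * r) * \<alpha> F + C * r\<^sup>2 + L * r * \<alpha> E"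
        using gx(2) k0 nnE nnF T1(2) by (subst (asm) ennreal_le_iff) auto
      then have "g x * (pe - pf) \<le> L * r * (\<alpha> E + \<alpha> F) + C * r\<^sup>2"
        unfolding diff(1) by (simp add: algebra_simps)
      also have "\<dots> \<le> L * r * (2 * (N * r)) + C * r\<^sup>2"
        using diff(2,3) k0 by (intro add_right_mono mult_left_mono) auto
      also have "\<dots> = (2 * L * N + C) * r\<^sup>2" by (simp add: power2_eq_square algebra_simps)
      finally have "g x * (pe - pf) \<le> (2 * L * N + C) * r\<^sup>2" .
      moreover have "g a * (pe - pf) \<le> g x * (pe - pf)" using gx pfe by (intro mult_right_mono) auto
      ultimately have "g a * (pe - pf) \<le> (2 * L * N + C) * r\<^sup>2" by linarith
      then have "pe - pf \<le> (2 * L * N + C) / g a * r\<^sup>2" using ga by (simp add: pos_le_divide_eq mult.commute)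
      also have "\<dots> \<le> K * r\<^sup>2" by (intro mult_right_mono) (auto simp: K_def)
      finally have "pe \<le> pf + K * r\<^sup>2" by simp
      then have "ennreal pe \<le> ennreal (pf + K * r\<^sup>2)" by (rule ennreal_leI)
      then show ?thesis unfolding pe(1) pf(1) using pf(2) K0 by simp
    qed
  qed
  show ?thesis
  proof (intro exI conjI ballI allI impI)
    show "T > 0" "K > 0" by (fact T(1), fact K0)
    fix x r assume x: "x \<in> ball p T" and r: "0 < r \<and> r < T"
    let ?S = "{F. finite_perimeter_in U F \<and> compact (closure ((F - E) \<union> (E - F))) \<and>
                   closure ((F - E) \<union> (E - F)) \<subseteq> ball x r}"
    \<comment> \<open>The infimum and the error term trade places: in this form each competitor can
      be treated separately, and finiteness of the perimeter of \<open>E\<close> allows the exchange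
      back.\<close>
    have "perimeter E (ball x r) - ennreal (K * r\<^sup>2) \<le> (INF F\<in>?S. perimeter F (ball x r))"
    proof (rule INF_greatest)
      fix F assume "F \<in> ?S"
      then show "perimeter E (ball x r) - ennreal (K * r\<^sup>2) \<le> perimeter F (ball x r)"
        using main[OF x, of r F] r by (simp add: ennreal_minus_le_iff add.commute)
    qed
    moreover have "perimeter E (ball x r) \<noteq> top"
    proof -
      have "ball x r \<subseteq> cball p r0"
      proof
        fix q assume "q \<in> ball x r"
        then show "q \<in> cball p r0" using x r T(3) dist_triangle[of p q x] by simp
      qed
      then show ?thesis using fin[OF order_trans[OF _ r0(2)], of "ball x r"] by auto
    qed
    ultimately show "perimeter E (ball x r) - (INF F\<in>?S. perimeter F (ball x r)) \<le> ennreal (K * r\<^sup>2)"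
      by (simp add: ennreal_minus_le_iff add.commute)
  qed
qed

end

section \<open>Uniform constants on relatively compact sets\<close>

theorem mainTheorem3:
  fixes U E :: "R2 set" and f g :: "R2 \<Rightarrow> real" and v :: real
  assumes "open U"
    and "\<forall>x\<in>U. f x > 0" and "\<forall>x\<in>U. g x > 0"
    and "locally_lipschitz_on U f" and "locally_lipschitz_on U g"
    and "v > 0"
    and "finite_perimeter_in U E" and "wvolume f E = ennreal v"
    and "\<forall>F. finite_perimeter_in U F \<and> wvolume f F = ennreal v
             \<longrightarrow> wperimeter U g E \<le> wperimeter U g F"
  shows "\<forall>V. open V \<and> compact (closure V) \<and> closure V \<subseteq> U \<longrightarrow>
          (\<exists>T K. 0 < T \<and> (V \<noteq> {} \<and> frontier U \<noteq> {} \<longrightarrow> T < setdist V (frontier U))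
             \<and> K > 0 \<and>
             (\<forall>x\<in>V. \<forall>r. 0 < r \<and> r < T \<longrightarrow>
                perimeter E (ball x r)
                - (INF F\<in>{F. finite_perimeter_in U F \<and>
                             compact (closure ((F - E) \<union> (E - F))) \<and>
                             closure ((F - E) \<union> (E - F)) \<subseteq> ball x r}.
                     perimeter F (ball x r))
                \<le> ennreal (K * r\<^sup>2)))"
proof (intro allI impI)
  fix V assume V: "open V \<and> compact (closure V) \<and> closure V \<subseteq> U"
  interpret minimiser U E f g v
    by unfold_locales (use assms in auto)
  define ok where "ok x r K \<longleftrightarrow> perimeter E (ball x r)
                - (INF F\<in>{F. finite_perimeter_in U F \<and>
                             compact (closure ((F - E) \<union> (E - F))) \<and>
                             closure ((F - E) \<union> (E - F)) \<subseteq> ball x r}.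
                     perimeter F (ball x r))
                \<le> ennreal (K * r\<^sup>2)" for x r K
  have ok_mono: "ok x r K'" if "ok x r K" "K \<le> K'" for x r K K'
    unfolding ok_def
    by (rule order_trans[OF that(1)[unfolded ok_def]]) (intro ennreal_leI mult_right_mono that(2) zero_le_power2)
  have "\<forall>p\<in>closure V. \<exists>T K. T > 0 \<and> K > 0 \<and> (\<forall>x\<in>ball p T. \<forall>r. 0 < r \<and> r < T \<longrightarrow> ok x r K)"
  proof
    fix p assume "p \<in> closure V"
    then have "p \<in> U" using V by blast
    from local_almost_minimality[OF this]
    show "\<exists>T K. T > 0 \<and> K > 0 \<and> (\<forall>x\<in>ball p T. \<forall>r. 0 < r \<and> r < T \<longrightarrow> ok x r K)"
      unfolding ok_def by meson
  qed
  then obtain T K where TK: "\<And>p. p \<in> closure V \<Longrightarrow> T p > 0" "\<And>p. p \<in> closure V \<Longrightarrow> K p > 0"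
    "\<And>p x r. p \<in> closure V \<Longrightarrow> x \<in> ball p (T p) \<Longrightarrow> 0 < r \<Longrightarrow> r < T p \<Longrightarrow> ok x r (K p)"
    by metis
  \<comment> \<open>The local constants hold on whole discs of centres, so finitely many of them
    control all of \<open>V\<close>.\<close>
  obtain I where I: "I \<subseteq> closure V" "finite I" "closure V \<subseteq> (\<Union>p\<in>I. ball p (T p))"
  proof (rule compactE_image[of "closure V" "closure V" "\<lambda>p. ball p (T p)"])
    show "closure V \<subseteq> (\<Union>p\<in>closure V. ball p (T p))" using TK(1) by force
  qed (use V in auto)
  have sd: "0 < setdist V (frontier U)" if "V \<noteq> {}" "frontier U \<noteq> {}"
  proof -
    have "closure V \<inter> frontier U = {}"
      using V assms(1) by (auto simp: frontier_def interior_open)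
    then have "0 < setdist (closure V) (frontier U)"
      using setdist_gt_0_compact_closed[of "closure V" "frontier U"] V that by simp
    then show ?thesis by simp
  qed
  \<comment> \<open>Half the distance gives the strict inequality. If \<open>V\<close> or the
    frontier is empty, \<open>setdist\<close> is 0 and the distance condition is void, so any
    positive value serves.\<close>
  define d where "d = (if V \<noteq> {} \<and> frontier U \<noteq> {} then setdist V (frontier U) / 2 else 1)"
  define T0 where "T0 = Min (insert d (T ` I))"
  \<comment> \<open>The sum dominates each local constant; the 1 keeps it positive when the cover is
    empty.\<close>
  define K0 where "K0 = 1 + (\<Sum>p\<in>I. K p)"
  have Kp: "0 \<le> K p" if "p \<in> I" for p using TK(2)[of p] I(1) that by (auto intro: less_imp_le)
  show "\<exists>T K. 0 < T \<and> (V \<noteq> {} \<and> frontier U \<noteq> {} \<longrightarrow> T < setdist V (frontier U))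
             \<and> K > 0 \<and>
             (\<forall>x\<in>V. \<forall>r. 0 < r \<and> r < T \<longrightarrow>
                perimeter E (ball x r)
                - (INF F\<in>{F. finite_perimeter_in U F \<and>
                             compact (closure ((F - E) \<union> (E - F))) \<and>
                             closure ((F - E) \<union> (E - F)) \<subseteq> ball x r}.
                     perimeter F (ball x r))
                \<le> ennreal (K * r\<^sup>2))"
    unfolding ok_def[symmetric]
  proof (intro exI conjI ballI allI impI)
    have "0 < d" using sd by (simp add: d_def)
    then show "0 < T0" using TK(1) I(1,2) by (auto simp: T0_def)
    show "0 < K0" using Kp by (simp add: K0_def add_pos_nonneg sum_nonneg)
    have "T0 \<le> d" using I(2) by (simp add: T0_def)
    then show "T0 < setdist V (frontier U)" if "V \<noteq> {} \<and> frontier U \<noteq> {}"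
      using sd that by (simp add: d_def)
    fix x r assume x: "x \<in> V" and r: "0 < r \<and> r < T0"
    obtain p where p: "p \<in> I" "x \<in> ball p (T p)"
      using I(3) x closure_subset[of V] by blast
    have "T0 \<le> T p" using I(2) p(1) by (simp add: T0_def)
    then have "ok x r (K p)" using TK(3)[of p x r] p r I(1) by auto
    moreover have "K p \<le> K0"
      using member_le_sum[of p I K] Kp p(1) I(2) by (simp add: K0_def)
    ultimately show "ok x r K0" by (rule ok_mono)
  qed
qed
end
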